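(* Let $M$ be a real, smooth, orientable $n$-dimensional manifold with a volume form $V$, let $\pi\in\mathcal X^2(M)$ be a Poisson bivector on $M$, and let $m\in C^\infty(M)$ with $m>0$ everywhere. Then $m$ is a last multiplier of $(M,\pi,V)$, i.e. $D_V(m\pi)=0$, if and only if the modular vector field of $\pi$ with respect to the volume form $mV$ vanishes: $X_{\pi,mV}=0$.
   Context: $\mathcal X^k(M)$ is the $C^\infty(M)$-module of $k$-vector fields on $M$ and $\Lambda^k(M)$ the module of differential $k$-forms. For $A\in\mathcal X^k(M)$ the contraction $i_A:\Lambda^p(M)\to\Lambda^{p-k}(M)$ is defined by $\langle i_A\omega,B\rangle=\langle\omega,A\wedge B\rangle$ for all $B\in\mathcal X^{p-k}(M)$ if $p\ge k$, and $i_A\omega=0$ if $p<k$. For a volume form $V$, the map $V^\flat:\mathcal X^k(M)\to\Lambda^{n-k}(M)$, $V^\flat(A)=i_AV$, is a $C^\infty(M)$-isomorphism with inverse $V^\natural$, and the curl operator is $D_V=V^\natural\circ d\circ V^\flat:\mathcal X^k(M)\to\mathcal X^{k-1}(M)$. For $f\in C^\infty(M)$, $A_f$ denotes the Hamiltonian vector field of $f$ with respect to the Poisson bracket $\{\cdot,\cdot\}$ induced by $\pi$. For a volume form $W$, the divergence $\mathrm{div}_W X$ of a vector field $X$ is defined by $L_XW=(\mathrm{div}_WX)W$, and the modular vector field $X_{\pi,W}$ is the unique vector field such that $\mathrm{div}_W A_f=X_{\pi,W}(f)$ for all $f\in C^\infty(M)$. *)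

theory Defs
  imports "HOL-Analysis.Analysis"
begin

section \<open>Smooth manifolds and smooth functions\<close>

(* Used only for open S. The derivative is tested in each fixed direction v,
   which in finite dimension is the same as testing it as a linear map. *)
primrec Ck_on ::
  "nat \<Rightarrow> 'e::real_normed_vector set \<Rightarrow> ('e \<Rightarrow> 'f::real_normed_vector) \<Rightarrow> bool" where
  "Ck_on 0 S f \<longleftrightarrow> continuous_on S f"
| "Ck_on (Suc k) S f \<longleftrightarrow>
     f differentiable_on S \<and> (\<forall>v. Ck_on k S (\<lambda>x. frechet_derivative f (at x) v))"

definition smooth_on ::
  "'e::real_normed_vector set \<Rightarrow> ('e \<Rightarrow> 'f::real_normed_vector) \<Rightarrow> bool" where
  "smooth_on S f \<longleftrightarrow> (\<forall>k. Ck_on k S f)"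

(* A chart is a pair (U, \<phi>) of an open set U and a homeomorphism \<phi> of U onto an open subset of
   the model space; the values of \<phi> outside U are irrelevant.  The manifold is the whole type 'a,
   Hausdorff and second countable by its type class, and its dimension is DIM('e). *)
type_synonym ('a, 'e) atlas = "('a set \<times> ('a \<Rightarrow> 'e)) set"

definition smooth_manifold ::
  "('a::{t2_space,second_countable_topology}, 'e::euclidean_space) atlas \<Rightarrow> bool" where
  "smooth_manifold M \<longleftrightarrow>
     (\<Union>(U, \<phi>)\<in>M. U) = UNIV \<and>
     (\<forall>(U, \<phi>)\<in>M. open U \<and> open (\<phi> ` U) \<and> homeomorphism U (\<phi> ` U) \<phi> (inv_into U \<phi>)) \<and>
     (\<forall>(U, \<phi>)\<in>M. \<forall>(U', \<psi>)\<in>M. smooth_on (\<phi> ` (U \<inter> U')) (\<psi> \<circ> inv_into U \<phi>))"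

definition mdim :: "('a, 'e::euclidean_space) atlas \<Rightarrow> nat" where
  "mdim M = DIM('e)"

definition smooth_funs :: "('a, 'e::euclidean_space) atlas \<Rightarrow> ('a \<Rightarrow> real) set" where
  "smooth_funs M = {f. \<forall>(U, \<phi>)\<in>M. smooth_on (\<phi> ` U) (f \<circ> inv_into U \<phi>)}"

section \<open>Tangent vectors and vector fields\<close>

(* Tangent vectors at p are the point derivations of the smooth functions at p, extended by 0 to
   all other functions so that equality of tangent vectors is equality in HOL. *)
type_synonym 'a tvec = "('a \<Rightarrow> real) \<Rightarrow> real"

definition tangent :: "('a, 'e::euclidean_space) atlas \<Rightarrow> 'a \<Rightarrow> 'a tvec set" where
  "tangent M p = {v.
     (\<forall>f. f \<notin> smooth_funs M \<longrightarrow> v f = 0) \<and>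
     (\<forall>f\<in>smooth_funs M. \<forall>g\<in>smooth_funs M. \<forall>a b.
        v (\<lambda>x. a * f x + b * g x) = a * v f + b * v g) \<and>
     (\<forall>f\<in>smooth_funs M. \<forall>g\<in>smooth_funs M.
        v (\<lambda>x. f x * g x) = f p * v g + g p * v f)}"

type_synonym 'a vfield = "'a \<Rightarrow> 'a tvec"

definition vfields :: "('a, 'e::euclidean_space) atlas \<Rightarrow> 'a vfield set" where
  "vfields M = {X. (\<forall>p. X p \<in> tangent M p) \<and>
     (\<forall>f\<in>smooth_funs M. (\<lambda>p. X p f) \<in> smooth_funs M)}"

definition lie_bracket ::
  "('a, 'e::euclidean_space) atlas \<Rightarrow> 'a vfield \<Rightarrow> 'a vfield \<Rightarrow> 'a vfield" where
  "lie_bracket M X Y = (\<lambda>p f.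
     if f \<in> smooth_funs M then X p (\<lambda>q. Y q f) - Y p (\<lambda>q. X q f) else 0)"

section \<open>Differential forms\<close>

(* A k-covector at p takes a list of k tangent vectors at p, and is 0 on every other list. *)
type_synonym 'a covec = "'a tvec list \<Rightarrow> real"

definition tuples :: "('a, 'e::euclidean_space) atlas \<Rightarrow> 'a \<Rightarrow> nat \<Rightarrow> 'a tvec list set" where
  "tuples M p k = {vs. length vs = k \<and> set vs \<subseteq> tangent M p}"

definition covectors :: "('a, 'e::euclidean_space) atlas \<Rightarrow> 'a \<Rightarrow> nat \<Rightarrow> 'a covec set" where
  "covectors M p k = {\<omega>.
     (\<forall>vs. vs \<notin> tuples M p k \<longrightarrow> \<omega> vs = 0) \<and>
     (\<forall>us ws. \<forall>v\<in>tangent M p. \<forall>w\<in>tangent M p. \<forall>a b. us @ v # ws \<in> tuples M p k \<longrightarrow>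
        \<omega> (us @ (\<lambda>f. a * v f + b * w f) # ws) = a * \<omega> (us @ v # ws) + b * \<omega> (us @ w # ws)) \<and>
     (\<forall>vs\<in>tuples M p k. \<forall>i j. i < j \<longrightarrow> j < k \<longrightarrow> vs ! i = vs ! j \<longrightarrow> \<omega> vs = 0)}"

type_synonym 'a form = "'a \<Rightarrow> 'a covec"

definition form_eval :: "'a form \<Rightarrow> 'a vfield list \<Rightarrow> 'a \<Rightarrow> real" where
  "form_eval \<omega> Xs = (\<lambda>p. \<omega> p (map (\<lambda>X. X p) Xs))"

definition forms :: "('a, 'e::euclidean_space) atlas \<Rightarrow> nat \<Rightarrow> 'a form set" where
  "forms M k = {\<omega>. (\<forall>p. \<omega> p \<in> covectors M p k) \<and>
     (\<forall>Xs. length Xs = k \<longrightarrow> set Xs \<subseteq> vfields M \<longrightarrow> form_eval \<omega> Xs \<in> smooth_funs M)}"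

definition volume_form :: "('a, 'e::euclidean_space) atlas \<Rightarrow> 'a form \<Rightarrow> bool" where
  "volume_form M V \<longleftrightarrow> V \<in> forms M (mdim M) \<and> (\<forall>p. \<exists>vs. V p vs \<noteq> 0)"

definition ext_d :: "('a, 'e::euclidean_space) atlas \<Rightarrow> nat \<Rightarrow> 'a form \<Rightarrow> 'a form" where
  "ext_d M k \<omega> = (THE \<eta>. \<eta> \<in> forms M (Suc k) \<and>
     (\<forall>Xs p. length Xs = Suc k \<longrightarrow> set Xs \<subseteq> vfields M \<longrightarrow>
        form_eval \<eta> Xs p =
          (\<Sum>i\<le>k. (-1) ^ i * (Xs ! i) p (form_eval \<omega> (nths Xs (- {i})))) +
          (\<Sum>j\<le>k. \<Sum>i<j. (-1) ^ (i + j) *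
             form_eval \<omega> (lie_bracket M (Xs ! i) (Xs ! j) # nths Xs (- {i, j})) p)))"

definition lie_derivative ::
  "('a, 'e::euclidean_space) atlas \<Rightarrow> nat \<Rightarrow> 'a vfield \<Rightarrow> 'a form \<Rightarrow> 'a form" where
  "lie_derivative M k X \<omega> = (THE \<eta>. \<eta> \<in> forms M k \<and>
     (\<forall>Ys p. length Ys = k \<longrightarrow> set Ys \<subseteq> vfields M \<longrightarrow>
        form_eval \<eta> Ys p =
          X p (form_eval \<omega> Ys) - (\<Sum>i<k. form_eval \<omega> (Ys[i := lie_bracket M X (Ys ! i)]) p)))"

definition divergence ::
  "('a, 'e::euclidean_space) atlas \<Rightarrow> 'a form \<Rightarrow> 'a vfield \<Rightarrow> 'a \<Rightarrow> real" where
  "divergence M W X = (THE g. g \<in> smooth_funs M \<and>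
     lie_derivative M (mdim M) X W = (\<lambda>p vs. g p * W p vs))"

section \<open>Multivector fields\<close>

(* The exterior power of the tangent space at p, realized inside the dual of the k-covectors: it is
   spanned by the decomposable v1 \<and> ... \<and> vk, which send \<omega> to \<omega> [v1, ..., vk].  The
   pairing of a k-covector \<omega> with a k-vector A is therefore A \<omega>.  As for tangent vectors,
   values outside the k-covectors are 0. *)
type_synonym 'a kvec = "'a covec \<Rightarrow> real"

definition decomp :: "('a, 'e::euclidean_space) atlas \<Rightarrow> 'a \<Rightarrow> 'a tvec list \<Rightarrow> 'a kvec" where
  "decomp M p vs = (\<lambda>\<omega>. if \<omega> \<in> covectors M p (length vs) then \<omega> vs else 0)"

inductive_set kvectors :: "('a, 'e::euclidean_space) atlas \<Rightarrow> 'a \<Rightarrow> nat \<Rightarrow> 'a kvec set"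
  for M :: "('a, 'e::euclidean_space) atlas" and p :: 'a and k :: nat where
  zero: "(\<lambda>\<omega>. 0) \<in> kvectors M p k"
| add: "vs \<in> tuples M p k \<Longrightarrow> A \<in> kvectors M p k \<Longrightarrow>
     (\<lambda>\<omega>. c * decomp M p vs \<omega> + A \<omega>) \<in> kvectors M p k"

(* On decomposables: (u1 \<and> ... \<and> uk) \<and> (v1 \<and> ... \<and> vl) = u1 \<and> ... \<and> vl. *)
definition wedge ::
  "('a, 'e::euclidean_space) atlas \<Rightarrow> 'a \<Rightarrow> nat \<Rightarrow> nat \<Rightarrow> 'a kvec \<Rightarrow> 'a kvec \<Rightarrow> 'a kvec" where
  "wedge M p k l A B = (\<lambda>\<omega>.
     if \<omega> \<in> covectors M p (k + l) then A (\<lambda>us. B (\<lambda>vs. \<omega> (us @ vs))) else 0)"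

(* For A of degree k and \<omega> of degree q.  This prescribes the pairing of the contraction with the
   decomposables only; contraction_pairing below gives it for all multivectors. *)
definition contraction ::
  "('a, 'e::euclidean_space) atlas \<Rightarrow> 'a \<Rightarrow> nat \<Rightarrow> nat \<Rightarrow> 'a kvec \<Rightarrow> 'a covec \<Rightarrow> 'a covec" where
  "contraction M p k q A \<omega> = (\<lambda>vs.
     if k \<le> q \<and> vs \<in> tuples M p (q - k) then wedge M p k (q - k) A (decomp M p vs) \<omega> else 0)"

type_synonym 'a kvfield = "'a \<Rightarrow> 'a kvec"

definition kvfields :: "('a, 'e::euclidean_space) atlas \<Rightarrow> nat \<Rightarrow> 'a kvfield set" where
  "kvfields M k = {A. (\<forall>p. A p \<in> kvectors M p k) \<and>
     (\<forall>\<omega>\<in>forms M k. (\<lambda>p. A p (\<omega> p)) \<in> smooth_funs M)}"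

definition flat :: "('a, 'e::euclidean_space) atlas \<Rightarrow> 'a form \<Rightarrow> nat \<Rightarrow> 'a kvfield \<Rightarrow> 'a form" where
  "flat M V k A = (\<lambda>p. contraction M p k (mdim M) (A p) (V p))"

definition natural :: "('a, 'e::euclidean_space) atlas \<Rightarrow> 'a form \<Rightarrow> nat \<Rightarrow> 'a form \<Rightarrow> 'a kvfield"
  where "natural M V k = inv_into (kvfields M k) (flat M V k)"

(* For k > mdim M the form flat M V k A and its differential vanish.  The truncated degree
   mdim M - k is then harmless, since the zero form is the same function in every degree. *)
definition curl :: "('a, 'e::euclidean_space) atlas \<Rightarrow> 'a form \<Rightarrow> nat \<Rightarrow> 'a kvfield \<Rightarrow> 'a kvfield"
  where "curl M V k A = natural M V (k - 1) (ext_d M (mdim M - k) (flat M V k A))"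

(* Multiplication of a form or multivector field by a function. *)
definition fscale :: "('a \<Rightarrow> real) \<Rightarrow> ('a \<Rightarrow> 'b \<Rightarrow> real) \<Rightarrow> ('a \<Rightarrow> 'b \<Rightarrow> real)" where
  "fscale m T = (\<lambda>p x. m p * T p x)"

section \<open>Poisson structures\<close>

definition differential ::
  "('a, 'e::euclidean_space) atlas \<Rightarrow> ('a \<Rightarrow> real) \<Rightarrow> 'a form" where
  "differential M f = (\<lambda>p vs. if vs \<in> tuples M p 1 then (vs ! 0) f else 0)"

definition wedge11 :: "('a, 'e::euclidean_space) atlas \<Rightarrow> 'a form \<Rightarrow> 'a form \<Rightarrow> 'a form" where
  "wedge11 M \<alpha> \<beta> = (\<lambda>p vs. if vs \<in> tuples M p 2
     then \<alpha> p [vs ! 0] * \<beta> p [vs ! 1] - \<alpha> p [vs ! 1] * \<beta> p [vs ! 0] else 0)"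

definition bracket ::
  "('a, 'e::euclidean_space) atlas \<Rightarrow> 'a kvfield \<Rightarrow> ('a \<Rightarrow> real) \<Rightarrow> ('a \<Rightarrow> real) \<Rightarrow> 'a \<Rightarrow> real" where
  "bracket M \<pi> f g = (\<lambda>p. \<pi> p (wedge11 M (differential M f) (differential M g) p))"

definition poisson_bivector :: "('a, 'e::euclidean_space) atlas \<Rightarrow> 'a kvfield \<Rightarrow> bool" where
  "poisson_bivector M \<pi> \<longleftrightarrow> \<pi> \<in> kvfields M 2 \<and>
     (\<forall>f\<in>smooth_funs M. \<forall>g\<in>smooth_funs M. \<forall>h\<in>smooth_funs M. \<forall>p.
        bracket M \<pi> f (bracket M \<pi> g h) p + bracket M \<pi> g (bracket M \<pi> h f) p +
        bracket M \<pi> h (bracket M \<pi> f g) p = 0)"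

(* Sign convention: A_f g = {f, g}. *)
definition hamiltonian ::
  "('a, 'e::euclidean_space) atlas \<Rightarrow> 'a kvfield \<Rightarrow> ('a \<Rightarrow> real) \<Rightarrow> 'a vfield" where
  "hamiltonian M \<pi> f = (\<lambda>p g. if g \<in> smooth_funs M then bracket M \<pi> f g p else 0)"

definition modular_vfield ::
  "('a, 'e::euclidean_space) atlas \<Rightarrow> 'a kvfield \<Rightarrow> 'a form \<Rightarrow> 'a vfield" where
  "modular_vfield M \<pi> W = (THE X. X \<in> vfields M \<and>
     (\<forall>f\<in>smooth_funs M. divergence M W (hamiltonian M \<pi> f) = (\<lambda>p. X p f)))"

definition last_multiplier ::
  "('a, 'e::euclidean_space) atlas \<Rightarrow> 'a kvfield \<Rightarrow> 'a form \<Rightarrow> ('a \<Rightarrow> real) \<Rightarrow> bool" where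
  "last_multiplier M \<pi> V m \<longleftrightarrow> curl M V 2 (fscale m \<pi>) = (\<lambda>p \<omega>. 0)"

section \<open>The defining identity of the contraction\<close>

lemma kvectors_linear:
  assumes "A \<in> kvectors M p k" "\<alpha> \<in> covectors M p k" "\<beta> \<in> covectors M p k"
    "(\<lambda>vs. a * \<alpha> vs + b * \<beta> vs) \<in> covectors M p k"
  shows "A (\<lambda>vs. a * \<alpha> vs + b * \<beta> vs) = a * A \<alpha> + b * A \<beta>"
  using assms
proof (induction rule: kvectors.induct)
  case (add vs A c)
  then have "length vs = k" by (simp add: tuples_def)
  with add show ?case by (simp add: decomp_def algebra_simps)
qed simp

lemma covectors_comb:
  assumes "\<alpha> \<in> covectors M p k" "\<beta> \<in> covectors M p k"
  shows "(\<lambda>vs. a * \<alpha> vs + b * \<beta> vs) \<in> covectors M p k"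
  using assms unfolding covectors_def by (simp add: algebra_simps)

lemma covectors_zero: "(\<lambda>vs. 0) \<in> covectors M p k"
  by (simp add: covectors_def)

lemma kvectors_at_zero: "A \<in> kvectors M p k \<Longrightarrow> A (\<lambda>vs. 0) = 0"
  by (induction rule: kvectors.induct) (simp_all add: decomp_def)

lemma covectors_append_right:
  assumes "\<omega> \<in> covectors M p (k + l)" "vs \<in> tuples M p l"
  shows "(\<lambda>us. \<omega> (us @ vs)) \<in> covectors M p k"
proof -
  have t: "us @ vs \<in> tuples M p (k + l) \<longleftrightarrow> us \<in> tuples M p k" for us
    using assms(2) by (auto simp: tuples_def)
  show ?thesis
    unfolding covectors_def
  proof (intro CollectI conjI allI ballI impI)
    fix us assume "us \<notin> tuples M p k"
    then show "\<omega> (us @ vs) = 0" using assms(1) t unfolding covectors_def by blast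
  next
    fix us ws v w a b
    assume "v \<in> tangent M p" "w \<in> tangent M p" "us @ v # ws \<in> tuples M p k"
    then show "\<omega> ((us @ (\<lambda>f. a * v f + b * w f) # ws) @ vs) =
        a * \<omega> ((us @ v # ws) @ vs) + b * \<omega> ((us @ w # ws) @ vs)"
      using assms(1) t[of "us @ v # ws"] unfolding covectors_def by simp
  next
    fix us i j assume *: "us \<in> tuples M p k" "i < j" "j < k" "us ! i = us ! j"
    then have "(us @ vs) ! i = (us @ vs) ! j" by (simp add: nth_append tuples_def)
    moreover have "us @ vs \<in> tuples M p (k + l)" using t * by blast
    ultimately show "\<omega> (us @ vs) = 0"
      using assms(1) * unfolding covectors_def by (auto dest!: bspec)
  qed
qed

lemma covectors_append_left:
  assumes "\<omega> \<in> covectors M p (k + l)" "us \<in> tuples M p k"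
  shows "(\<lambda>vs. \<omega> (us @ vs)) \<in> covectors M p l"
proof -
  have t: "us @ vs \<in> tuples M p (k + l) \<longleftrightarrow> vs \<in> tuples M p l" for vs
    using assms(2) by (auto simp: tuples_def)
  have lu: "length us = k" using assms(2) by (simp add: tuples_def)
  show ?thesis
    unfolding covectors_def
  proof (intro CollectI conjI allI ballI impI)
    fix vs assume "vs \<notin> tuples M p l"
    then show "\<omega> (us @ vs) = 0" using assms(1) t unfolding covectors_def by blast
  next
    fix xs ws v w a b
    assume "v \<in> tangent M p" "w \<in> tangent M p" "xs @ v # ws \<in> tuples M p l"
    then have "(us @ xs) @ v # ws \<in> tuples M p (k + l)" and
      "v \<in> tangent M p" "w \<in> tangent M p" using t by auto
    then have "\<omega> ((us @ xs) @ (\<lambda>f. a * v f + b * w f) # ws) =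
        a * \<omega> ((us @ xs) @ v # ws) + b * \<omega> ((us @ xs) @ w # ws)"
      using assms(1) unfolding covectors_def by blast
    then show "\<omega> (us @ xs @ (\<lambda>f. a * v f + b * w f) # ws) =
        a * \<omega> (us @ xs @ v # ws) + b * \<omega> (us @ xs @ w # ws)" by simp
  next
    fix vs i j assume *: "vs \<in> tuples M p l" "i < j" "j < l" "vs ! i = vs ! j"
    have "(us @ vs) ! (k + i) = (us @ vs) ! (k + j)"
      using lu * by (simp add: nth_append)
    moreover have "us @ vs \<in> tuples M p (k + l)" "k + i < k + j" "k + j < k + l"
      using t * by auto
    ultimately show "\<omega> (us @ vs) = 0"
      using assms(1) unfolding covectors_def by blast
  qed
qed

lemma wedge_decomp:
  assumes "A \<in> kvectors M p k" "\<omega> \<in> covectors M p (k + l)" "vs \<in> tuples M p l"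
  shows "wedge M p k l A (decomp M p vs) \<omega> = A (\<lambda>us. \<omega> (us @ vs))"
proof -
  have "decomp M p vs (\<lambda>vs. \<omega> (us @ vs)) = \<omega> (us @ vs)" for us
  proof (cases "us \<in> tuples M p k")
    case True
    with covectors_append_left[OF assms(2) True] assms(3) show ?thesis
      by (simp add: decomp_def tuples_def)
  next
    case False
    with assms(3) have "us @ vs \<notin> tuples M p (k + l)" by (auto simp: tuples_def)
    with assms(2) show ?thesis by (simp add: decomp_def covectors_def)
  qed
  with assms(2) show ?thesis by (simp add: wedge_def)
qed

lemma contraction_apply:
  assumes "A \<in> kvectors M p k" "\<omega> \<in> covectors M p q" "k \<le> q" "vs \<in> tuples M p (q - k)"
  shows "contraction M p k q A \<omega> vs = A (\<lambda>us. \<omega> (us @ vs))"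
  using assms wedge_decomp[of A M p k \<omega> "q - k" vs] by (simp add: contraction_def)

lemma wedge_decomp_left:
  assumes "us \<in> tuples M p k" "vs \<in> tuples M p l"
  shows "wedge M p k l (decomp M p us) (decomp M p vs) = decomp M p (us @ vs)"
proof
  fix \<omega>
  have d: "decomp M p us \<in> kvectors M p k"
    using kvectors.add[OF assms(1) kvectors.zero, of 1] by simp
  have l: "length us = k" "length vs = l" using assms by (auto simp: tuples_def)
  show "wedge M p k l (decomp M p us) (decomp M p vs) \<omega> = decomp M p (us @ vs) \<omega>"
  proof (cases "\<omega> \<in> covectors M p (k + l)")
    case True
    show ?thesis
      using wedge_decomp[OF d True assms(2)] covectors_append_right[OF True assms(2)] True l
      by (simp add: decomp_def)
  qed (use l in \<open>simp add: wedge_def decomp_def\<close>)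
qed

lemma contraction_covectors:
  assumes "A \<in> kvectors M p k" "\<omega> \<in> covectors M p q"
  shows "contraction M p k q A \<omega> \<in> covectors M p (q - k)"
proof (cases "k \<le> q")
  case False
  then show ?thesis by (simp add: contraction_def covectors_zero)
next
  case True
  define l where "l = q - k"
  have q: "q = k + l" using True by (simp add: l_def)
  have om: "\<omega> \<in> covectors M p (k + l)" using assms(2) q by simp
  show ?thesis using assms(1)
  proof (induction rule: kvectors.induct)
    case zero
    have "contraction M p k q (\<lambda>\<omega>. 0) \<omega> = (\<lambda>vs. 0)"
      by (simp add: contraction_def wedge_def fun_eq_iff)
    then show ?case by (simp add: covectors_zero)
  next
    case (add us A c)
    have "contraction M p k q (\<lambda>\<omega>. c * decomp M p us \<omega> + A \<omega>) \<omega> vs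
        = c * \<omega> (us @ vs) + 1 * contraction M p k q A \<omega> vs" for vs
    proof (cases "vs \<in> tuples M p l")
      case True
      have "length us = k" using add(1) by (simp add: tuples_def)
      moreover have "(\<lambda>\<omega>. c * decomp M p us \<omega> + A \<omega>) \<in> kvectors M p k"
        by (rule kvectors.add[OF add(1,2)])
      ultimately show ?thesis
        using contraction_apply[OF _ assms(2) \<open>k \<le> q\<close>, of _ vs]
          covectors_append_right[OF om True] True add(2)
        by (simp add: l_def decomp_def)
    next
      case False
      have "us @ vs \<notin> tuples M p (k + l)" using False add(1) by (auto simp: tuples_def)
      then have "\<omega> (us @ vs) = 0" using om unfolding covectors_def by blast
      with False show ?thesis by (simp add: contraction_def l_def)
    qed
    then have "contraction M p k q (\<lambda>\<omega>. c * decomp M p us \<omega> + A \<omega>) \<omega>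
        = (\<lambda>vs. c * \<omega> (us @ vs) + 1 * contraction M p k q A \<omega> vs)" by blast
    with covectors_comb[OF covectors_append_left[OF om add(1)] add.IH[folded l_def], of c 1]
    show ?case by (simp add: l_def)
  qed
qed

theorem contraction_pairing:
  assumes A: "A \<in> kvectors M p k" and \<omega>: "\<omega> \<in> covectors M p (k + l)"
    and B: "B \<in> kvectors M p l"
  shows "B (contraction M p k (k + l) A \<omega>) = wedge M p k l A B \<omega>"
proof -
  have "B (contraction M p k (k + l) A \<omega>) = wedge M p k l A B \<omega> \<and>
      (\<lambda>us. B (\<lambda>vs. \<omega> (us @ vs))) \<in> covectors M p k"
    using B
  proof (induction rule: kvectors.induct)
    case zero
    then show ?case using \<omega> kvectors_at_zero[OF A] by (simp add: wedge_def covectors_zero)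
  next
    case (add ws B c)
    have lw: "length ws = l" using add(1) by (simp add: tuples_def)
    have dd: "decomp M p ws (\<lambda>vs. \<omega> (us @ vs)) = \<omega> (us @ ws)" for us
    proof (cases "us \<in> tuples M p k")
      case True
      then show ?thesis using covectors_append_left[OF \<omega> True] lw by (simp add: decomp_def)
    next
      case False
      then have "us @ ws \<notin> tuples M p (k + l)" using add(1) by (auto simp: tuples_def)
      then show ?thesis using \<omega> by (simp add: decomp_def covectors_def)
    qed
    have r: "(\<lambda>us. \<omega> (us @ ws)) \<in> covectors M p k"
      using covectors_append_right[OF \<omega> add(1)] .
    have rB: "(\<lambda>us. B (\<lambda>vs. \<omega> (us @ vs))) \<in> covectors M p k" using add.IH by blast
    note comb = covectors_comb[OF r rB, of c 1]
    have "wedge M p k l A (\<lambda>\<omega>. c * decomp M p ws \<omega> + B \<omega>) \<omega>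
        = A (\<lambda>us. c * \<omega> (us @ ws) + 1 * B (\<lambda>vs. \<omega> (us @ vs)))"
      using \<omega> dd by (simp add: wedge_def)
    also have "\<dots> = c * A (\<lambda>us. \<omega> (us @ ws)) + 1 * A (\<lambda>us. B (\<lambda>vs. \<omega> (us @ vs)))"
      by (rule kvectors_linear[OF A r rB comb])
    also have "A (\<lambda>us. \<omega> (us @ ws)) = contraction M p k (k + l) A \<omega> ws"
      using contraction_apply[OF A \<omega>, of ws] add(1) by simp
    also have "\<dots> = decomp M p ws (contraction M p k (k + l) A \<omega>)"
      using contraction_covectors[OF A \<omega>] lw by (simp add: decomp_def)
    also have "A (\<lambda>us. B (\<lambda>vs. \<omega> (us @ vs))) = B (contraction M p k (k + l) A \<omega>)"
      using add.IH \<omega> by (simp add: wedge_def)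
    finally show ?case using comb dd by simp
  qed
  then show ?thesis by blast
qed

end

theory Submission
  imports Defs
begin

text \<open>
Write $W = mV$ and $\sigma = i_{m\pi} V = i_\pi W$. The map $f \mapsto \mathrm{div}_W A_f$ is a
derivation because the bracket is antisymmetric, so the modular field $X$ exists. In coordinates,
with $w$ the density of $W$,
\[ w\, X(x_c) = \sum_b \partial_b (w \{x_c, x_b\}), \]
and the right-hand side is also the value of $d\sigma$ on the coordinate fields other than
$\partial_c$. Hence $d\sigma = i_X W = i_{mX} V$, that is $D_V(m\pi) = m X$, and $m > 0$.

Smooth functions exist in abundance (bump functions), and Hadamard's lemma makes every point
derivation a combination of partial derivatives, so each point has a neighbourhood with a coordinate
frame of globally defined vector fields. The Koszul formula for $d$ is shown to be tensorial and
alternating by induction on the degree, using $i_X d = L_X - d i_X$.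
\<close>

section \<open>Calculus of smooth functions on open sets\<close>

text \<open>\<open>ext_d\<close>, \<open>lie_derivative\<close>, \<open>divergence\<close> and
  \<open>modular_vfield\<close> are definite descriptions, the first two given by values on globally
  defined fields. So each must first be shown to denote. A tensorial formula in global fields
  depends on their values at p only, hence comes from a form; tangent vectors extend to global
  fields, hence that form is unique. For the same reason coordinates and coordinate fields are cut
  off and defined everywhere. They are genuine only on N, so an identity must be localized to N
  before it is differentiated.

  Deleting b from the indices other than c leaves \<pi> paired with dx_c and dx_b, and the Koszul
  sign cancels the sign of moving b to the front; this is why the two coordinate expressions agree.
  \<open>natural\<close> is an \<open>inv_into\<close>, so D_V(m \<pi>) is found by exhibiting a
  preimage of d\<sigma> and proving \<open>flat\<close> injective in degree 1. Dimension 1 is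
  separate: there the degree n - 2 of \<sigma> is truncated to 0.\<close>

lemma Ck_on_cong:
  assumes "open S" "\<And>x. x \<in> S \<Longrightarrow> f x = g x"
  shows "Ck_on k S f \<longleftrightarrow> Ck_on k S g"
proof -
  have "Ck_on k S g" if "Ck_on k S f" "\<And>x. x \<in> S \<Longrightarrow> f x = g x" for f g
    using that
  proof (induction k arbitrary: f g)
    case 0
    then show ?case by (simp cong: continuous_on_cong)
  next
    case (Suc k)
    have df: "f differentiable (at x)" if "x \<in> S" for x
      using Suc.prems(1) that assms(1) by (simp add: differentiable_on_eq_differentiable_at)
    have dg: "g differentiable (at x)" if "x \<in> S" for x
      using df[OF that] has_derivative_transform_within_open[OF _ assms(1) that, of f _ UNIV g] Suc.prems(2)
      unfolding differentiable_def by blast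
    have "frechet_derivative f (at x) = frechet_derivative g (at x)" if "x \<in> S" for x
      using frechet_derivative_transform_within_open[OF df[OF that] assms(1) that] Suc.prems(2) by blast
    moreover have "Ck_on k S (\<lambda>x. frechet_derivative f (at x) v)" for v
      using Suc.prems(1) by simp
    ultimately have "Ck_on k S (\<lambda>x. frechet_derivative g (at x) v)" for v
      using Suc.IH[of "\<lambda>x. frechet_derivative f (at x) v" "\<lambda>x. frechet_derivative g (at x) v"] by simp
    with dg show ?case by (simp add: differentiable_at_imp_differentiable_on)
  qed
  from this[of f g] this[of g f] assms(2) show ?thesis by auto
qed

text \<open>The closure proofs below supply the derivative in the form that the differentiation
  rules produce; on the open set S it agrees with \<open>frechet_derivative\<close>.\<close>

lemma Ck_on_SucI:
  assumes "open S" "\<And>x. x \<in> S \<Longrightarrow> (f has_derivative f' x) (at x)"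
    "\<And>v. Ck_on k S (\<lambda>x. f' x v)"
  shows "Ck_on (Suc k) S f"
proof -
  have "f differentiable_on S"
    by (rule differentiable_at_imp_differentiable_on) (use assms(2) in \<open>auto simp: differentiable_def\<close>)
  moreover have "Ck_on k S (\<lambda>x. frechet_derivative f (at x) v)" for v
    using Ck_on_cong[OF assms(1), of "\<lambda>x. frechet_derivative f (at x) v" "\<lambda>x. f' x v" k]
      assms(3) frechet_derivative_at[OF assms(2)] by simp
  ultimately show ?thesis by simp
qed

lemma Ck_on_SucD:
  assumes "open S" "Ck_on (Suc k) S f" "x \<in> S"
  shows "(f has_derivative frechet_derivative f (at x)) (at x)"
  using assms by (simp add: differentiable_on_eq_differentiable_at flip: frechet_derivative_works)

lemma Ck_on_SucD':
  assumes "Ck_on (Suc k) S f"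
  shows "Ck_on k S (\<lambda>x. frechet_derivative f (at x) v)"
  using assms by simp

lemma Ck_on_pred:
  assumes "Ck_on (Suc k) S f"
  shows "Ck_on k S f"
  using assms
proof (induction k arbitrary: f)
  case 0
  then show ?case using differentiable_imp_continuous_on by auto
next
  case (Suc k)
  have "f differentiable_on S" and "\<And>v. Ck_on (Suc k) S (\<lambda>x. frechet_derivative f (at x) v)"
    using Suc.prems by (auto simp del: Ck_on.simps(2) simp: Ck_on.simps(2)[of "Suc k"])
  then show ?case using Suc.IH by simp
qed

lemma Ck_on_continuous: "Ck_on k S f \<Longrightarrow> continuous_on S f"
proof (induction k)
  case (Suc k)
  then show ?case using Ck_on_pred by blast
qed simp

lemma Ck_on_subset:
  assumes "Ck_on k S f" "T \<subseteq> S"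
  shows "Ck_on k T f"
  using assms
proof (induction k arbitrary: f)
  case 0
  then show ?case by (auto intro: continuous_on_subset)
next
  case (Suc k)
  then show ?case by (auto intro: differentiable_on_subset)
qed

text \<open>Each point brings an open neighbourhood of its own, so differentiability is obtained at
  the point itself and not merely within S.\<close>

lemma Ck_on_local:
  assumes "\<And>x. x \<in> S \<Longrightarrow> \<exists>T. open T \<and> x \<in> T \<and> Ck_on k T f"
  shows "Ck_on k S f"
  using assms
proof (induction k arbitrary: f)
  case 0
  have "continuous (at x within S) f" if "x \<in> S" for x
    using 0[OF that] by (auto simp: continuous_on_eq_continuous_at intro: continuous_at_imp_continuous_at_within)
  then show ?case by (simp add: continuous_on_eq_continuous_within)
next
  case (Suc k)
  have "f differentiable (at x)" if x: "x \<in> S" for x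
  proof -
    obtain T where T: "open T" "x \<in> T" "Ck_on (Suc k) T f" using Suc.prems[OF x] by auto
    from Ck_on_SucD[OF T(1,3,2)] show ?thesis by (auto simp: differentiable_def)
  qed
  moreover have "Ck_on k S (\<lambda>x. frechet_derivative f (at x) v)" for v
    using Suc.prems by (intro Suc.IH) fastforce
  ultimately show ?case by (simp add: differentiable_at_imp_differentiable_on)
qed

lemma Ck_on_const: "Ck_on k S (\<lambda>x. c)"
proof (induction k arbitrary: c)
  case (Suc k)
  then show ?case by (simp add: differentiable_on_def)
qed simp

lemma Ck_on_linear: "bounded_linear f \<Longrightarrow> open S \<Longrightarrow> Ck_on k S f"
proof (induction k)
  case 0
  then show ?case by (simp add: linear_continuous_on)
next
  case (Suc k)
  show ?case
    by (rule Ck_on_SucI[OF Suc.prems(2), where f'="\<lambda>x. f"])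
      (auto intro: bounded_linear_imp_has_derivative Suc.prems Ck_on_const)
qed

lemma Ck_on_linear_compose:
  assumes "bounded_linear L" "open S" "Ck_on k S f"
  shows "Ck_on k S (\<lambda>x. L (f x))"
  using assms(3)
proof (induction k arbitrary: f)
  case 0
  then show ?case using assms by (auto intro: bounded_linear.continuous_on)
next
  case (Suc k)
  show ?case
    by (rule Ck_on_SucI[OF assms(2) bounded_linear.has_derivative[OF assms(1) Ck_on_SucD[OF assms(2) Suc.prems]]])
      (use Suc in auto)
qed

lemma Ck_on_add:
  assumes "open S" "Ck_on k S f" "Ck_on k S g"
  shows "Ck_on k S (\<lambda>x. f x + g x)"
  using assms(2,3)
proof (induction k arbitrary: f g)
  case 0
  then show ?case by (auto intro: continuous_intros)
next
  case (Suc k)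
  show ?case
    by (rule Ck_on_SucI[OF assms(1) has_derivative_add[OF Ck_on_SucD[OF assms(1) Suc.prems(1)]
            Ck_on_SucD[OF assms(1) Suc.prems(2)]]])
      (use Suc in auto)
qed

lemma Ck_on_sum:
  assumes "open S" "\<And>i. i \<in> I \<Longrightarrow> Ck_on k S (f i)"
  shows "Ck_on k S (\<lambda>x. \<Sum>i\<in>I. f i x)"
  using assms(2) by (induction I rule: infinite_finite_induct)
    (auto intro: Ck_on_const Ck_on_add[OF assms(1)])

lemma Ck_on_mult:
  fixes f g :: "'e::real_normed_vector \<Rightarrow> real"
  assumes "open S" "Ck_on k S f" "Ck_on k S g"
  shows "Ck_on k S (\<lambda>x. f x * g x)"
  using assms(2,3)
proof (induction k arbitrary: f g)
  case 0
  then show ?case by (auto intro: continuous_intros)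
next
  case (Suc k)
  \<comment> \<open>The product rule leaves one factor undifferentiated; \<open>Ck_on_pred\<close>
    lowers that factor to class k.\<close>
  show ?case
    by (rule Ck_on_SucI[OF assms(1) has_derivative_mult[OF Ck_on_SucD[OF assms(1) Suc.prems(1)]
            Ck_on_SucD[OF assms(1) Suc.prems(2)]]], assumption, assumption)
      (intro Ck_on_add[OF assms(1)] Suc.IH Ck_on_SucD'[OF Suc.prems(1)]
        Ck_on_SucD'[OF Suc.prems(2)] Ck_on_pred[OF Suc.prems(1)] Ck_on_pred[OF Suc.prems(2)])
qed

lemma Ck_on_inverse:
  fixes f :: "'e::real_normed_vector \<Rightarrow> real"
  assumes "open S" "Ck_on k S f" "\<And>x. x \<in> S \<Longrightarrow> f x \<noteq> 0"
  shows "Ck_on k S (\<lambda>x. inverse (f x))"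
  using assms(2)
proof (induction k)
  case 0
  then show ?case using assms(3) by (auto intro: continuous_intros)
next
  case (Suc k)
  have d: "((\<lambda>x. inverse (f x)) has_derivative
      (\<lambda>h. (-1) * (inverse (f x) * frechet_derivative f (at x) h * inverse (f x)))) (at x)" if "x \<in> S" for x
    using Deriv.has_derivative_inverse[OF assms(3)[OF that] Ck_on_SucD[OF assms(1) Suc.prems that]] by simp
  show ?case
    by (rule Ck_on_SucI[OF assms(1) d], assumption)
      (intro Ck_on_mult[OF assms(1)] Ck_on_const Suc.IH[OF Ck_on_pred[OF Suc.prems]]
        Ck_on_SucD'[OF Suc.prems])
qed

text \<open>The chain rule applies the derivative of f to a direction that moves with x, while
  \<open>Ck_on\<close> tests fixed directions only. Expanding the direction in the basis reduces it
  to sums of products of functions of class k.\<close>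

lemma Ck_on_compose:
  fixes f :: "'e::euclidean_space \<Rightarrow> real"
    and g :: "'d::real_normed_vector \<Rightarrow> 'e"
  assumes "open S" "open T" "g ` S \<subseteq> T" "Ck_on k T f" "Ck_on k S g"
  shows "Ck_on k S (\<lambda>x. f (g x))"
  using assms(4,5)
proof (induction k arbitrary: f)
  case 0
  then show ?case using continuous_on_compose2[of T f S g] assms(3) by auto
next
  case (Suc k)
  have f: "(f has_derivative frechet_derivative f (at (g x))) (at (g x))" if "x \<in> S" for x
    using Ck_on_SucD[OF assms(2) Suc.prems(1)] that assms(3) by auto
  have d: "((\<lambda>x. f (g x)) has_derivative
      (\<lambda>h. \<Sum>b\<in>Basis. (frechet_derivative g (at x) h \<bullet> b) * frechet_derivative f (at (g x)) b)) (at x)"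
    if "x \<in> S" for x
  proof -
    interpret L: linear "frechet_derivative f (at (g x))"
      using f[OF that] has_derivative_linear by blast
    have rep: "frechet_derivative f (at (g x)) y = (\<Sum>b\<in>Basis. (y \<bullet> b) * frechet_derivative f (at (g x)) b)" for y
    proof -
      have "frechet_derivative f (at (g x)) y =
          frechet_derivative f (at (g x)) (\<Sum>b\<in>Basis. (y \<bullet> b) *\<^sub>R b)"
        by (simp add: euclidean_representation)
      then show ?thesis by (simp add: L.sum L.scaleR)
    qed
    show ?thesis
      using has_derivative_compose[OF Ck_on_SucD[OF assms(1) Suc.prems(2) that] f[OF that]]
      by (subst (asm) rep)
  qed
  have pg: "Ck_on k S g" by (rule Ck_on_pred[OF Suc.prems(2)])
  show ?case
    by (rule Ck_on_SucI[OF assms(1) d], assumption)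
      (intro Ck_on_sum[OF assms(1)] Ck_on_mult[OF assms(1)] Suc.IH Ck_on_SucD'[OF Suc.prems(1)] pg
        Ck_on_linear_compose[OF bounded_linear_inner_left assms(1)] Ck_on_SucD'[OF Suc.prems(2)])
qed

section \<open>Averages of a function along segments from a base point\<close>

text \<open>Every differentiation in x under the integral brings out a factor t, so the induction
  has to carry an arbitrary weight t^j.\<close>

lemma Ck_on_radial_integral:
  fixes F :: "'e::euclidean_space \<Rightarrow> real"
  assumes "open B" "convex B" "a \<in> B" "Ck_on k B F"
  shows "Ck_on k B (\<lambda>x. integral {0..1} (\<lambda>t. t ^ j * F (a + t *\<^sub>R (x - a))))"
  using assms(4)
proof (induction k arbitrary: F j)
  case 0
  have inB: "a + t *\<^sub>R (x - a) \<in> B" if "x \<in> B" "t \<in> {0..1}" for x and t :: real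
    using convexD_alt[OF assms(2,3) that(1), of t] that by (simp add: algebra_simps)
  have "continuous_on B (\<lambda>x. integral (cbox 0 1) (\<lambda>t. t ^ j * F (a + t *\<^sub>R (x - a))))"
    by (rule integral_continuous_on_param)
      (use 0 inB in \<open>auto simp: case_prod_unfold intro!: continuous_intros
        intro: continuous_on_compose2[of B F]\<close>)
  then show ?case by simp
next
  case (Suc k)
  have inB: "a + t *\<^sub>R (x - a) \<in> B" if "x \<in> B" "t \<in> {0..1}" for x and t :: real
    using convexD_alt[OF assms(2,3) that(1), of t] that by (simp add: algebra_simps)
  have cD: "continuous_on B (\<lambda>y. frechet_derivative F (at y) b)" for b
    using Ck_on_continuous[OF Ck_on_SucD'[OF Suc.prems]] .
  have cF: "continuous_on B F" using Ck_on_continuous[OF Suc.prems] .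
  have lin: "linear (frechet_derivative F (at y))" if "y \<in> B" for y
    using Ck_on_SucD[OF assms(1) Suc.prems that] has_derivative_linear by blast
  \<comment> \<open>The x-derivative of the integrand as a bounded linear map. Writing it in the
    coordinate functionals reduces its joint continuity in x and t, which
    \<open>leibniz_rule\<close> requires, to that of the partial derivatives.\<close>
  define D where "D = (\<lambda>x t. \<Sum>b\<in>Basis. (t ^ Suc j * frechet_derivative F (at (a + t *\<^sub>R (x - a))) b)
     *\<^sub>R blinfun_inner_left b)"
  have Dv: "blinfun_apply (D x t) v = t ^ Suc j * frechet_derivative F (at (a + t *\<^sub>R (x - a))) v"
    if "x \<in> B" "t \<in> {0..1}" for x t v
  proof -
    interpret L: linear "frechet_derivative F (at (a + t *\<^sub>R (x - a)))" using lin inB that by blast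
    have "frechet_derivative F (at (a + t *\<^sub>R (x - a))) v =
        frechet_derivative F (at (a + t *\<^sub>R (x - a))) (\<Sum>b\<in>Basis. (v \<bullet> b) *\<^sub>R b)"
      by (simp add: euclidean_representation)
    also have "\<dots> = (\<Sum>b\<in>Basis. (v \<bullet> b) * frechet_derivative F (at (a + t *\<^sub>R (x - a))) b)"
      by (simp add: L.sum L.scaleR)
    finally show ?thesis
      by (simp add: D_def blinfun.sum_left blinfun.scaleR_left sum_distrib_left mult_ac inner_commute)
  qed
  have cD': "continuous_on (B \<times> cbox 0 1) (\<lambda>(x, t). D x t)"
    unfolding D_def case_prod_unfold
    by (intro continuous_intros continuous_on_compose2[OF cD]) (use inB in auto)
  have der: "((\<lambda>x. integral (cbox 0 1) (\<lambda>t. t ^ j * F (a + t *\<^sub>R (x - a)))) has_derivative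
      blinfun_apply (integral (cbox 0 1) (D x))) (at x within B)" if x: "x \<in> B" for x
  proof (rule leibniz_rule[OF _ _ cD' x assms(2)])
    fix x t assume xt: "x \<in> B" "t \<in> cbox 0 (1::real)"
    then have t: "t \<in> {0..1}" by simp
    have "((\<lambda>x. F (a + t *\<^sub>R (x - a))) has_derivative
       (\<lambda>v. frechet_derivative F (at (a + t *\<^sub>R (x - a))) (t *\<^sub>R v))) (at x)"
      by (rule has_derivative_compose[where g = F and f = "\<lambda>x. a + t *\<^sub>R (x - a)"])
        (auto intro!: derivative_eq_intros Ck_on_SucD[OF assms(1) Suc.prems inB[OF xt(1) t]])
    then have "((\<lambda>x. t ^ j * F (a + t *\<^sub>R (x - a))) has_derivative
       (\<lambda>v. t ^ j * frechet_derivative F (at (a + t *\<^sub>R (x - a))) (t *\<^sub>R v))) (at x)"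
      by (rule has_derivative_mult_right)
    moreover have "(\<lambda>v. t ^ j * frechet_derivative F (at (a + t *\<^sub>R (x - a))) (t *\<^sub>R v)) =
      blinfun_apply (D x t)"
      using Dv[OF xt(1) t] linear_scale[OF lin[OF inB[OF xt(1) t]]] by (auto simp: fun_eq_iff)
    ultimately show "((\<lambda>x. t ^ j * F (a + t *\<^sub>R (x - a))) has_derivative
      blinfun_apply (D x t)) (at x within B)"
      using has_derivative_at_withinI by metis
  next
    fix x assume "x \<in> B"
    then show "(\<lambda>t. t ^ j * F (a + t *\<^sub>R (x - a))) integrable_on cbox 0 1"
      using inB by (intro integrable_continuous continuous_intros continuous_on_compose2[OF cF]) auto
  qed
  have app: "blinfun_apply (integral (cbox 0 1) (D x)) v =
     integral {0..1} (\<lambda>t. t ^ Suc j * frechet_derivative F (at (a + t *\<^sub>R (x - a))) v)"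
    if x: "x \<in> B" for x v
  proof -
    have "continuous_on (cbox 0 1) (D x)"
      unfolding D_def
      by (intro continuous_intros continuous_on_compose2[OF cD]) (use x inB in auto)
    then have "D x integrable_on cbox 0 1" by (rule integrable_continuous)
    then have "blinfun_apply (integral (cbox 0 1) (D x)) v = integral (cbox 0 1) (\<lambda>t. blinfun_apply (D x t) v)"
      by (rule blinfun_apply_integral)
    also have "\<dots> = integral {0..1} (\<lambda>t. t ^ Suc j * frechet_derivative F (at (a + t *\<^sub>R (x - a))) v)"
      using Dv[OF x] by (auto intro: integral_cong)
    finally show ?thesis .
  qed
  show ?case
  proof (rule Ck_on_SucI[OF assms(1)])
    show "((\<lambda>x. integral {0..1} (\<lambda>t. t ^ j * F (a + t *\<^sub>R (x - a)))) has_derivative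
      blinfun_apply (integral (cbox 0 1) (D x))) (at x)" if x: "x \<in> B" for x
      using der[OF x] by (simp add: at_within_open[OF x assms(1)])
    show "Ck_on k B (\<lambda>x. blinfun_apply (integral (cbox 0 1) (D x)) v)" for v
      using Suc.IH[OF Ck_on_SucD'[OF Suc.prems], of "Suc j" v]
        Ck_on_cong[OF assms(1), of "\<lambda>x. blinfun_apply (integral (cbox 0 1) (D x)) v", OF app]
      by blast
  qed
qed

section \<open>Closure properties of smooth functions\<close>

lemma smooth_on_cong:
  "open S \<Longrightarrow> (\<And>x. x \<in> S \<Longrightarrow> f x = g x) \<Longrightarrow> smooth_on S f \<longleftrightarrow> smooth_on S g"
  using Ck_on_cong unfolding smooth_on_def by blast

lemma smooth_on_subset: "smooth_on S f \<Longrightarrow> T \<subseteq> S \<Longrightarrow> smooth_on T f"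
  using Ck_on_subset unfolding smooth_on_def by blast

lemma smooth_on_local:
  "(\<And>x. x \<in> S \<Longrightarrow> \<exists>T. open T \<and> x \<in> T \<and> smooth_on T f) \<Longrightarrow> smooth_on S f"
  unfolding smooth_on_def using Ck_on_local by meson

lemma smooth_on_const: "smooth_on S (\<lambda>x. c)"
  by (simp add: smooth_on_def Ck_on_const)

lemma smooth_on_linear: "bounded_linear f \<Longrightarrow> open S \<Longrightarrow> smooth_on S f"
  by (simp add: smooth_on_def Ck_on_linear)

lemma smooth_on_add:
  "open S \<Longrightarrow> smooth_on S f \<Longrightarrow> smooth_on S g \<Longrightarrow> smooth_on S (\<lambda>x. f x + g x)"
  by (simp add: smooth_on_def Ck_on_add)

lemma smooth_on_sum:
  "open S \<Longrightarrow> (\<And>i. i \<in> I \<Longrightarrow> smooth_on S (f i)) \<Longrightarrow> smooth_on S (\<lambda>x. \<Sum>i\<in>I. f i x)"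
  by (simp add: smooth_on_def Ck_on_sum)

lemma smooth_on_mult:
  fixes f g :: "'e::real_normed_vector \<Rightarrow> real"
  shows "open S \<Longrightarrow> smooth_on S f \<Longrightarrow> smooth_on S g \<Longrightarrow> smooth_on S (\<lambda>x. f x * g x)"
  by (simp add: smooth_on_def Ck_on_mult)

lemma smooth_on_inverse:
  fixes f :: "'e::real_normed_vector \<Rightarrow> real"
  shows "open S \<Longrightarrow> smooth_on S f \<Longrightarrow> (\<And>x. x \<in> S \<Longrightarrow> f x \<noteq> 0) \<Longrightarrow> smooth_on S (\<lambda>x. inverse (f x))"
  by (simp add: smooth_on_def Ck_on_inverse)

lemma smooth_on_compose:
  fixes f :: "'e::euclidean_space \<Rightarrow> real"
  shows "open S \<Longrightarrow> open T \<Longrightarrow> g ` S \<subseteq> T \<Longrightarrow> smooth_on T f \<Longrightarrow> smooth_on S g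
    \<Longrightarrow> smooth_on S (\<lambda>x. f (g x))"
  by (simp add: smooth_on_def Ck_on_compose)

lemma smooth_on_deriv:
  "smooth_on S f \<Longrightarrow> smooth_on S (\<lambda>x. frechet_derivative f (at x) v)"
  unfolding smooth_on_def using Ck_on_SucD' by blast

lemma smooth_on_has_derivative:
  "open S \<Longrightarrow> smooth_on S f \<Longrightarrow> x \<in> S \<Longrightarrow> (f has_derivative frechet_derivative f (at x)) (at x)"
  unfolding smooth_on_def using Ck_on_SucD by blast

lemma smooth_on_continuous: "smooth_on S f \<Longrightarrow> continuous_on S f"
  unfolding smooth_on_def using Ck_on_continuous by blast

section \<open>Bump functions on Euclidean space\<close>

text \<open>For m = 0 this is the classical flat function exp(-1/t). The powers of 1/t make the span
  of the family closed under differentiation.\<close>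

definition flat_exp :: "nat \<Rightarrow> real \<Rightarrow> real" where
  "flat_exp m t = (if t > 0 then (1 / t) ^ m * exp (- (1 / t)) else 0)"

lemma flat_exp_tendsto_0: "(flat_exp m \<longlongrightarrow> 0) (at 0)"
proof -
  have "((\<lambda>t. (1 / t) ^ m * exp (- (1 / t))) \<longlongrightarrow> 0) (at_right (0::real))"
  proof -
    have "((\<lambda>s. s ^ m / exp s) \<longlongrightarrow> (0::real)) at_top" by (rule tendsto_power_div_exp_0)
    then have "((\<lambda>t. (inverse t) ^ m / exp (inverse t)) \<longlongrightarrow> (0::real)) (at_right 0)"
      using filterlim_inverse_at_top_right by (rule filterlim_compose)
    then show ?thesis by (simp add: exp_minus field_simps)
  qed
  then have "(flat_exp m \<longlongrightarrow> 0) (at_right 0)"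
    by (rule Lim_transform_eventually)
      (auto simp: flat_exp_def eventually_at_right_field intro!: exI[of _ 1])
  moreover have "(flat_exp m \<longlongrightarrow> 0) (at_left 0)"
    by (rule Lim_transform_eventually[OF tendsto_const])
      (auto simp: flat_exp_def eventually_at_left_field intro!: exI[of _ "-1"])
  ultimately show ?thesis by (simp add: filterlim_split_at)
qed

text \<open>At 0 the difference quotient is \<open>flat_exp (Suc m) h\<close>, so the previous limit
  gives derivative 0; elsewhere the usual rules apply.\<close>

lemma flat_exp_has_derivative:
  "(flat_exp m has_real_derivative (flat_exp (m + 2) t - real m * flat_exp (m + 1) t)) (at t)"
proof -
  consider "t > 0" | "t < 0" | "t = 0" by linarith
  then show ?thesis
  proof cases
    case 1
    have u: "((\<lambda>t. 1 / t) has_real_derivative - (1 / t)\<^sup>2) (at t)"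
      using 1 by (auto intro!: derivative_eq_intros simp: power2_eq_square)
    \<comment> \<open>With u = 1/t kept abstract, subject only to u' = -u^2, the derivative is
      computed without fractions.\<close>
    have "((\<lambda>t. u t ^ m * exp (- u t)) has_real_derivative
        (u t ^ (m + 2) * exp (- u t) - real m * (u t ^ (m + 1) * exp (- u t)))) (at t)"
      if [derivative_intros]: "(u has_real_derivative - (u t)\<^sup>2) (at t)" for u :: "real \<Rightarrow> real"
      by (cases m) (auto intro!: derivative_eq_intros simp: power2_eq_square algebra_simps dest!: gr0_implies_Suc)
    from this[OF u] have "((\<lambda>t. (1 / t) ^ m * exp (- (1 / t))) has_real_derivative
        (flat_exp (m + 2) t - real m * flat_exp (m + 1) t)) (at t)"
      using 1 by (simp only: flat_exp_def if_True)
    then show ?thesis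
      by (rule has_field_derivative_transform_within_open[of _ _ _ "{0<..}"])
        (use 1 in \<open>auto simp: flat_exp_def\<close>)
  next
    case 2
    have "((\<lambda>t. 0) has_real_derivative
        (flat_exp (m + 2) t - real m * flat_exp (m + 1) t)) (at t)"
      using 2 by (auto simp: flat_exp_def)
    then show ?thesis
      by (rule has_field_derivative_transform_within_open[of _ _ _ "{..<0}"])
        (use 2 in \<open>auto simp: flat_exp_def\<close>)
  next
    case 3
    have "(\<lambda>h. flat_exp (Suc m) h) = (\<lambda>h. flat_exp m h / h)"
      by (auto simp: flat_exp_def fun_eq_iff field_simps)
    with flat_exp_tendsto_0[of "Suc m"] 3 show ?thesis
      by (simp add: DERIV_def flat_exp_def)
  qed
qed

lemma smooth_on_flat_exp: "smooth_on UNIV (flat_exp m)"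
proof -
  have "Ck_on k UNIV (flat_exp m)" for k
  proof (induction k arbitrary: m)
    case 0
    have "continuous (at x) (flat_exp m)" for x
      using flat_exp_has_derivative by (rule DERIV_isCont)
    then show ?case by (simp add: continuous_at_imp_continuous_on)
  next
    case (Suc k)
    show ?case
    proof (rule Ck_on_SucI[OF open_UNIV flat_exp_has_derivative[unfolded has_field_derivative_def]])
      fix v
      have "Ck_on k UNIV (\<lambda>x. v * flat_exp (m + 2) x + (- real m * v) * flat_exp (m + 1) x)"
        by (intro Ck_on_add Ck_on_mult Ck_on_const Suc.IH open_UNIV)
      then show "Ck_on k UNIV (\<lambda>x. (flat_exp (m + 2) x - real m * flat_exp (m + 1) x) * v)"
        by (simp add: algebra_simps)
    qed
  qed
  then show ?thesis by (simp add: smooth_on_def)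
qed

text \<open>The quotient P / (P + Q), where P is positive exactly inside radius 2r and Q exactly
  outside radius r. These regions overlap and cover the space, so the denominator never
  vanishes.\<close>

lemma smooth_bump_euclidean:
  fixes a :: "'e::euclidean_space"
  assumes "0 < r"
  obtains h :: "'e \<Rightarrow> real" where "smooth_on UNIV h"
    "\<And>x. x \<in> ball a r \<Longrightarrow> h x = 1" "\<And>x. x \<notin> cball a (2 * r) \<Longrightarrow> h x = 0"
proof
  define u where "u = (\<lambda>x. (x - a) \<bullet> (x - a))"
  define P where "P = (\<lambda>x. flat_exp 0 (4 * r\<^sup>2 - u x))"
  define Q where "Q = (\<lambda>x. flat_exp 0 (u x - r\<^sup>2))"
  define h where "h = (\<lambda>x. P x * inverse (P x + Q x))"
  have u_norm: "u x = (dist a x)\<^sup>2" for x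
    by (simp add: u_def dist_norm norm_minus_commute dot_square_norm)
  have fe: "flat_exp 0 t \<ge> 0" "flat_exp 0 t > 0 \<longleftrightarrow> t > 0" for t
    by (auto simp: flat_exp_def)
  have "r\<^sup>2 < 4 * r\<^sup>2" using assms by simp
  then have pos: "P x + Q x \<noteq> 0" for x
    using fe[of "4 * r\<^sup>2 - u x"] fe[of "u x - r\<^sup>2"] unfolding P_def Q_def by linarith
  have lin: "smooth_on UNIV (\<lambda>x. (x - a) \<bullet> b)" for b :: 'e
    using smooth_on_add[OF open_UNIV smooth_on_linear[OF bounded_linear_inner_left[of b] open_UNIV]
        smooth_on_const[of UNIV "- (a \<bullet> b)"]] by (simp add: inner_diff_left)
  have su: "smooth_on UNIV u"
    unfolding u_def euclidean_inner[of "x - a" "x - a" for x]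
    by (intro smooth_on_sum smooth_on_mult lin open_UNIV)
  have "smooth_on UNIV (\<lambda>x. 4 * r\<^sup>2 + (- 1) * u x)" "smooth_on UNIV (\<lambda>x. - r\<^sup>2 + u x)"
    by (intro smooth_on_add smooth_on_mult smooth_on_const su open_UNIV)+
  then have "smooth_on UNIV P" "smooth_on UNIV Q" unfolding P_def Q_def
    using smooth_on_compose[OF open_UNIV open_UNIV _ smooth_on_flat_exp] by fastforce+
  then show "smooth_on UNIV h" unfolding h_def
    by (intro smooth_on_mult smooth_on_inverse smooth_on_add open_UNIV pos)
  show "h x = 1" if "x \<in> ball a r" for x
  proof -
    have "u x < r\<^sup>2" using that by (simp add: u_norm power_strict_mono)
    then have "Q x = 0" by (simp add: Q_def flat_exp_def)
    with pos[of x] show ?thesis by (simp add: h_def)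
  qed
  show "h x = 0" if "x \<notin> cball a (2 * r)" for x
  proof -
    have "(2 * r)\<^sup>2 < u x" unfolding u_norm using that assms by (intro power_strict_mono) auto
    then have "P x = 0" by (simp add: P_def flat_exp_def power_mult_distrib)
    then show ?thesis by (simp add: h_def)
  qed
qed

text \<open>g is arbitrary outside B. The open sets B and -C cover the space, and the product is 0
  on the latter.\<close>

lemma smooth_on_cutoff:
  fixes h g :: "'e::real_normed_vector \<Rightarrow> real"
  assumes "open B" "smooth_on B g" "smooth_on UNIV h" "closed C" "C \<subseteq> B" "\<And>x. x \<notin> C \<Longrightarrow> h x = 0"
  shows "smooth_on UNIV (\<lambda>x. h x * g x)"
proof (rule smooth_on_local)
  fix x
  show "\<exists>T. open T \<and> x \<in> T \<and> smooth_on T (\<lambda>x. h x * g x)"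
  proof (cases "x \<in> B")
    case True
    then show ?thesis
      using smooth_on_mult[OF assms(1) smooth_on_subset[OF assms(3)] assms(2)] assms(1) by blast
  next
    case False
    have "smooth_on (- C) (\<lambda>x. h x * g x)"
      by (subst smooth_on_cong[where g = "\<lambda>x. 0"]) (use assms(4,6) in \<open>auto simp: smooth_on_const\<close>)
    with False assms(4,5) show ?thesis by blast
  qed
qed

text \<open>G b is the average of the partial derivative in direction b over the segment from a to
  x; the fundamental theorem of calculus along that segment gives the expansion.\<close>

lemma Hadamard_lemma:
  fixes F :: "'e::euclidean_space \<Rightarrow> real"
  assumes "open B" "convex B" "a \<in> B" "smooth_on B F"
  obtains G where "\<And>b. smooth_on B (G b)"
    "\<And>x. x \<in> B \<Longrightarrow> F x = F a + (\<Sum>b\<in>Basis. ((x - a) \<bullet> b) * G b x)"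
    "\<And>b. G b a = frechet_derivative F (at a) b"
proof
  define G where "G = (\<lambda>b x. integral {0..1} (\<lambda>t. frechet_derivative F (at (a + t *\<^sub>R (x - a))) b))"
  show "smooth_on B (G b)" for b
    using Ck_on_radial_integral[OF assms(1-3), of _ "\<lambda>y. frechet_derivative F (at y) b" 0]
      smooth_on_deriv[OF assms(4)]
    by (simp add: smooth_on_def G_def)
  show "G b a = frechet_derivative F (at a) b" for b by (simp add: G_def)
  fix x assume x: "x \<in> B"
  have inB: "a + t *\<^sub>R (x - a) \<in> B" if "t \<in> {0..1}" for t :: real
    using convexD_alt[OF assms(2,3) x, of t] that by (simp add: algebra_simps)
  have rep: "frechet_derivative F (at y) v = (\<Sum>b\<in>Basis. (v \<bullet> b) * frechet_derivative F (at y) b)"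
    if "y \<in> B" for y v
  proof -
    interpret L: linear "frechet_derivative F (at y)"
      using smooth_on_has_derivative[OF assms(1,4) that] has_derivative_linear by blast
    have "frechet_derivative F (at y) v = frechet_derivative F (at y) (\<Sum>b\<in>Basis. (v \<bullet> b) *\<^sub>R b)"
      by (simp add: euclidean_representation)
    then show ?thesis by (simp add: L.sum L.scaleR)
  qed
  have "((\<lambda>t. F (a + t *\<^sub>R (x - a))) has_vector_derivative
      frechet_derivative F (at (a + t *\<^sub>R (x - a))) (x - a)) (at t within {0..1})"
    if t: "t \<in> {0..1}" for t
  proof -
    have D: "(F has_derivative frechet_derivative F (at (a + t *\<^sub>R (x - a)))) (at (a + t *\<^sub>R (x - a)))"
      by (rule smooth_on_has_derivative[OF assms(1,4) inB[OF t]])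
    have "((\<lambda>t. F (a + t *\<^sub>R (x - a))) has_derivative
        (\<lambda>h. frechet_derivative F (at (a + t *\<^sub>R (x - a))) (h *\<^sub>R (x - a)))) (at t within {0..1})"
      by (rule has_derivative_compose[where g = F and f = "\<lambda>t. a + t *\<^sub>R (x - a)"])
        (auto intro!: derivative_eq_intros D)
    then show ?thesis
      using linear_scale[OF has_derivative_linear[OF D]] by (simp add: has_vector_derivative_def)
  qed
  from fundamental_theorem_of_calculus[OF _ this]
  have "((\<lambda>t. frechet_derivative F (at (a + t *\<^sub>R (x - a))) (x - a)) has_integral (F x - F a)) {0..1}"
    by simp
  then have "F x - F a = integral {0..1} (\<lambda>t. frechet_derivative F (at (a + t *\<^sub>R (x - a))) (x - a))"
    by (simp add: integral_unique)
  also have "\<dots> = integral {0..1} (\<lambda>t. \<Sum>b\<in>Basis. ((x - a) \<bullet> b) * frechet_derivative F (at (a + t *\<^sub>R (x - a))) b)"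
    by (intro integral_cong rep inB)
  also have "\<dots> = (\<Sum>b\<in>Basis. integral {0..1} (\<lambda>t. ((x - a) \<bullet> b) * frechet_derivative F (at (a + t *\<^sub>R (x - a))) b))"
  proof (rule integral_sum[OF finite_Basis])
    fix b :: 'e assume "b \<in> Basis"
    show "(\<lambda>t. ((x - a) \<bullet> b) * frechet_derivative F (at (a + t *\<^sub>R (x - a))) b) integrable_on {0..1}"
      by (intro integrable_continuous_real continuous_intros
          continuous_on_compose2[OF smooth_on_continuous[OF smooth_on_deriv[OF assms(4)]]])
        (use inB in auto)
  qed
  also have "\<dots> = (\<Sum>b\<in>Basis. ((x - a) \<bullet> b) * G b x)"
    by (simp add: G_def)
  finally show "F x = F a + (\<Sum>b\<in>Basis. ((x - a) \<bullet> b) * G b x)" by simp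
qed

section \<open>Local frames\<close>

locale smooth_mfd =
  fixes M :: "('a::{t2_space,second_countable_topology}, 'e::euclidean_space) atlas"
  assumes smooth_mfd: "smooth_manifold M"
begin

lemma chartD:
  assumes "(U, \<phi>) \<in> M"
  shows "open U" "open (\<phi> ` U)" "continuous_on U \<phi>" "continuous_on (\<phi> ` U) (inv_into U \<phi>)"
    "\<And>p. p \<in> U \<Longrightarrow> inv_into U \<phi> (\<phi> p) = p"
proof -
  have *: "open U \<and> open (\<phi> ` U) \<and> homeomorphism U (\<phi> ` U) \<phi> (inv_into U \<phi>)"
    using smooth_mfd assms unfolding smooth_manifold_def by blast
  then show "open U" "open (\<phi> ` U)" by simp_all
  from * have h: "homeomorphism U (\<phi> ` U) \<phi> (inv_into U \<phi>)" by simp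
  show "continuous_on U \<phi>" by (rule homeomorphism_cont1[OF h])
  show "continuous_on (\<phi> ` U) (inv_into U \<phi>)" by (rule homeomorphism_cont2[OF h])
  show "inv_into U \<phi> (\<phi> p) = p" if "p \<in> U" for p by (rule homeomorphism_apply1[OF h that])
qed

lemma chart_ex:
  obtains U \<phi> where "(U, \<phi>) \<in> M" "p \<in> U"
proof -
  have "p \<in> (\<Union>(U, \<phi>)\<in>M. U)" using smooth_mfd by (simp add: smooth_manifold_def)
  then show ?thesis using that by auto
qed

lemma transition_smooth:
  "(U, \<phi>) \<in> M \<Longrightarrow> (U', \<psi>) \<in> M \<Longrightarrow> smooth_on (\<phi> ` (U \<inter> U')) (\<psi> \<circ> inv_into U \<phi>)"
  using smooth_mfd unfolding smooth_manifold_def by blast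

lemma chart_image_open:
  assumes "(U, \<phi>) \<in> M" "open N"
  shows "open (\<phi> ` (U \<inter> N))"
proof -
  have "\<phi> ` (U \<inter> N) = \<phi> ` U \<inter> inv_into U \<phi> -` N"
    using chartD(5)[OF assms(1)] by force
  then show ?thesis
    using continuous_open_preimage[OF chartD(4,2)[OF assms(1)] assms(2)] by simp
qed

lemma chart_preimage_open:
  assumes "(U, \<phi>) \<in> M" "open B"
  shows "open {q \<in> U. \<phi> q \<in> B}"
  using continuous_open_preimage[OF chartD(3,1)[OF assms(1)] assms(2)]
  by (simp add: vimage_def Int_def)

section \<open>Smoothness on open subsets of the manifold\<close>

text \<open>Allows division by functions that are nonzero only locally, and gluing of local formulas
  into elements of \<open>smooth_funs\<close>.\<close>

definition smooth_near :: "'a set \<Rightarrow> ('a \<Rightarrow> real) \<Rightarrow> bool" where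
  "smooth_near N f \<longleftrightarrow> (\<forall>(U, \<phi>)\<in>M. smooth_on (\<phi> ` (U \<inter> N)) (f \<circ> inv_into U \<phi>))"

lemma smooth_near_subset: "smooth_near N f \<Longrightarrow> N' \<subseteq> N \<Longrightarrow> smooth_near N' f"
  unfolding smooth_near_def by (fastforce intro: smooth_on_subset)

lemma smooth_near_UNIV: "smooth_near UNIV f \<longleftrightarrow> f \<in> smooth_funs M"
  by (simp add: smooth_near_def smooth_funs_def)

lemma smooth_funs_near: "f \<in> smooth_funs M \<Longrightarrow> smooth_near N f"
  using smooth_near_UNIV smooth_near_subset by blast

lemma smooth_near_cong:
  assumes "open N" "\<And>q. q \<in> N \<Longrightarrow> f q = g q"
  shows "smooth_near N f \<longleftrightarrow> smooth_near N g"
proof -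
  have "smooth_on (\<phi> ` (U \<inter> N)) (f \<circ> inv_into U \<phi>) \<longleftrightarrow>
      smooth_on (\<phi> ` (U \<inter> N)) (g \<circ> inv_into U \<phi>)" if "(U, \<phi>) \<in> M" for U \<phi>
    by (rule smooth_on_cong[OF chart_image_open[OF that assms(1)]])
      (use chartD(5)[OF that] assms(2) in auto)
  then show ?thesis unfolding smooth_near_def by auto
qed

lemma smooth_near_const: "smooth_near N (\<lambda>p. c)"
  by (simp add: smooth_near_def smooth_on_const o_def)

lemma smooth_near_add:
  "open N \<Longrightarrow> smooth_near N f \<Longrightarrow> smooth_near N g \<Longrightarrow> smooth_near N (\<lambda>p. f p + g p)"
  unfolding smooth_near_def o_def by (fastforce intro: smooth_on_add chart_image_open)

lemma smooth_near_mult: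
  "open N \<Longrightarrow> smooth_near N f \<Longrightarrow> smooth_near N g \<Longrightarrow> smooth_near N (\<lambda>p. f p * g p)"
  unfolding smooth_near_def o_def by (fastforce intro: smooth_on_mult chart_image_open)

lemma smooth_near_inverse:
  assumes "open N" "smooth_near N f" "\<And>q. q \<in> N \<Longrightarrow> f q \<noteq> 0"
  shows "smooth_near N (\<lambda>p. inverse (f p))"
proof -
  have "smooth_on (\<phi> ` (U \<inter> N)) ((\<lambda>p. inverse (f p)) \<circ> inv_into U \<phi>)" if "(U, \<phi>) \<in> M" for U \<phi>
    unfolding o_def
    by (rule smooth_on_inverse[OF chart_image_open[OF that assms(1)]])
      (use assms(2,3) that chartD(5)[OF that] in \<open>auto simp: smooth_near_def o_def\<close>)
  then show ?thesis by (auto simp: smooth_near_def)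
qed

lemma smooth_funs_local:
  assumes "\<And>p. \<exists>N. open N \<and> p \<in> N \<and> smooth_near N f"
  shows "f \<in> smooth_funs M"
proof -
  have "smooth_on (\<phi> ` U) (f \<circ> inv_into U \<phi>)" if c: "(U, \<phi>) \<in> M" for U \<phi>
  proof (rule smooth_on_local)
    fix y assume "y \<in> \<phi> ` U"
    then obtain p where p: "p \<in> U" "y = \<phi> p" by blast
    obtain N where "open N" "p \<in> N" "smooth_near N f" using assms by blast
    with p c chart_image_open[OF c] show "\<exists>T. open T \<and> y \<in> T \<and> smooth_on T (f \<circ> inv_into U \<phi>)"
      by (intro exI[of _ "\<phi> ` (U \<inter> N)"]) (auto simp: smooth_near_def)
  qed
  then show ?thesis by (auto simp: smooth_funs_def)
qed

lemma smooth_const: "(\<lambda>p. c) \<in> smooth_funs M"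
  using smooth_near_const smooth_near_UNIV by blast

lemma smooth_add: "f \<in> smooth_funs M \<Longrightarrow> g \<in> smooth_funs M \<Longrightarrow> (\<lambda>p. f p + g p) \<in> smooth_funs M"
  using smooth_near_add[OF open_UNIV] by (simp add: smooth_near_UNIV)

lemma smooth_mult: "f \<in> smooth_funs M \<Longrightarrow> g \<in> smooth_funs M \<Longrightarrow> (\<lambda>p. f p * g p) \<in> smooth_funs M"
  using smooth_near_mult[OF open_UNIV] by (simp add: smooth_near_UNIV)

lemma smooth_cmult: "f \<in> smooth_funs M \<Longrightarrow> (\<lambda>p. c * f p) \<in> smooth_funs M"
  by (intro smooth_mult smooth_const)

lemma smooth_minus: "f \<in> smooth_funs M \<Longrightarrow> (\<lambda>p. - f p) \<in> smooth_funs M"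
  using smooth_cmult[of f "-1"] by simp

lemma smooth_diff: "f \<in> smooth_funs M \<Longrightarrow> g \<in> smooth_funs M \<Longrightarrow> (\<lambda>p. f p - g p) \<in> smooth_funs M"
  using smooth_add[of f "\<lambda>p. - g p"] smooth_minus[of g] by simp

lemma smooth_sum:
  "(\<And>i. i \<in> I \<Longrightarrow> f i \<in> smooth_funs M) \<Longrightarrow> (\<lambda>p. \<Sum>i\<in>I. f i p) \<in> smooth_funs M"
  by (induction I rule: infinite_finite_induct) (auto intro: smooth_const smooth_add)

lemmas smooth_intros = smooth_const smooth_add smooth_mult smooth_minus smooth_diff smooth_sum

section \<open>Functions and bumps carried over from a chart\<close>

text \<open>Extension by 0 is smooth at points off U because the preimage K of C is compact, hence
  closed in the Hausdorff space M: its complement is an open set on which the extension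
  vanishes.\<close>

lemma smooth_push:
  assumes c: "(U, \<phi>) \<in> M" and h: "smooth_on (\<phi> ` U) h" and C: "compact C" "C \<subseteq> \<phi> ` U"
    and 0: "\<And>y. y \<in> \<phi> ` U \<Longrightarrow> y \<notin> C \<Longrightarrow> h y = 0"
  shows "(\<lambda>p. if p \<in> U then h (\<phi> p) else 0) \<in> smooth_funs M"
proof (rule smooth_funs_local)
  let ?f = "\<lambda>p. if p \<in> U then h (\<phi> p) else 0"
  fix p
  show "\<exists>N. open N \<and> p \<in> N \<and> smooth_near N ?f"
  proof (cases "p \<in> U")
    case True
    have "smooth_on (\<psi> ` (U' \<inter> U)) (?f \<circ> inv_into U' \<psi>)" if c': "(U', \<psi>) \<in> M" for U' \<psi>
    proof -
      have o: "open (\<psi> ` (U' \<inter> U))" by (rule chart_image_open[OF c' chartD(1)[OF c]])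
      have "smooth_on (\<psi> ` (U' \<inter> U)) (\<lambda>x. h ((\<phi> \<circ> inv_into U' \<psi>) x))"
        by (rule smooth_on_compose[OF o chartD(2)[OF c] _ h transition_smooth[OF c' c]])
          (use chartD(5)[OF c'] in auto)
      then show ?thesis
        by (subst smooth_on_cong[OF o, where g = "\<lambda>x. h ((\<phi> \<circ> inv_into U' \<psi>) x)"])
          (use chartD(5)[OF c'] in auto)
    qed
    then have "smooth_near U ?f" by (auto simp: smooth_near_def)
    with True chartD(1)[OF c] show ?thesis by blast
  next
    case False
    define K where "K = inv_into U \<phi> ` C"
    have "compact K"
      unfolding K_def using compact_continuous_image continuous_on_subset chartD(4)[OF c] C by blast
    then have o: "open (- K)" by (simp add: compact_imp_closed open_Compl)
    have "K \<subseteq> U" using C(2) chartD(5)[OF c] by (force simp: K_def)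
    have "?f q = 0" if "q \<in> - K" for q
    proof (cases "q \<in> U")
      case True
      have "\<phi> q \<notin> C" using that chartD(5)[OF c True] by (force simp: K_def)
      with True 0 show ?thesis by simp
    qed simp
    then have "smooth_near (- K) ?f" using smooth_near_cong[OF o, of ?f "\<lambda>p. 0"] smooth_near_const by blast
    with o False \<open>K \<subseteq> U\<close> show ?thesis by blast
  qed
qed

lemma bump_ex:
  assumes "open N" "p \<in> N"
  obtains \<beta> N' where "\<beta> \<in> smooth_funs M" "open N'" "p \<in> N'" "N' \<subseteq> N"
    "\<And>q. q \<in> N' \<Longrightarrow> \<beta> q = 1" "\<And>q. q \<notin> N \<Longrightarrow> \<beta> q = 0"
proof -
  obtain U \<phi> where c: "(U, \<phi>) \<in> M" "p \<in> U" by (rule chart_ex)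
  have "open (\<phi> ` (U \<inter> N))" "\<phi> p \<in> \<phi> ` (U \<inter> N)"
    using chart_image_open[OF c(1) assms(1)] c assms by auto
  then obtain r where r: "r > 0" "cball (\<phi> p) r \<subseteq> \<phi> ` (U \<inter> N)" unfolding open_contains_cball by blast
  obtain h where h: "smooth_on UNIV h" "\<And>x. x \<in> ball (\<phi> p) (r/2) \<Longrightarrow> h x = (1::real)"
    "\<And>x. x \<notin> cball (\<phi> p) r \<Longrightarrow> h x = 0"
    using smooth_bump_euclidean[of "r/2" "\<phi> p"] r(1) by auto
  define \<beta> where "\<beta> = (\<lambda>q. if q \<in> U then h (\<phi> q) else 0)"
  define N' where "N' = {q \<in> U. \<phi> q \<in> ball (\<phi> p) (r/2)}"
  have inN: "q \<in> N" if "q \<in> U" "\<phi> q \<in> cball (\<phi> p) r" for q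
  proof -
    from that r obtain q' where "q' \<in> U" "q' \<in> N" "\<phi> q = \<phi> q'" by blast
    with chartD(5)[OF c(1)] that(1) show ?thesis by metis
  qed
  show ?thesis
  proof
    show "\<beta> \<in> smooth_funs M" unfolding \<beta>_def
      by (rule smooth_push[OF c(1) smooth_on_subset[OF h(1)], of "cball (\<phi> p) r"]) (use r h(3) in auto)
    show "open N'" unfolding N'_def by (rule chart_preimage_open[OF c(1) open_ball])
    show "p \<in> N'" using c r by (simp add: N'_def)
    show "N' \<subseteq> N" using inN r(1) by (auto simp: N'_def)
    show "\<beta> q = 1" if "q \<in> N'" for q using that h(2) by (simp add: N'_def \<beta>_def)
    show "\<beta> q = 0" if "q \<notin> N" for q using that h(3) inN by (auto simp: \<beta>_def)
  qed
qed

section \<open>Point derivations and vector fields\<close>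

lemma tangent_lin:
  assumes "v \<in> tangent M p" "f \<in> smooth_funs M" "g \<in> smooth_funs M"
  shows "v (\<lambda>x. a * f x + b * g x) = a * v f + b * v g"
  using assms by (simp add: tangent_def)

lemma tangent_mult:
  assumes "v \<in> tangent M p" "f \<in> smooth_funs M" "g \<in> smooth_funs M"
  shows "v (\<lambda>x. f x * g x) = f p * v g + g p * v f"
  using assms by (simp add: tangent_def)

lemma tangent_nonsmooth: "v \<in> tangent M p \<Longrightarrow> f \<notin> smooth_funs M \<Longrightarrow> v f = 0"
  by (simp add: tangent_def)

lemma tangent_add:
  "v \<in> tangent M p \<Longrightarrow> f \<in> smooth_funs M \<Longrightarrow> g \<in> smooth_funs M \<Longrightarrow> v (\<lambda>x. f x + g x) = v f + v g"
  using tangent_lin[of v p f g 1 1] by simp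

lemma tangent_diff:
  "v \<in> tangent M p \<Longrightarrow> f \<in> smooth_funs M \<Longrightarrow> g \<in> smooth_funs M \<Longrightarrow> v (\<lambda>x. f x - g x) = v f - v g"
  using tangent_lin[of v p f g 1 "-1"] by simp

lemma tangent_cmult:
  "v \<in> tangent M p \<Longrightarrow> f \<in> smooth_funs M \<Longrightarrow> v (\<lambda>x. c * f x) = c * v f"
  using tangent_lin[of v p f f c 0] by simp

lemma tangent_const:
  assumes "v \<in> tangent M p"
  shows "v (\<lambda>x. c) = 0"
proof -
  have "v (\<lambda>x. 1) = 0"
    using tangent_mult[OF assms smooth_const[of 1] smooth_const[of 1]] by simp
  then show ?thesis using tangent_cmult[OF assms smooth_const[of 1], of c] by simp
qed

lemma tangent_sum:
  assumes "v \<in> tangent M p" "\<And>i. i \<in> I \<Longrightarrow> f i \<in> smooth_funs M"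
  shows "v (\<lambda>x. \<Sum>i\<in>I. f i x) = (\<Sum>i\<in>I. v (f i))"
  using assms(2)
proof (induction I rule: infinite_finite_induct)
  case (insert i I)
  then have "(\<lambda>x. \<Sum>i\<in>I. f i x) \<in> smooth_funs M" by (intro smooth_sum) auto
  with insert show ?case by (simp add: tangent_add[OF assms(1)])
qed (simp_all add: tangent_const[OF assms(1)])

text \<open>With a bump \<beta> at p supported in N, the product (f - g) \<beta> is identically 0,
  and the Leibniz rule at p reads off v f - v g.\<close>

lemma tangent_local:
  assumes "v \<in> tangent M p" "open N" "p \<in> N" "\<And>q. q \<in> N \<Longrightarrow> f q = g q"
    "f \<in> smooth_funs M" "g \<in> smooth_funs M"
  shows "v f = v g"
proof -
  obtain \<beta> N' where \<beta>: "\<beta> \<in> smooth_funs M" "p \<in> N'" "\<And>q. q \<in> N' \<Longrightarrow> \<beta> q = 1" "\<And>q. q \<notin> N \<Longrightarrow> \<beta> q = 0"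
    using bump_ex[OF assms(2,3)] by metis
  have d: "(\<lambda>q. f q - g q) \<in> smooth_funs M" using assms smooth_diff by blast
  have "(\<lambda>q. (f q - g q) * \<beta> q) = (\<lambda>q. 0)"
    using assms(4) \<beta>(4) by (metis mult_eq_0_iff right_minus_eq)
  then have "0 = v (\<lambda>q. (f q - g q) * \<beta> q)" using tangent_const[OF assms(1)] by simp
  also have "\<dots> = v f - v g"
    using tangent_mult[OF assms(1) d \<beta>(1)] tangent_diff[OF assms(1,5,6)] assms(3,4) \<beta>(2,3) by simp
  finally show ?thesis by simp
qed

lemma tangent_comb:
  assumes "v \<in> tangent M p" "w \<in> tangent M p"
  shows "(\<lambda>f. a * v f + b * w f) \<in> tangent M p"
  using assms unfolding tangent_def by (simp add: algebra_simps)

lemma tangent_zero: "(\<lambda>f. 0) \<in> tangent M p"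
  by (simp add: tangent_def)

lemma tangent_sum_vec:
  "(\<And>i. i \<in> I \<Longrightarrow> v i \<in> tangent M p) \<Longrightarrow> (\<lambda>f. \<Sum>i\<in>I. c i * v i f) \<in> tangent M p"
proof (induction I rule: infinite_finite_induct)
  case (insert i I)
  then show ?case using tangent_comb[of "v i" p "\<lambda>f. \<Sum>i\<in>I. c i * v i f" "c i" 1] by simp
qed (simp_all add: tangent_zero)

lemma vfieldsD: "X \<in> vfields M \<Longrightarrow> X p \<in> tangent M p"
  by (simp add: vfields_def)

lemma vfields_smooth: "X \<in> vfields M \<Longrightarrow> f \<in> smooth_funs M \<Longrightarrow> (\<lambda>p. X p f) \<in> smooth_funs M"
  by (simp add: vfields_def)

lemma vfields_comb:
  assumes "X \<in> vfields M" "Y \<in> vfields M" "a \<in> smooth_funs M" "b \<in> smooth_funs M"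
  shows "(\<lambda>p f. a p * X p f + b p * Y p f) \<in> vfields M"
  using assms unfolding vfields_def by (auto intro!: tangent_comb smooth_intros)

lemma vfields_zero: "(\<lambda>p f. 0) \<in> vfields M"
  by (simp add: vfields_def tangent_zero smooth_const)

lemma vfields_sum:
  "(\<And>i. i \<in> I \<Longrightarrow> X i \<in> vfields M) \<Longrightarrow> (\<And>i. i \<in> I \<Longrightarrow> c i \<in> smooth_funs M) \<Longrightarrow>
    (\<lambda>p f. \<Sum>i\<in>I. c i p * X i p f) \<in> vfields M"
  unfolding vfields_def by (auto intro!: tangent_sum_vec smooth_intros)

section \<open>Coordinate frames made of global fields\<close>

text \<open>Coordinates with their coordinate fields, cut off so as to exist on all of M. Only over
  N are the E b dual to the x b and spanning.\<close>

definition frame :: "'a set \<Rightarrow> ('e \<Rightarrow> 'a vfield) \<Rightarrow> ('e \<Rightarrow> 'a \<Rightarrow> real) \<Rightarrow> bool" where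
  "frame N E x \<longleftrightarrow> open N \<and> (\<forall>b. E b \<in> vfields M) \<and> (\<forall>b. x b \<in> smooth_funs M) \<and>
     (\<forall>q\<in>N. \<forall>b\<in>Basis. \<forall>c\<in>Basis. E b q (x c) = (if b = c then 1 else 0)) \<and>
     (\<forall>q\<in>N. \<forall>v\<in>tangent M q. \<forall>f. v f = (\<Sum>b\<in>Basis. v (x b) * E b q f))"

text \<open>N is the part of the chart where the cutoff h is 1, so there E b is the partial
  derivative in direction b. Spanning is Hadamard's lemma applied to the chart expression of f at
  the given point.\<close>

lemma frame_ex:
  obtains N E x where "frame N E x" "p \<in> N"
proof -
  obtain U \<phi> where c: "(U, \<phi>) \<in> M" "p \<in> U" by (rule chart_ex)
  note inv = chartD(5)[OF c(1)]
  obtain r where r: "r > 0" "cball (\<phi> p) r \<subseteq> \<phi> ` U"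
    using chartD(2)[OF c(1)] c(2) unfolding open_contains_cball by blast
  obtain h where h: "smooth_on UNIV h" "\<And>x. x \<in> ball (\<phi> p) (r/2) \<Longrightarrow> h x = (1::real)"
    "\<And>x. x \<notin> cball (\<phi> p) r \<Longrightarrow> h x = 0"
    using smooth_bump_euclidean[of "r/2" "\<phi> p"] r(1) by auto
  define B where "B = ball (\<phi> p) (r/2)"
  have B: "open B" "convex B" "B \<subseteq> \<phi> ` U" "\<phi> p \<in> B" using r by (auto simp: B_def)
  define N where "N = {q \<in> U. \<phi> q \<in> B}"
  have N: "open N" unfolding N_def using chart_preimage_open[OF c(1) B(1)] .
  have push: "(\<lambda>q. if q \<in> U then h (\<phi> q) * g (\<phi> q) else 0) \<in> smooth_funs M"
    if "smooth_on (\<phi> ` U) g" for g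
    by (rule smooth_push[OF c(1) smooth_on_mult[OF chartD(2)[OF c(1)] smooth_on_subset[OF h(1)] that],
          of "cball (\<phi> p) r"]) (use r h(3) in auto)
  define x where "x = (\<lambda>b q. if q \<in> U then h (\<phi> q) * (\<phi> q \<bullet> b) else 0)"
  \<comment> \<open>The outer case distinction is the convention of \<open>tangent\<close> for
    functions that are not smooth.\<close>
  define E where "E = (\<lambda>b q f. if f \<in> smooth_funs M then
     (if q \<in> U then h (\<phi> q) * frechet_derivative (f \<circ> inv_into U \<phi>) (at (\<phi> q)) b else 0) else 0)"
  have sm: "smooth_on (\<phi> ` U) (f \<circ> inv_into U \<phi>)" if "f \<in> smooth_funs M" for f
    using that c(1) by (auto simp: smooth_funs_def)
  have der: "(f \<circ> inv_into U \<phi> has_derivative frechet_derivative (f \<circ> inv_into U \<phi>) (at (\<phi> q))) (at (\<phi> q))"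
    if "f \<in> smooth_funs M" "q \<in> U" for f q
    using smooth_on_has_derivative[OF chartD(2)[OF c(1)] sm[OF that(1)]] that(2) by blast
  have x_smooth: "x b \<in> smooth_funs M" for b
    unfolding x_def by (intro push smooth_on_linear bounded_linear_inner_left chartD(2)[OF c(1)])
  have E_tan: "E b q \<in> tangent M q" for b q
  proof (cases "q \<in> U")
    case False
    then have "E b q = (\<lambda>f. 0)" by (auto simp: E_def)
    then show ?thesis by (simp add: tangent_zero)
  next
    case True
    show ?thesis
      unfolding tangent_def
    proof (intro CollectI conjI allI ballI impI)
      show "E b q f = 0" if "f \<notin> smooth_funs M" for f using that by (simp add: E_def)
    next
      fix f g s t assume fg: "f \<in> smooth_funs M" "g \<in> smooth_funs M"
      have "((\<lambda>y. s * (f \<circ> inv_into U \<phi>) y + t * (g \<circ> inv_into U \<phi>) y) has_derivative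
         (\<lambda>v. s * frechet_derivative (f \<circ> inv_into U \<phi>) (at (\<phi> q)) v +
              t * frechet_derivative (g \<circ> inv_into U \<phi>) (at (\<phi> q)) v)) (at (\<phi> q))"
        by (intro has_derivative_add has_derivative_mult_right der fg True)
      from frechet_derivative_at[OF this, symmetric]
      show "E b q (\<lambda>x. s * f x + t * g x) = s * E b q f + t * E b q g"
        using fg True by (simp add: E_def smooth_intros o_def distrib_left)
    next
      fix f g assume fg: "f \<in> smooth_funs M" "g \<in> smooth_funs M"
      have "((\<lambda>y. (f \<circ> inv_into U \<phi>) y * (g \<circ> inv_into U \<phi>) y) has_derivative
         (\<lambda>v. (f \<circ> inv_into U \<phi>) (\<phi> q) * frechet_derivative (g \<circ> inv_into U \<phi>) (at (\<phi> q)) v +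
              frechet_derivative (f \<circ> inv_into U \<phi>) (at (\<phi> q)) v * (g \<circ> inv_into U \<phi>) (\<phi> q))) (at (\<phi> q))"
        by (intro has_derivative_mult der fg True)
      from frechet_derivative_at[OF this, symmetric]
      show "E b q (\<lambda>x. f x * g x) = f q * E b q g + g q * E b q f"
        using fg True inv[OF True] by (simp add: E_def smooth_intros o_def distrib_left)
    qed
  qed
  have E_vf: "E b \<in> vfields M" for b
    unfolding vfields_def
  proof (intro CollectI conjI allI ballI)
    fix f assume f: "f \<in> smooth_funs M"
    then have "(\<lambda>q. E b q f) = (\<lambda>q. if q \<in> U then h (\<phi> q) *
        frechet_derivative (f \<circ> inv_into U \<phi>) (at (\<phi> q)) b else 0)"
      by (simp add: E_def)
    then show "(\<lambda>q. E b q f) \<in> smooth_funs M"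
      using push[OF smooth_on_deriv[OF sm[OF f]], of b] by simp
  qed (rule E_tan)
  have E_N: "E b q f = frechet_derivative (f \<circ> inv_into U \<phi>) (at (\<phi> q)) b"
    if "f \<in> smooth_funs M" "q \<in> N" for b q f
    using that h(2) by (simp add: E_def N_def B_def)
  have delta: "E b q (x b') = (if b = b' then 1 else 0)" if "q \<in> N" "b \<in> Basis" "b' \<in> Basis" for q b b'
  proof -
    have "((\<lambda>y. y \<bullet> b') has_derivative (\<lambda>v. v \<bullet> b')) (at (\<phi> q))"
      by (auto intro!: derivative_eq_intros)
    then have "(x b' \<circ> inv_into U \<phi> has_derivative (\<lambda>v. v \<bullet> b')) (at (\<phi> q))"
    proof (rule has_derivative_transform_within_open[OF _ B(1)])
      show "\<phi> q \<in> B" using that by (simp add: N_def)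
      fix y assume y: "y \<in> B"
      with B(3) obtain q' where "q' \<in> U" "y = \<phi> q'" by blast
      with inv y h(2) show "y \<bullet> b' = (x b' \<circ> inv_into U \<phi>) y" by (simp add: x_def B_def)
    qed
    from frechet_derivative_at[OF this, symmetric] E_N[OF x_smooth that(1)] that(2,3)
    show ?thesis by (simp add: inner_Basis)
  qed
  have decomp: "v f = (\<Sum>b\<in>Basis. v (x b) * E b q f)" if q: "q \<in> N" and v: "v \<in> tangent M q" for q v f
  proof (cases "f \<in> smooth_funs M")
    case False
    then show ?thesis using tangent_nonsmooth[OF v] tangent_nonsmooth[OF E_tan] by simp
  next
    case True
    define F where "F = f \<circ> inv_into U \<phi>"
    have qU: "q \<in> U" "\<phi> q \<in> B" using q by (auto simp: N_def)
    have "smooth_on B F" using smooth_on_subset[OF sm[OF True] B(3)] by (simp add: F_def)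
    from Hadamard_lemma[OF B(1,2) qU(2) this]
    obtain G where G: "\<And>b. smooth_on B (G b)"
      "\<And>y. y \<in> B \<Longrightarrow> F y = F (\<phi> q) + (\<Sum>b\<in>Basis. ((y - \<phi> q) \<bullet> b) * G b y)"
      "\<And>b. G b (\<phi> q) = frechet_derivative F (at (\<phi> q)) b" by blast
    obtain s where s: "s > 0" "cball (\<phi> q) s \<subseteq> B" using B(1) qU(2) unfolding open_contains_cball by blast
    obtain k where k: "smooth_on UNIV k" "\<And>x. x \<in> ball (\<phi> q) (s/2) \<Longrightarrow> k x = (1::real)"
      "\<And>x. x \<notin> cball (\<phi> q) s \<Longrightarrow> k x = 0"
      using smooth_bump_euclidean[of "s/2" "\<phi> q"] s(1) by auto
    \<comment> \<open>The Hadamard coefficients exist on B only. The second cutoff k, supported in B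
      and 1 near the image of q, makes them smooth everywhere; \<open>push\<close> then contributes
      the factor h, which is 1 on B.\<close>
    define g where "g = (\<lambda>b q. if q \<in> U then h (\<phi> q) * (k (\<phi> q) * G b (\<phi> q)) else 0)"
    have g: "g b \<in> smooth_funs M" for b
      unfolding g_def
      by (intro push smooth_on_subset[OF smooth_on_cutoff[OF B(1) G(1) k(1) closed_cball s(2) k(3)]]) auto
    define N2 where "N2 = {q' \<in> U. \<phi> q' \<in> ball (\<phi> q) (s/2)}"
    have N2: "open N2" "q \<in> N2"
      unfolding N2_def using chart_preimage_open[OF c(1) open_ball] by (blast, use qU s in simp)
    define R where "R = (\<lambda>q'. f q + (\<Sum>b\<in>Basis. (x b q' - x b q) * g b q'))"
    have R: "R \<in> smooth_funs M" unfolding R_def by (intro smooth_intros x_smooth g)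
    have "v f = v R"
    proof (rule tangent_local[OF v N2 _ True R])
      fix q' assume q': "q' \<in> N2"
      have qB: "\<phi> q' \<in> B" "q' \<in> U" using q' s by (auto simp: N2_def)
      have "g b q' = G b (\<phi> q')" for b
        using q' qB h(2) k(2) by (simp add: g_def N2_def B_def)
      moreover have "x b q' - x b q = (\<phi> q' - \<phi> q) \<bullet> b" for b
        using qB qU h(2) by (simp add: x_def B_def inner_diff_left)
      ultimately show "f q' = R q'"
        using G(2)[OF qB(1)] inv[OF qB(2)] inv[OF qU(1)] by (simp add: R_def F_def)
    qed
    also have "\<dots> = (\<Sum>b\<in>Basis. v (\<lambda>q'. (x b q' - x b q) * g b q'))"
      unfolding R_def
      by (simp add: tangent_add[OF v] tangent_sum[OF v] tangent_const[OF v] smooth_intros x_smooth g)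
    also have "\<dots> = (\<Sum>b\<in>Basis. v (x b) * E b q f)"
    proof (rule sum.cong[OF refl])
      \<comment> \<open>x b minus its value at q vanishes at q, so the Leibniz rule keeps only the
        term in which x b is differentiated.\<close>
      fix b
      have "g b q = G b (\<phi> q)" using qU h(2) k(2) s by (simp add: g_def B_def)
      also have "\<dots> = E b q f" using G(3) E_N[OF True q] by (simp add: F_def)
      finally show "v (\<lambda>q'. (x b q' - x b q) * g b q') = v (x b) * E b q f"
        using tangent_mult[OF v _ g, of "\<lambda>q'. x b q' - x b q"]
        by (simp add: smooth_intros x_smooth tangent_diff[OF v] tangent_const[OF v])
    qed
    finally show ?thesis .
  qed
  have "frame N E x" unfolding frame_def using N E_vf x_smooth delta decomp by blast
  moreover have "p \<in> N" using c B by (simp add: N_def)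
  ultimately show thesis by (rule that)
qed

text \<open>The components of v at p are used as constant coefficients of the frame fields.\<close>

lemma extend_tangent:
  assumes "v \<in> tangent M p"
  obtains X where "X \<in> vfields M" "X p = v"
proof -
  obtain N E x where f: "frame N E x" "p \<in> N" by (rule frame_ex)
  show ?thesis
  proof
    show "(\<lambda>q f. \<Sum>b\<in>Basis. v (x b) * E b q f) \<in> vfields M"
      using f(1) by (intro vfields_sum smooth_const) (auto simp: frame_def)
    show "(\<lambda>f. \<Sum>b\<in>Basis. v (x b) * E b p f) = v"
      using f assms by (auto simp: frame_def)
  qed
qed

end

section \<open>Alternating functions and tensoriality\<close>

text \<open>The carrier and its addition are parameters, so that the sign rules serve vector fields
  evaluated at a point as well as tangent vectors. Vanishing is demanded for adjacent equal entries
  only; \<open>altern_repeat\<close> extends it.\<close>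

definition altern :: "'b set \<Rightarrow> ('b \<Rightarrow> 'b \<Rightarrow> 'b) \<Rightarrow> nat \<Rightarrow> ('b list \<Rightarrow> real) \<Rightarrow> bool" where
  "altern T add k G \<longleftrightarrow>
     (\<forall>X\<in>T. \<forall>Y\<in>T. add X Y \<in> T) \<and>
     (\<forall>us ws. \<forall>X\<in>T. \<forall>Y\<in>T. length us + length ws + 1 = k \<longrightarrow> set us \<subseteq> T \<longrightarrow> set ws \<subseteq> T \<longrightarrow>
        G (us @ add X Y # ws) = G (us @ X # ws) + G (us @ Y # ws)) \<and>
     (\<forall>us ws. \<forall>X\<in>T. length us + length ws + 2 = k \<longrightarrow> set us \<subseteq> T \<longrightarrow> set ws \<subseteq> T \<longrightarrow>
        G (us @ X # X # ws) = 0)"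

lemma altern_prefix:
  assumes "altern T add (length ps + k) G" "set ps \<subseteq> T"
  shows "altern T add k (\<lambda>l. G (ps @ l))"
proof -
  have "G ((ps @ us) @ add X Y # ws) = G ((ps @ us) @ X # ws) + G ((ps @ us) @ Y # ws)"
    if "X \<in> T" "Y \<in> T" "length us + length ws + 1 = k" "set us \<subseteq> T" "set ws \<subseteq> T" for us ws X Y
    using assms that unfolding altern_def by (auto simp del: append_assoc)
  moreover have "G ((ps @ us) @ X # X # ws) = 0"
    if "X \<in> T" "length us + length ws + 2 = k" "set us \<subseteq> T" "set ws \<subseteq> T" for us ws X
    using assms that unfolding altern_def by (auto simp del: append_assoc)
  ultimately show ?thesis using assms(1) unfolding altern_def by simp
qed

text \<open>Polarization: expand the value with X + Y in both slots.\<close>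

lemma altern_swap:
  assumes "altern T add k G" "X \<in> T" "Y \<in> T" "set us \<subseteq> T" "set ws \<subseteq> T"
    "length us + length ws + 2 = k"
  shows "G (us @ X # Y # ws) = - G (us @ Y # X # ws)"
proof -
  have cl: "add X Y \<in> T" using assms unfolding altern_def by blast
  have lin: "G (us @ add X Y # Z # ws) = G (us @ X # Z # ws) + G (us @ Y # Z # ws)" if "Z \<in> T" for Z
    using assms that unfolding altern_def by auto
  have lin2: "G ((us @ [Z]) @ add X Y # ws) = G ((us @ [Z]) @ X # ws) + G ((us @ [Z]) @ Y # ws)"
    if "Z \<in> T" for Z
    using assms that unfolding altern_def by (auto simp del: append_assoc)
  have z: "G (us @ Z # Z # ws) = 0" if "Z \<in> T" for Z
    using assms that unfolding altern_def by auto
  have "0 = G (us @ add X Y # add X Y # ws)" using z[OF cl] by simp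
  also have "\<dots> = G (us @ X # Y # ws) + G (us @ Y # X # ws)"
    using lin[OF cl] lin2[OF assms(2)] lin2[OF assms(3)] z[OF assms(2)] z[OF assms(3)] by simp
  finally show ?thesis by simp
qed

lemma altern_move:
  assumes "altern T add k G" "X \<in> T" "set us \<subseteq> T" "set ws \<subseteq> T" "length us + length ws + 1 = k"
  shows "G (us @ X # ws) = (-1) ^ length us * G (X # us @ ws)"
  using assms(3-)
proof (induction us arbitrary: ws rule: rev_induct)
  case (snoc Z us)
  have "G (us @ Z # X # ws) = - G (us @ X # Z # ws)"
    by (rule altern_swap[OF assms(1)]) (use snoc.prems assms in auto)
  with snoc.IH[of "Z # ws"] snoc.prems show ?case by simp
qed simp

text \<open>Everything up to the first copy of the repeated entry is frozen as a prefix, and the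
  second copy is moved next to the first.\<close>

lemma altern_repeat:
  assumes "altern T add k G" "set xs \<subseteq> T" "length xs = k" "\<not> distinct xs"
  shows "G xs = 0"
proof -
  obtain us y zs ws where xs: "xs = us @ [y] @ zs @ [y] @ ws"
    using not_distinct_decomp[OF assms(4)] by blast
  have "altern T add (length zs + length ws + 1) (\<lambda>l. G ((us @ [y]) @ l))"
    by (rule altern_prefix) (use assms xs in auto)
  then have "G ((us @ [y]) @ zs @ y # ws) = (-1) ^ length zs * G ((us @ [y]) @ y # zs @ ws)"
    by (rule altern_move) (use assms xs in auto)
  moreover have "G (us @ y # y # zs @ ws) = 0"
    using assms xs unfolding altern_def by auto
  ultimately show ?thesis by (simp add: xs)
qed

text \<open>Only vanishing is transported between orderings, so the sign of the permutation can stay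
  implicit.\<close>

lemma altern_mset:
  assumes "altern T add k G" "set ys \<subseteq> T" "length ys = k" "mset xs = mset ys" "G ys = 0"
  shows "G xs = 0"
  using assms
proof (induction ys arbitrary: xs k G)
  case (Cons e ys)
  have "e \<in> set xs" using Cons.prems(4) by (metis list.set_intros(1) set_mset_mset)
  then obtain us ws where xs: "xs = us @ e # ws" by (meson split_list)
  then have m: "mset (us @ ws) = mset ys" using Cons.prems(4) by simp
  have l: "length us + length ws = length ys" using mset_eq_length[OF m] by simp
  have s: "set us \<union> set ws = set ys" using mset_eq_setD[OF m] by simp
  have a: "altern T add (length [e] + length ys) G" using Cons.prems(1,3) by simp
  have "G (e # us @ ws) = 0"
    using Cons.IH[OF altern_prefix[OF a] _ refl m] Cons.prems by auto
  moreover have "G (us @ e # ws) = (-1) ^ length us * G (e # us @ ws)"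
    by (rule altern_move[OF Cons.prems(1)]) (use Cons.prems l s in auto)
  ultimately show ?case by (simp add: xs)
qed simp

context smooth_mfd
begin

section \<open>Maps on vector fields that are multilinear over smooth functions\<close>

definition tens :: "nat \<Rightarrow> ('a vfield list \<Rightarrow> 'a \<Rightarrow> real) \<Rightarrow> bool" where
  "tens k F \<longleftrightarrow>
     (\<forall>Xs. length Xs = k \<longrightarrow> set Xs \<subseteq> vfields M \<longrightarrow> F Xs \<in> smooth_funs M) \<and>
     (\<forall>us ws. \<forall>X\<in>vfields M. \<forall>Y\<in>vfields M. \<forall>a\<in>smooth_funs M. \<forall>b\<in>smooth_funs M.
        length us + length ws + 1 = k \<longrightarrow> set us \<subseteq> vfields M \<longrightarrow> set ws \<subseteq> vfields M \<longrightarrow>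
        F (us @ (\<lambda>p f. a p * X p f + b p * Y p f) # ws) =
          (\<lambda>p. a p * F (us @ X # ws) p + b p * F (us @ Y # ws) p)) \<and>
     (\<forall>us ws. \<forall>X\<in>vfields M.
        length us + length ws + 2 = k \<longrightarrow> set us \<subseteq> vfields M \<longrightarrow> set ws \<subseteq> vfields M \<longrightarrow>
        F (us @ X # X # ws) = (\<lambda>p. 0))"

lemma tens_smooth:
  "tens k F \<Longrightarrow> length Xs = k \<Longrightarrow> set Xs \<subseteq> vfields M \<Longrightarrow> F Xs \<in> smooth_funs M"
  unfolding tens_def by blast

lemma tens_lin:
  assumes "tens k F" "X \<in> vfields M" "Y \<in> vfields M" "a \<in> smooth_funs M" "b \<in> smooth_funs M"
    "set us \<subseteq> vfields M" "set ws \<subseteq> vfields M" "length us + length ws + 1 = k"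
  shows "F (us @ (\<lambda>p f. a p * X p f + b p * Y p f) # ws) =
    (\<lambda>p. a p * F (us @ X # ws) p + b p * F (us @ Y # ws) p)"
  using assms unfolding tens_def by blast

lemma tens_add:
  assumes "tens k F" "X \<in> vfields M" "Y \<in> vfields M"
    "set us \<subseteq> vfields M" "set ws \<subseteq> vfields M" "length us + length ws + 1 = k"
  shows "F (us @ (\<lambda>p f. X p f + Y p f) # ws) = (\<lambda>p. F (us @ X # ws) p + F (us @ Y # ws) p)"
  using tens_lin[OF assms(1-3) smooth_const[of 1] smooth_const[of 1] assms(4-)] by simp

lemma tens_scale:
  assumes "tens k F" "X \<in> vfields M" "a \<in> smooth_funs M"
    "set us \<subseteq> vfields M" "set ws \<subseteq> vfields M" "length us + length ws + 1 = k"
  shows "F (us @ (\<lambda>p f. a p * X p f) # ws) = (\<lambda>p. a p * F (us @ X # ws) p)"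
  using tens_lin[OF assms(1,2,2,3) smooth_const[of 0] assms(4-)] by simp

lemma tens_adj:
  assumes "tens k F" "X \<in> vfields M" "set us \<subseteq> vfields M" "set ws \<subseteq> vfields M"
    "length us + length ws + 2 = k"
  shows "F (us @ X # X # ws) = (\<lambda>p. 0)"
  using assms unfolding tens_def by blast

lemma tens_altern:
  assumes "tens k F"
  shows "altern (vfields M) (\<lambda>X Y p f. X p f + Y p f) k (\<lambda>Xs. F Xs p)"
proof -
  have "(\<lambda>p f. X p f + Y p f) \<in> vfields M" if "X \<in> vfields M" "Y \<in> vfields M" for X Y
    using vfields_comb[OF that smooth_const[of 1] smooth_const[of 1]] by simp
  then show ?thesis unfolding altern_def by (simp add: tens_add[OF assms] tens_adj[OF assms])
qed

lemma tens_sum: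
  assumes "tens k F" "finite I" "\<And>i. i \<in> I \<Longrightarrow> X i \<in> vfields M" "\<And>i. i \<in> I \<Longrightarrow> c i \<in> smooth_funs M"
    "set us \<subseteq> vfields M" "set ws \<subseteq> vfields M" "length us + length ws + 1 = k"
  shows "F (us @ (\<lambda>p f. \<Sum>i\<in>I. c i p * X i p f) # ws) = (\<lambda>p. \<Sum>i\<in>I. c i p * F (us @ X i # ws) p)"
  using assms(2-4)
proof (induction I)
  case empty
  show ?case
    using tens_scale[OF assms(1) vfields_zero smooth_const[of 0] assms(5-)] by simp
next
  case (insert i I)
  have "(\<lambda>p f. \<Sum>i\<in>I. c i p * X i p f) \<in> vfields M" using insert by (intro vfields_sum) auto
  from tens_lin[OF assms(1) _ this _ smooth_const[of 1] assms(5-), of "X i" "c i"] insert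
  show ?case by simp
qed

text \<open>Multiplying Z by a bump \<beta> does not change the value at p, and \<beta> Z is a
  combination of frame fields whose coefficients can be pulled out. The result involves Z only
  through its components at p.\<close>

lemma tens_pointwise:
  assumes F: "tens k F" and X: "X \<in> vfields M" and Y: "Y \<in> vfields M" and XY: "X p = Y p"
    and l: "set us \<subseteq> vfields M" "set ws \<subseteq> vfields M" "length us + length ws + 1 = k"
  shows "F (us @ X # ws) p = F (us @ Y # ws) p"
proof -
  obtain N E x where fr: "frame N E x" and p: "p \<in> N" by (rule frame_ex)
  obtain \<beta> where \<beta>: "\<beta> \<in> smooth_funs M" "\<beta> p = 1" "\<And>q. q \<notin> N \<Longrightarrow> \<beta> q = 0"
    using bump_ex[of N p] fr p unfolding frame_def by metis
  have "F (us @ Z # ws) p = (\<Sum>b\<in>Basis. Z p (x b) * F (us @ E b # ws) p)" if Z: "Z \<in> vfields M" for Z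
  proof -
    \<comment> \<open>The expansion in the frame is valid on N; outside N both sides vanish with
      \<beta>, so the identity is global.\<close>
    have eq: "(\<lambda>q f. \<beta> q * Z q f) = (\<lambda>q f. \<Sum>b\<in>Basis. (\<beta> q * Z q (x b)) * E b q f)"
    proof (intro ext)
      fix q f
      show "\<beta> q * Z q f = (\<Sum>b\<in>Basis. (\<beta> q * Z q (x b)) * E b q f)"
      proof (cases "q \<in> N")
        case True
        then have "Z q f = (\<Sum>b\<in>Basis. Z q (x b) * E b q f)"
          using fr vfieldsD[OF Z] unfolding frame_def by blast
        then show ?thesis by (simp add: sum_distrib_left mult.assoc)
      qed (simp add: \<beta>(3))
    qed
    have "F (us @ Z # ws) p = F (us @ (\<lambda>q f. \<beta> q * Z q f) # ws) p"
      using tens_scale[OF F Z \<beta>(1) l] \<beta>(2) by simp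
    also have "\<dots> = (\<Sum>b\<in>Basis. (\<beta> p * Z p (x b)) * F (us @ E b # ws) p)"
      unfolding eq
      using tens_sum[OF F finite_Basis _ _ l, of E "\<lambda>b q. \<beta> q * Z q (x b)"] fr Z \<beta>(1)
      by (simp add: frame_def smooth_mult vfields_smooth)
    finally show ?thesis using \<beta>(2) by simp
  qed
  from this[OF X] this[OF Y] XY show ?thesis by simp
qed

text \<open>One slot is exchanged at a time; the prefix \<open>us\<close> collects the slots already
  treated.\<close>

lemma tens_pointwise_list:
  assumes "tens k F" "list_all2 (\<lambda>X Y. X p = Y p) Xs Ys" "set us \<subseteq> vfields M"
    "set Xs \<subseteq> vfields M" "set Ys \<subseteq> vfields M" "length us + length Xs = k"
  shows "F (us @ Xs) p = F (us @ Ys) p"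
  using assms(2-)
proof (induction arbitrary: us rule: list_all2_induct)
  case (Cons X Xs Y Ys)
  have "length Xs = length Ys" using Cons(2) by (rule list_all2_lengthD)
  have "F (us @ X # Xs) p = F (us @ Y # Xs) p"
    by (rule tens_pointwise[OF assms(1)]) (use Cons in auto)
  also have "\<dots> = F (us @ Y # Ys) p" using Cons.IH[of "us @ [Y]"] Cons.prems by simp
  finally show ?case .
qed simp

section \<open>Covectors, and the passage between tensorial maps and forms\<close>

lemma covectors_lin:
  assumes "\<omega> \<in> covectors M p k" "v \<in> tangent M p" "w \<in> tangent M p"
    "set us \<subseteq> tangent M p" "set ws \<subseteq> tangent M p" "length us + length ws + 1 = k"
  shows "\<omega> (us @ (\<lambda>f. a * v f + b * w f) # ws) = a * \<omega> (us @ v # ws) + b * \<omega> (us @ w # ws)"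
proof -
  have "us @ v # ws \<in> tuples M p k" using assms by (simp add: tuples_def)
  then show ?thesis using assms(1-3) unfolding covectors_def by blast
qed

lemma covectors_altern:
  assumes "\<omega> \<in> covectors M p k"
  shows "altern (tangent M p) (\<lambda>v w f. v f + w f) k \<omega>"
  unfolding altern_def
proof (intro conjI ballI allI impI)
  fix v w assume "v \<in> tangent M p" "w \<in> tangent M p"
  then show "(\<lambda>f. v f + w f) \<in> tangent M p" using tangent_comb[of v p w 1 1] by simp
next
  fix us ws v w
  assume "v \<in> tangent M p" "w \<in> tangent M p" "length us + length ws + 1 = k"
    "set us \<subseteq> tangent M p" "set ws \<subseteq> tangent M p"
  then show "\<omega> (us @ (\<lambda>f. v f + w f) # ws) = \<omega> (us @ v # ws) + \<omega> (us @ w # ws)"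
    using covectors_lin[OF assms, of v w us ws 1 1] by simp
next
  fix us ws v
  assume *: "v \<in> tangent M p" "length us + length ws + 2 = k"
    "set us \<subseteq> tangent M p" "set ws \<subseteq> tangent M p"
  then have "us @ v # v # ws \<in> tuples M p k" by (simp add: tuples_def)
  moreover have "(us @ v # v # ws) ! length us = (us @ v # v # ws) ! Suc (length us)"
    by (simp add: nth_append)
  moreover have "Suc (length us) < k" using * by simp
  ultimately show "\<omega> (us @ v # v # ws) = 0" using assms lessI unfolding covectors_def by blast
qed

lemma covectors_sum:
  assumes "\<omega> \<in> covectors M p k" "finite I" "\<And>i. i \<in> I \<Longrightarrow> v i \<in> tangent M p"
    "set us \<subseteq> tangent M p" "set ws \<subseteq> tangent M p" "length us + length ws + 1 = k"
  shows "\<omega> (us @ (\<lambda>f. \<Sum>i\<in>I. c i * v i f) # ws) = (\<Sum>i\<in>I. c i * \<omega> (us @ v i # ws))"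
  using assms(2,3)
proof (induction I)
  case empty
  show ?case using covectors_lin[OF assms(1) tangent_zero tangent_zero assms(4-), of 0 0] by simp
next
  case (insert i I)
  have "(\<lambda>f. \<Sum>i\<in>I. c i * v i f) \<in> tangent M p" using insert by (intro tangent_sum_vec) auto
  from covectors_lin[OF assms(1) _ this assms(4-), of "v i" "c i" 1] insert
  show ?case by simp
qed

text \<open>The form evaluates F on arbitrarily chosen extensions of tangent vectors to fields;
  \<open>tens_pointwise\<close> makes the value independent of the choice.\<close>

lemma form_of_tens:
  assumes F: "tens k F"
  obtains \<eta> where "\<eta> \<in> forms M k"
    "\<And>Xs p. length Xs = k \<Longrightarrow> set Xs \<subseteq> vfields M \<Longrightarrow> form_eval \<eta> Xs p = F Xs p"
proof
  define ex where "ex = (\<lambda>p v. SOME X. X \<in> vfields M \<and> X p = v)"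
  have ex: "ex p v \<in> vfields M" "ex p v p = v" if "v \<in> tangent M p" for p v
    using someI_ex[of "\<lambda>X. X \<in> vfields M \<and> X p = v"] extend_tangent[OF that]
    unfolding ex_def by blast+
  have exs: "set (map (ex p) vs) \<subseteq> vfields M" if "set vs \<subseteq> tangent M p" for p vs
    using ex(1) that by auto
  define \<eta> where "\<eta> = (\<lambda>p vs. if vs \<in> tuples M p k then F (map (ex p) vs) p else 0)"
  have "\<eta> p \<in> covectors M p k" for p
    unfolding covectors_def
  proof (intro CollectI conjI allI ballI impI)
    show "\<eta> p vs = 0" if "vs \<notin> tuples M p k" for vs using that by (simp add: \<eta>_def)
  next
    fix us ws v w a b
    assume v: "v \<in> tangent M p" and w: "w \<in> tangent M p" and t: "us @ v # ws \<in> tuples M p k"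
    note vw = tangent_comb[OF v w, of a b]
    have uw: "set us \<subseteq> tangent M p" "set ws \<subseteq> tangent M p" "length us + length ws + 1 = k"
      using t by (auto simp: tuples_def)
    have l: "length (map (ex p) us) + length (map (ex p) ws) + 1 = k" using uw by simp
    \<comment> \<open>The extension chosen for the combination and the combination of the chosen
      extensions agree at p, which is all that \<open>tens_pointwise\<close> asks.\<close>
    have "F (map (ex p) us @ ex p (\<lambda>f. a * v f + b * w f) # map (ex p) ws) p =
      F (map (ex p) us @ (\<lambda>q f. a * ex p v q f + b * ex p w q f) # map (ex p) ws) p"
      by (rule tens_pointwise[OF F ex(1)[OF vw] vfields_comb[OF ex(1)[OF v] ex(1)[OF w] smooth_const smooth_const] _
            exs[OF uw(1)] exs[OF uw(2)] l]) (simp add: ex(2)[OF v] ex(2)[OF w] ex(2)[OF vw])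
    also have "\<dots> = a * F (map (ex p) us @ ex p v # map (ex p) ws) p +
        b * F (map (ex p) us @ ex p w # map (ex p) ws) p"
      using tens_lin[OF F ex(1)[OF v] ex(1)[OF w] smooth_const smooth_const
          exs[OF uw(1)] exs[OF uw(2)] l, of a b] by simp
    finally show "\<eta> p (us @ (\<lambda>f. a * v f + b * w f) # ws) = a * \<eta> p (us @ v # ws) + b * \<eta> p (us @ w # ws)"
      using t w vw by (simp add: \<eta>_def tuples_def)
  next
    fix vs i j assume *: "vs \<in> tuples M p k" "i < j" "j < k" "vs ! i = vs ! j"
    have "\<not> distinct vs"
      using * nth_eq_iff_index_eq[of vs i j] by (auto simp: tuples_def)
    then have "\<not> distinct (map (ex p) vs)" by (simp add: distinct_map)
    then show "\<eta> p vs = 0"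
      using altern_repeat[OF tens_altern[OF F] exs] * by (auto simp: \<eta>_def tuples_def)
  qed
  moreover have ev: "form_eval \<eta> Xs p = F Xs p" if "length Xs = k" "set Xs \<subseteq> vfields M" for Xs p
  proof -
    have t: "set (map (\<lambda>X. X p) Xs) \<subseteq> tangent M p" using that(2) vfieldsD by auto
    have "F ([] @ map (ex p) (map (\<lambda>X. X p) Xs)) p = F ([] @ Xs) p"
    proof (rule tens_pointwise_list[OF F])
      show "list_all2 (\<lambda>X Y. X p = Y p) (map (ex p) (map (\<lambda>X. X p) Xs)) Xs"
        using that(2) ex(2) vfieldsD by (auto simp: list.rel_map list_all2_same)
    qed (use that exs[OF t] in auto)
    then show ?thesis using that t by (simp add: form_eval_def \<eta>_def tuples_def)
  qed
  moreover have "form_eval \<eta> Xs = F Xs" if "length Xs = k" "set Xs \<subseteq> vfields M" for Xs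
    using ev[OF that] by blast
  ultimately show "\<eta> \<in> forms M k"
    unfolding forms_def using tens_smooth[OF F] by simp
  show "form_eval \<eta> Xs p = F Xs p" if "length Xs = k" "set Xs \<subseteq> vfields M" for Xs p
    by (rule ev[OF that])
qed

lemma formsD: "\<eta> \<in> forms M k \<Longrightarrow> \<eta> p \<in> covectors M p k"
  by (simp add: forms_def)

lemma forms_smooth:
  "\<eta> \<in> forms M k \<Longrightarrow> length Xs = k \<Longrightarrow> set Xs \<subseteq> vfields M \<Longrightarrow> form_eval \<eta> Xs \<in> smooth_funs M"
  by (simp add: forms_def)

lemma covectors_outside: "\<omega> \<in> covectors M p k \<Longrightarrow> vs \<notin> tuples M p k \<Longrightarrow> \<omega> vs = 0"
  by (simp add: covectors_def)

text \<open>Supplies uniqueness for the descriptions of \<open>ext_d\<close> and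
  \<open>lie_derivative\<close>: every tuple of tangent vectors is the value at p of a tuple of
  global fields.\<close>

lemma forms_eqI:
  assumes "\<eta> \<in> forms M k" "\<theta> \<in> forms M k"
    "\<And>Xs p. length Xs = k \<Longrightarrow> set Xs \<subseteq> vfields M \<Longrightarrow> form_eval \<eta> Xs p = form_eval \<theta> Xs p"
  shows "\<eta> = \<theta>"
proof (intro ext)
  fix p vs
  show "\<eta> p vs = \<theta> p vs"
  proof (cases "vs \<in> tuples M p k")
    case True
    have ex: "\<exists>Xs. length Xs = length vs \<and> set Xs \<subseteq> vfields M \<and> map (\<lambda>X. X p) Xs = vs"
      if "set vs \<subseteq> tangent M p" for vs
      using that
    proof (induction vs)
      case (Cons v vs)
      then obtain Xs where Xs: "length Xs = length vs" "set Xs \<subseteq> vfields M" "map (\<lambda>X. X p) Xs = vs" by auto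
      obtain X where "X \<in> vfields M" "X p = v" using extend_tangent Cons.prems by (metis list.set_intros(1) subsetD)
      with Xs show ?case by (intro exI[of _ "X # Xs"]) auto
    qed simp
    have "set vs \<subseteq> tangent M p" "length vs = k" using True by (simp_all add: tuples_def)
    with ex[of vs] obtain Xs where "length Xs = k" "set Xs \<subseteq> vfields M" "map (\<lambda>X. X p) Xs = vs"
      by blast
    with assms(3)[of Xs p] show ?thesis by (simp add: form_eval_def)
  next
    case False
    then show ?thesis using covectors_outside formsD assms(1,2) by metis
  qed
qed

lemma tens_form:
  assumes "\<eta> \<in> forms M k"
  shows "tens k (form_eval \<eta>)"
  unfolding tens_def
proof (intro conjI allI ballI impI)
  show "form_eval \<eta> Xs \<in> smooth_funs M" if "length Xs = k" "set Xs \<subseteq> vfields M" for Xs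
    using assms that by (rule forms_smooth)
next
  fix us ws X Y a b
  assume *: "X \<in> vfields M" "Y \<in> vfields M" "length us + length ws + 1 = k"
    "set us \<subseteq> vfields M" "set ws \<subseteq> vfields M"
  show "form_eval \<eta> (us @ (\<lambda>p f. a p * X p f + b p * Y p f) # ws) =
      (\<lambda>p. a p * form_eval \<eta> (us @ X # ws) p + b p * form_eval \<eta> (us @ Y # ws) p)"
  proof
    fix p
    have t: "set (map (\<lambda>X. X p) us) \<subseteq> tangent M p" "set (map (\<lambda>X. X p) ws) \<subseteq> tangent M p"
      using * vfieldsD by auto
    show "form_eval \<eta> (us @ (\<lambda>p f. a p * X p f + b p * Y p f) # ws) p =
      a p * form_eval \<eta> (us @ X # ws) p + b p * form_eval \<eta> (us @ Y # ws) p"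
      using covectors_lin[OF formsD[OF assms] vfieldsD[OF *(1)] vfieldsD[OF *(2)] t, of "a p" "b p"] *(3)
      by (simp add: form_eval_def)
  qed
next
  fix us ws X
  assume *: "X \<in> vfields M" "length us + length ws + 2 = k"
    "set us \<subseteq> vfields M" "set ws \<subseteq> vfields M"
  show "form_eval \<eta> (us @ X # X # ws) = (\<lambda>p. 0)"
  proof
    fix p
    have t: "set (map (\<lambda>X. X p) (us @ X # X # ws)) \<subseteq> tangent M p"
      using * vfieldsD by auto
    show "form_eval \<eta> (us @ X # X # ws) p = 0"
      using altern_repeat[OF covectors_altern[OF formsD[OF assms]] t] * by (simp add: form_eval_def)
  qed
qed

text \<open>The arguments are expanded in the frame from left to right; I records the basis elements
  already substituted. Lists with a repetition vanish by alternation.\<close>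

lemma covector_zeroI:
  assumes \<omega>: "\<omega> \<in> covectors M p k" and fr: "frame N E x" "p \<in> N"
    and 0: "\<And>I. length I = k \<Longrightarrow> set I \<subseteq> Basis \<Longrightarrow> distinct I \<Longrightarrow> \<omega> (map (\<lambda>b. E b p) I) = 0"
  shows "\<omega> = (\<lambda>vs. 0)"
proof -
  have Et: "E b p \<in> tangent M p" for b using fr vfieldsD by (auto simp: frame_def)
  have "\<omega> (map (\<lambda>b. E b p) I @ vs) = 0"
    if "length I + length vs = k" "set I \<subseteq> Basis" "set vs \<subseteq> tangent M p" for I vs
    using that
  proof (induction vs arbitrary: I)
    case Nil
    show ?case
    proof (cases "distinct I")
      case False
      then have "\<not> distinct (map (\<lambda>b. E b p) I)" by (simp add: distinct_map)
      then show ?thesis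
        using altern_repeat[OF covectors_altern[OF \<omega>], of "map (\<lambda>b. E b p) I"] Nil Et by auto
    qed (use Nil 0 in auto)
  next
    case (Cons v vs)
    have v: "v = (\<lambda>f. \<Sum>b\<in>Basis. v (x b) * E b p f)"
      using fr Cons.prems(3) unfolding frame_def by (simp add: fun_eq_iff)
    have "\<omega> (map (\<lambda>b. E b p) I @ v # vs) = (\<Sum>b\<in>Basis. v (x b) * \<omega> (map (\<lambda>b. E b p) I @ E b p # vs))"
      by (subst v, rule covectors_sum[OF \<omega> finite_Basis]) (use Cons.prems Et in auto)
    also have "\<dots> = 0"
    proof (rule sum.neutral, rule)
      fix b :: 'e assume "b \<in> Basis"
      with Cons.IH[of "I @ [b]"] Cons.prems
      show "v (x b) * \<omega> (map (\<lambda>b. E b p) I @ E b p # vs) = 0" by simp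
    qed
    finally show ?case .
  qed
  from this[of "[]"] have "\<omega> vs = 0" if "vs \<in> tuples M p k" for vs
    using that by (simp add: tuples_def)
  then show ?thesis using covectors_outside[OF \<omega>] by blast
qed

text \<open>In top degree every repetition-free list of basis elements is a rearrangement of J, so a
  single value decides.\<close>

lemma top_covector_zeroI:
  assumes \<omega>: "\<omega> \<in> covectors M p DIM('e)" and fr: "frame N E x" "p \<in> N"
    and J: "distinct J" "set J = (Basis :: 'e set)" and 0: "\<omega> (map (\<lambda>b. E b p) J) = 0"
  shows "\<omega> = (\<lambda>vs. 0)"
proof (rule covector_zeroI[OF \<omega> fr])
  have Et: "E b p \<in> tangent M p" for b using fr vfieldsD by (auto simp: frame_def)
  fix I :: "'e list" assume I: "length I = DIM('e)" "set I \<subseteq> Basis" "distinct I"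
  have "set I = Basis" using I by (intro card_subset_eq) (simp_all add: distinct_card)
  then have "mset I = mset J" using J I by (metis set_eq_iff_mset_eq_distinct)
  then have m: "mset (map (\<lambda>b. E b p) I) = mset (map (\<lambda>b. E b p) J)" by simp
  have "length J = DIM('e)" using J distinct_card by fastforce
  then show "\<omega> (map (\<lambda>b. E b p) I) = 0"
    using altern_mset[OF covectors_altern[OF \<omega>] _ _ m 0] Et by auto
qed

end

section \<open>The Lie derivative and the exterior derivative\<close>

lemma sum_lessThan_split:
  "(\<Sum>i<m + Suc n. f i :: real) = (\<Sum>i<m. f i) + f m + (\<Sum>i<n. f (m + Suc i))"
  by (induction n) (simp_all add: add.assoc)

lemma nths_remove: "nths xs (- {i}) = take i xs @ drop (Suc i) xs"
proof (induction xs arbitrary: i)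
  case (Cons x xs)
  show ?case
  proof (cases i)
    case 0
    have "{j. Suc j \<in> - {0}} = UNIV" by auto
    then show ?thesis using 0 by (simp add: nths_Cons nths_all)
  next
    case (Suc i')
    have "{j. Suc j \<in> - {Suc i'}} = - {i'}" by auto
    then show ?thesis using Suc Cons.IH[of i'] by (simp add: nths_Cons)
  qed
qed simp

text \<open>The cases that arise when a Koszul sum is split according to whether the first field is
  deleted.\<close>

lemma nths_Cons_remove:
  "nths (x # xs) (- {0}) = xs"
  "nths (x # xs) (- {Suc i}) = x # nths xs (- {i})"
  "nths (x # xs) (- {0, Suc i}) = nths xs (- {i})"
  "nths (x # xs) (- {Suc i, Suc j}) = x # nths xs (- {i, j})"
proof -
  have *: "{n. Suc n \<in> - {0, Suc i}} = - {i}" "{n. Suc n \<in> - {Suc i, Suc j}} = - {i, j}" by auto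
  show "nths (x # xs) (- {0}) = xs" "nths (x # xs) (- {Suc i}) = x # nths xs (- {i})"
    by (simp_all add: nths_remove)
  show "nths (x # xs) (- {0, Suc i}) = nths xs (- {i})"
    "nths (x # xs) (- {Suc i, Suc j}) = x # nths xs (- {i, j})"
    unfolding nths_Cons * by simp_all
qed

lemma length_nths_remove:
  "i < length xs \<Longrightarrow> length (nths xs (- {i})) = length xs - 1"
  "i < length xs \<Longrightarrow> j < length xs \<Longrightarrow> i \<noteq> j \<Longrightarrow> length (nths xs (- {i, j})) = length xs - 2"
proof -
  show "i < length xs \<Longrightarrow> length (nths xs (- {i})) = length xs - 1" by (simp add: nths_remove)
  assume *: "i < length xs" "j < length xs" "i \<noteq> j"
  have "{n. n < length xs \<and> n \<in> - {i, j}} = {..<length xs} - {i, j}" by auto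
  then show "length (nths xs (- {i, j})) = length xs - 2"
    using * by (simp add: length_nths card_Diff_subset)
qed

context smooth_mfd
begin

text \<open>In the Leibniz rule the mixed products of first derivatives are symmetric in X and Y and
  cancel.\<close>

lemma lie_bracket_vfields:
  assumes X: "X \<in> vfields M" and Y: "Y \<in> vfields M"
  shows "lie_bracket M X Y \<in> vfields M"
  unfolding vfields_def
proof (intro CollectI conjI allI ballI)
  note sX = vfields_smooth[OF X] and sY = vfields_smooth[OF Y]
  fix p
  note tX = vfieldsD[OF X, of p] and tY = vfieldsD[OF Y, of p]
  show "lie_bracket M X Y p \<in> tangent M p"
    unfolding tangent_def
  proof (intro CollectI conjI allI ballI impI)
    show "lie_bracket M X Y p f = 0" if "f \<notin> smooth_funs M" for f
      using that by (simp add: lie_bracket_def)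
  next
    fix f g a b assume fg: "f \<in> smooth_funs M" "g \<in> smooth_funs M"
    have "(\<lambda>q. Z q (\<lambda>x. a * f x + b * g x)) = (\<lambda>q. a * Z q f + b * Z q g)" if "Z \<in> vfields M" for Z
      using tangent_lin[OF vfieldsD[OF that] fg] by simp
    then show "lie_bracket M X Y p (\<lambda>x. a * f x + b * g x) =
        a * lie_bracket M X Y p f + b * lie_bracket M X Y p g"
      using fg X Y
      by (simp add: lie_bracket_def smooth_intros tangent_lin[OF tX] tangent_lin[OF tY] sX sY algebra_simps)
  next
    fix f g assume fg: "f \<in> smooth_funs M" "g \<in> smooth_funs M"
    have "(\<lambda>q. Z q (\<lambda>x. f x * g x)) = (\<lambda>q. f q * Z q g + g q * Z q f)" if "Z \<in> vfields M" for Z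
      using tangent_mult[OF vfieldsD[OF that] fg] by simp
    then show "lie_bracket M X Y p (\<lambda>x. f x * g x) =
        f p * lie_bracket M X Y p g + g p * lie_bracket M X Y p f"
      using fg X Y
      by (simp add: lie_bracket_def smooth_intros tangent_add[OF tX] tangent_add[OF tY]
          tangent_mult[OF tX] tangent_mult[OF tY] sX sY algebra_simps)
  qed
next
  fix f assume "f \<in> smooth_funs M"
  then show "(\<lambda>p. lie_bracket M X Y p f) \<in> smooth_funs M"
    using vfields_smooth[OF X] vfields_smooth[OF Y] by (simp add: lie_bracket_def smooth_intros)
qed

lemma lie_bracket_self: "lie_bracket M X X = (\<lambda>p f. 0)"
  by (simp add: lie_bracket_def fun_eq_iff)

text \<open>The factors 1 give the right-hand side the shape of a combination of two combinations,
  to which \<open>tens_lin\<close> applies directly.\<close>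

lemma lie_bracket_comb:
  assumes X: "X \<in> vfields M" and Y: "Y \<in> vfields M" and Z: "Z \<in> vfields M"
    and a: "a \<in> smooth_funs M" and b: "b \<in> smooth_funs M"
  shows "lie_bracket M X (\<lambda>p f. a p * Y p f + b p * Z p f) =
    (\<lambda>p f. 1 * (a p * lie_bracket M X Y p f + b p * lie_bracket M X Z p f) +
      1 * (X p a * Y p f + X p b * Z p f))"
proof (intro ext)
  fix p f
  note tX = vfieldsD[OF X, of p]
  show "lie_bracket M X (\<lambda>p f. a p * Y p f + b p * Z p f) p f =
      1 * (a p * lie_bracket M X Y p f + b p * lie_bracket M X Z p f) +
      1 * (X p a * Y p f + X p b * Z p f)"
  proof (cases "f \<in> smooth_funs M")
    case True
    then show ?thesis
      using vfields_smooth[OF Y True] vfields_smooth[OF Z True] a b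
      by (simp add: lie_bracket_def tangent_add[OF tX] tangent_mult[OF tX] smooth_intros algebra_simps)
  next
    case False
    then show ?thesis
      using tangent_nonsmooth[OF vfieldsD[OF Y] False] tangent_nonsmooth[OF vfieldsD[OF Z] False]
      by (simp add: lie_bracket_def)
  qed
qed

lemma lie_bracket_add_left:
  assumes X: "X \<in> vfields M" and Y: "Y \<in> vfields M" and Z: "Z \<in> vfields M"
  shows "lie_bracket M (\<lambda>p f. X p f + Y p f) Z =
    (\<lambda>p f. lie_bracket M X Z p f + lie_bracket M Y Z p f)"
  using vfields_smooth[OF X] vfields_smooth[OF Y]
  by (auto simp: lie_bracket_def fun_eq_iff tangent_add[OF vfieldsD[OF Z]])

section \<open>The Lie derivative formula\<close>

text \<open>The formula from \<open>lie_derivative\<close> for an arbitrary F, so that its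
  tensoriality can be proved before any form representing it is available. \<open>koszul\<close>
  plays the same part for \<open>ext_d\<close>.\<close>

definition lie_op ::
  "'a vfield \<Rightarrow> nat \<Rightarrow> ('a vfield list \<Rightarrow> 'a \<Rightarrow> real) \<Rightarrow> 'a vfield list \<Rightarrow> 'a \<Rightarrow> real" where
  "lie_op X k F Ys p = X p (F Ys) - (\<Sum>i<k. F (Ys[i := lie_bracket M X (Ys ! i)]) p)"

lemma set_update_vfields:
  assumes "X \<in> vfields M" "set us \<subseteq> vfields M" "i < length us"
  shows "set (us[i := lie_bracket M X (us ! i)]) \<subseteq> vfields M"
proof -
  have "us ! i \<in> vfields M" using nth_mem[OF assms(3)] assms(2) by blast
  then have "insert (lie_bracket M X (us ! i)) (set us) \<subseteq> vfields M"
    using lie_bracket_vfields[OF assms(1)] assms(2) by simp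
  then show ?thesis by (rule order_trans[OF set_update_subset_insert])
qed

text \<open>Separates the term in which B acts on the distinguished entry Z from the terms in which
  it acts on the other entries.\<close>

lemma sum_update_split:
  "(\<Sum>i<length us + Suc (length ws). F ((us @ Z # ws)[i := B ((us @ Z # ws) ! i)])) =
    (\<Sum>i<length us. F (us[i := B (us ! i)] @ Z # ws)) + F (us @ B Z # ws) +
    (\<Sum>i<length ws. F (us @ Z # ws[i := B (ws ! i)]) :: real)"
  unfolding sum_lessThan_split by (simp add: list_update_append nth_append)

text \<open>Differentiating a coefficient produces X a times F; the bracket of X with a Y
  contributes the same term with the opposite sign.\<close>

lemma tens_lie_op:
  assumes F: "tens k F" and X: "X \<in> vfields M"
  shows "tens k (lie_op X k F)"
  unfolding tens_def
proof (intro conjI allI ballI impI)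
  fix Xs assume *: "length Xs = k" "set Xs \<subseteq> vfields M"
  show "lie_op X k F Xs \<in> smooth_funs M"
    unfolding lie_op_def
    by (intro smooth_intros vfields_smooth[OF X] tens_smooth[OF F] set_update_vfields[OF X]) (use * in auto)
next
  fix us ws Y Z a b
  assume Y: "Y \<in> vfields M" and Z: "Z \<in> vfields M" and a: "a \<in> smooth_funs M" and b: "b \<in> smooth_funs M"
    and l: "length us + length ws + 1 = k" and us: "set us \<subseteq> vfields M" and ws: "set ws \<subseteq> vfields M"
  let ?Q = "\<lambda>p f. a p * Y p f + b p * Z p f"
  have k: "k = length us + Suc (length ws)" using l by simp
  note lin = tens_lin[OF F Y Z a b]
  have XY: "lie_bracket M X Y \<in> vfields M" and XZ: "lie_bracket M X Z \<in> vfields M"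
    using X Y Z lie_bracket_vfields by auto
  have sX: "(\<lambda>p. X p a) \<in> smooth_funs M" "(\<lambda>p. X p b) \<in> smooth_funs M"
    using vfields_smooth[OF X] a b by auto
  have br: "F (us @ lie_bracket M X ?Q # ws) = (\<lambda>p.
      (a p * F (us @ lie_bracket M X Y # ws) p + b p * F (us @ lie_bracket M X Z # ws) p) +
      (X p a * F (us @ Y # ws) p + X p b * F (us @ Z # ws) p))"
    unfolding lie_bracket_comb[OF X Y Z a b]
    using tens_lin[OF F vfields_comb[OF XY XZ a b] vfields_comb[OF Y Z sX] smooth_const[of 1] smooth_const[of 1] us ws l]
      tens_lin[OF F XY XZ a b us ws l] tens_lin[OF F Y Z sX us ws l]
    by simp
  have u: "F (us[i := lie_bracket M X (us ! i)] @ ?Q # ws) = (\<lambda>p.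
      a p * F (us[i := lie_bracket M X (us ! i)] @ Y # ws) p +
      b p * F (us[i := lie_bracket M X (us ! i)] @ Z # ws) p)" if "i < length us" for i
    by (rule lin) (use that set_update_vfields[OF X us that] ws l in auto)
  have w: "F (us @ ?Q # ws[i := lie_bracket M X (ws ! i)]) = (\<lambda>p.
      a p * F (us @ Y # ws[i := lie_bracket M X (ws ! i)]) p +
      b p * F (us @ Z # ws[i := lie_bracket M X (ws ! i)]) p)" if "i < length ws" for i
    by (rule lin) (use that set_update_vfields[OF X ws that] us l in auto)
  have sF: "F (us @ Y # ws) \<in> smooth_funs M" "F (us @ Z # ws) \<in> smooth_funs M"
    using us ws l Y Z by (auto intro!: tens_smooth[OF F])
  show "lie_op X k F (us @ ?Q # ws) = (\<lambda>p. a p * lie_op X k F (us @ Y # ws) p + b p * lie_op X k F (us @ Z # ws) p)"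
  proof
    fix p
    note tX = vfieldsD[OF X, of p]
    have 1: "X p (F (us @ ?Q # ws)) = a p * X p (F (us @ Y # ws)) + F (us @ Y # ws) p * X p a +
       (b p * X p (F (us @ Z # ws)) + F (us @ Z # ws) p * X p b)"
      unfolding lin[OF us ws l]
      using sF a b by (simp add: tangent_add[OF tX] tangent_mult[OF tX] smooth_intros)
    show "lie_op X k F (us @ ?Q # ws) p = a p * lie_op X k F (us @ Y # ws) p + b p * lie_op X k F (us @ Z # ws) p"
      unfolding lie_op_def 1 k sum_update_split[where F = "\<lambda>xs. F xs p"] br
      by (simp add: u w sum.distrib sum_distrib_left algebra_simps)
  qed
next
  fix us ws Y
  assume Y: "Y \<in> vfields M" and l: "length us + length ws + 2 = k"
    and us: "set us \<subseteq> vfields M" and ws: "set ws \<subseteq> vfields M"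
  have k: "k = length us + Suc (length (Y # ws))" using l by simp
  have XY: "lie_bracket M X Y \<in> vfields M" using X Y lie_bracket_vfields by auto
  have u: "F (us[i := lie_bracket M X (us ! i)] @ Y # Y # ws) = (\<lambda>p. 0)" if "i < length us" for i
    by (rule tens_adj[OF F Y]) (use that set_update_vfields[OF X us that] ws l in auto)
  have w: "F (us @ Y # Y # ws[i := lie_bracket M X (ws ! i)]) = (\<lambda>p. 0)" if "i < length ws" for i
    by (rule tens_adj[OF F Y]) (use that set_update_vfields[OF X ws that] us l in auto)
  show "lie_op X k F (us @ Y # Y # ws) = (\<lambda>p. 0)"
  proof
    fix p
    \<comment> \<open>These are the two terms in which the bracket hits one of the equal entries;
      all others still contain Y twice in a row.\<close>
    have "F (us @ lie_bracket M X Y # Y # ws) p = - F (us @ Y # lie_bracket M X Y # ws) p"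
      by (rule altern_swap[OF tens_altern[OF F] XY Y us ws l])
    then show "lie_op X k F (us @ Y # Y # ws) p = 0"
      unfolding lie_op_def k sum_update_split[where F = "\<lambda>xs. F xs p"]
      by (simp add: u w tens_adj[OF F Y us ws l] tangent_const[OF vfieldsD[OF X]] sum.lessThan_Suc_shift del: sum.lessThan_Suc)
  qed
qed

section \<open>The Koszul formula for the exterior derivative\<close>

definition koszul ::
  "nat \<Rightarrow> ('a vfield list \<Rightarrow> 'a \<Rightarrow> real) \<Rightarrow> 'a vfield list \<Rightarrow> 'a \<Rightarrow> real" where
  "koszul k F Xs p = (\<Sum>i\<le>k. (-1) ^ i * (Xs ! i) p (F (nths Xs (- {i})))) +
     (\<Sum>j\<le>k. \<Sum>i<j. (-1) ^ (i + j) *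
        F (lie_bracket M (Xs ! i) (Xs ! j) # nths Xs (- {i, j})) p)"

lemma tens_interior:
  assumes "tens (Suc k) F" "X \<in> vfields M"
  shows "tens k (\<lambda>Ys. F (X # Ys))"
  unfolding tens_def
proof (intro conjI allI ballI impI)
  show "F (X # Xs) \<in> smooth_funs M" if "length Xs = k" "set Xs \<subseteq> vfields M" for Xs
    using assms that by (auto intro!: tens_smooth[OF assms(1)])
next
  fix us ws Y Z a b
  assume *: "Y \<in> vfields M" "Z \<in> vfields M" "a \<in> smooth_funs M" "b \<in> smooth_funs M"
    "length us + length ws + 1 = k" "set us \<subseteq> vfields M" "set ws \<subseteq> vfields M"
  then show "F (X # us @ (\<lambda>p f. a p * Y p f + b p * Z p f) # ws) =
      (\<lambda>p. a p * F (X # us @ Y # ws) p + b p * F (X # us @ Z # ws) p)"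
    using tens_lin[OF assms(1) *(1-4), of "X # us" ws] assms(2) by simp
next
  fix us ws Y
  assume *: "Y \<in> vfields M" "length us + length ws + 2 = k" "set us \<subseteq> vfields M" "set ws \<subseteq> vfields M"
  then show "F (X # us @ Y # Y # ws) = (\<lambda>p. 0)"
    using tens_adj[OF assms(1) *(1), of "X # us" ws] assms(2) by simp
qed

text \<open>Cartan's formula at the level of lists. The terms in which X differentiates or is
  bracketed form \<open>lie_op\<close>; in the remaining ones X stays an argument of F, and the
  index shift by one supplies the minus sign.\<close>

lemma koszul_Cons:
  assumes F: "tens (Suc k) F" and X: "X \<in> vfields M" and ws: "set ws \<subseteq> vfields M" "length ws = Suc k"
  shows "koszul (Suc k) F (X # ws) p = lie_op X (Suc k) F ws p - koszul k (\<lambda>Ys. F (X # Ys)) ws p"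
proof -
  let ?B = "lie_bracket M"
  have sub: "set (nths ws A) \<subseteq> vfields M" for A by (rule order_trans[OF set_nths_subset ws(1)])
  have vf: "ws ! i \<in> vfields M" if "i \<le> k" for i using ws that by (auto simp: subset_eq)
  \<comment> \<open>\<open>lie_op\<close> brackets in place whereas Koszul puts the bracket in
    front; moving it costs j transpositions.\<close>
  have mv: "F (ws[j := ?B X (ws ! j)]) p = (-1) ^ j * F (?B X (ws ! j) # nths ws (- {j})) p" if "j \<le> k" for j
  proof -
    have "F (take j ws @ ?B X (ws ! j) # drop (Suc j) ws) p =
        (-1) ^ length (take j ws) * F (?B X (ws ! j) # take j ws @ drop (Suc j) ws) p"
      by (rule altern_move[OF tens_altern[OF F]])
        (use that ws X vf lie_bracket_vfields set_take_subset set_drop_subset in \<open>auto dest: in_set_takeD in_set_dropD\<close>)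
    then show ?thesis using that ws by (simp add: upd_conv_take_nth_drop nths_remove)
  qed
  \<comment> \<open>In the Koszul sum the bracket precedes X, but for the interior product X has to
    come first.\<close>
  have sw: "F (?B (ws ! i) (ws ! j) # X # nths ws (- {i, j})) p =
      - F (X # ?B (ws ! i) (ws ! j) # nths ws (- {i, j})) p" if "i < j" "j \<le> k" for i j
  proof -
    have "length (nths ws (- {i, j})) = Suc k - 2" using that ws by (subst length_nths_remove(2)) auto
    then have "length [] + length (nths ws (- {i, j})) + 2 = Suc k" using that by simp
    with altern_swap[OF tens_altern[OF F] _ X, of "?B (ws ! i) (ws ! j)" "[]" "nths ws (- {i, j})"] sub that vf
      lie_bracket_vfields show ?thesis by simp
  qed
  have "(\<Sum>i\<le>Suc k. (-1) ^ i * ((X # ws) ! i) p (F (nths (X # ws) (- {i})))) =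
     X p (F ws) - (\<Sum>i\<le>k. (-1) ^ i * (ws ! i) p (F (X # nths ws (- {i}))))"
    unfolding sum.atMost_Suc_shift by (simp add: nths_Cons_remove sum_negf)
  moreover have "(\<Sum>j\<le>Suc k. \<Sum>i<j. (-1) ^ (i + j) *
      F (?B ((X # ws) ! i) ((X # ws) ! j) # nths (X # ws) (- {i, j})) p) =
    (\<Sum>j\<le>k. (-1) ^ Suc j * F (?B X (ws ! j) # nths ws (- {j})) p +
      (\<Sum>i<j. (-1) ^ (i + j) * F (?B (ws ! i) (ws ! j) # X # nths ws (- {i, j})) p))"
    unfolding sum.atMost_Suc_shift
    by (simp add: sum.lessThan_Suc_shift nths_Cons_remove del: sum.lessThan_Suc)
  moreover have "\<dots> = (\<Sum>j\<le>k. - F (ws[j := ?B X (ws ! j)]) p -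
      (\<Sum>i<j. (-1) ^ (i + j) * F (X # ?B (ws ! i) (ws ! j) # nths ws (- {i, j})) p))"
    by (intro sum.cong refl) (simp add: mv sw sum_negf)
  ultimately show ?thesis
    by (simp add: koszul_def lie_op_def sum_subtractf sum_negf lessThan_Suc_atMost)
qed

text \<open>Additivity in F, with H a separate function because the decomposition is known only on
  lists of k vector fields.\<close>

lemma koszul_add:
  assumes "\<And>Ys. length Ys = k \<Longrightarrow> set Ys \<subseteq> vfields M \<Longrightarrow> F Ys \<in> smooth_funs M \<and> G Ys \<in> smooth_funs M \<and>
      H Ys = (\<lambda>p. F Ys p + G Ys p)"
    and Xs: "length Xs = Suc k" "set Xs \<subseteq> vfields M"
  shows "koszul k H Xs p = koszul k F Xs p + koszul k G Xs p"
proof -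
  have sub: "set (nths Xs A) \<subseteq> vfields M" for A by (rule order_trans[OF set_nths_subset Xs(2)])
  have vf: "Xs ! i \<in> vfields M" if "i \<le> k" for i using Xs that by (auto simp: subset_eq)
  have 1: "(Xs ! i) p (H (nths Xs (- {i}))) =
      (Xs ! i) p (F (nths Xs (- {i}))) + (Xs ! i) p (G (nths Xs (- {i})))" if "i \<le> k" for i
    using assms(1)[OF _ sub, of "- {i}"] Xs that
    by (simp add: length_nths_remove tangent_add[OF vfieldsD[OF vf[OF that]]])
  have 2: "H (lie_bracket M (Xs ! i) (Xs ! j) # nths Xs (- {i, j})) p =
      F (lie_bracket M (Xs ! i) (Xs ! j) # nths Xs (- {i, j})) p +
      G (lie_bracket M (Xs ! i) (Xs ! j) # nths Xs (- {i, j})) p" if "i < j" "j \<le> k" for i j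
  proof -
    have "length (nths Xs (- {i, j})) = Suc k - 2" using that Xs by (subst length_nths_remove(2)) auto
    with assms(1)[of "lie_bracket M (Xs ! i) (Xs ! j) # nths Xs (- {i, j})"] sub vf lie_bracket_vfields that
    show ?thesis by simp
  qed
  show ?thesis
    unfolding koszul_def by (simp add: 1 2 distrib_left sum.distrib)
qed

text \<open>By \<open>koszul_Cons\<close>, linearity and alternation in the slots behind the first
  are inherited from \<open>lie_op\<close> and the induction hypothesis. The first slot is reached
  through antisymmetry in the first two, which follows by polarization from additivity
  (\<open>add0\<close>) and equal leading entries (\<open>adj0\<close>).\<close>

lemma tens_koszul:
  assumes "tens k F"
  shows "tens (Suc k) (koszul k F)"
  using assms
proof (induction k arbitrary: F)
  case 0
  have K: "koszul 0 F [X] = (\<lambda>p. X p (F []))" for X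
    by (simp add: koszul_def fun_eq_iff nths_Cons_remove)
  have "koszul 0 F Xs \<in> smooth_funs M" if "length Xs = Suc 0" "set Xs \<subseteq> vfields M" for Xs
  proof -
    obtain X where "Xs = [X]" "X \<in> vfields M" using \<open>length Xs = Suc 0\<close> \<open>set Xs \<subseteq> vfields M\<close> by (cases Xs) auto
    then show ?thesis using K vfields_smooth tens_smooth[OF 0, of "[]"] by simp
  qed
  then show ?case unfolding tens_def by (auto simp: K)
next
  case (Suc k)
  note F = Suc.prems
  let ?G = "koszul (Suc k) F"
  let ?i = "\<lambda>X Ys. F (X # Ys)"
  have G: "?G (X # ws) = (\<lambda>p. lie_op X (Suc k) F ws p - koszul k (?i X) ws p)"
    if "X \<in> vfields M" "set ws \<subseteq> vfields M" "length ws = Suc k" for X ws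
    using koszul_Cons[OF F that] by blast
  have L: "tens (Suc k) (lie_op X (Suc k) F)" if "X \<in> vfields M" for X by (rule tens_lie_op[OF F that])
  have I: "tens (Suc k) (koszul k (?i X))" if "X \<in> vfields M" for X
    by (rule Suc.IH[OF tens_interior[OF F that]])
  have smooth: "?G Xs \<in> smooth_funs M" if "length Xs = Suc (Suc k)" "set Xs \<subseteq> vfields M" for Xs
  proof (cases Xs)
    case (Cons X ws)
    with that show ?thesis
      using tens_smooth[OF L] tens_smooth[OF I] by (auto simp: G intro!: smooth_diff)
  qed (use that in simp)
  have lin: "?G (X # us @ (\<lambda>p f. a p * Y p f + b p * Z p f) # ws) =
      (\<lambda>p. a p * ?G (X # us @ Y # ws) p + b p * ?G (X # us @ Z # ws) p)"
    if "X \<in> vfields M" "Y \<in> vfields M" "Z \<in> vfields M" "a \<in> smooth_funs M" "b \<in> smooth_funs M"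
      "set us \<subseteq> vfields M" "set ws \<subseteq> vfields M" "length us + length ws + 1 = Suc k" for X us Y Z ws a b
    using that tens_lin[OF L[OF that(1)] that(2-)] tens_lin[OF I[OF that(1)] that(2-)]
    by (simp add: G vfields_comb algebra_simps)
  have adj: "?G (X # us @ Y # Y # ws) = (\<lambda>p. 0)"
    if "X \<in> vfields M" "Y \<in> vfields M"
      "set us \<subseteq> vfields M" "set ws \<subseteq> vfields M" "length us + length ws + 2 = Suc k" for X us Y ws
    using that tens_adj[OF L[OF that(1)] that(2-)] tens_adj[OF I[OF that(1)] that(2-)]
    by (simp add: G)
  \<comment> \<open>The bracket of X with itself vanishes, so the Lie part is the Lie derivative of
    i_X F on ws. Cartan's formula applied to i_X F gives the same for the other part, because i_X
    i_X F = 0.\<close>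
  have adj0: "?G (X # X # ws) = (\<lambda>p. 0)"
    if X: "X \<in> vfields M" and ws: "set ws \<subseteq> vfields M" "length ws = k" for X ws
  proof
    fix p
    have b0: "F ((\<lambda>p f. 0) # ws) = (\<lambda>p. 0)"
      using tens_scale[OF F X smooth_const[of 0], of "[]" ws] ws by simp
    have l: "lie_op X (Suc k) F (X # ws) p = lie_op X k (?i X) ws p"
      by (simp add: lie_op_def sum.lessThan_Suc_shift lie_bracket_self b0 del: sum.lessThan_Suc)
    show "?G (X # X # ws) p = 0"
    proof (cases k)
      case 0
      with ws l show ?thesis
        by (simp add: G X) (simp add: koszul_def lie_op_def nths_Cons_remove)
    next
      case (Suc k')
      have z: "F (X # X # Ys) = (\<lambda>p. 0)" if "length Ys = k'" "set Ys \<subseteq> vfields M" for Ys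
        using tens_adj[OF F X, of "[]" Ys] that Suc by simp
      \<comment> \<open>0 = 0 + 0 in \<open>koszul_add\<close> makes the value equal to its
        double.\<close>
      have "koszul k' (\<lambda>Ys. F (X # X # Ys)) ws p = 0"
        using koszul_add[of k' "\<lambda>Ys. F (X # X # Ys)" "\<lambda>Ys. F (X # X # Ys)" "\<lambda>Ys. F (X # X # Ys)" ws p]
          z smooth_const ws Suc by simp
      then have "koszul k (?i X) (X # ws) p = lie_op X k (?i X) ws p"
        using koszul_Cons[of k' "?i X" X ws p] tens_interior[OF F X] X ws Suc by simp
      with l ws X show ?thesis by (simp add: G)
    qed
  qed
  have add0: "?G ((\<lambda>p f. X p f + Y p f) # ws) = (\<lambda>p. ?G (X # ws) p + ?G (Y # ws) p)"
    if X: "X \<in> vfields M" and Y: "Y \<in> vfields M" and ws: "set ws \<subseteq> vfields M" "length ws = Suc k" for X Y ws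
  proof
    fix p
    let ?Z = "\<lambda>p f. X p f + Y p f"
    have Z: "?Z \<in> vfields M" using vfields_comb[OF X Y smooth_const[of 1] smooth_const[of 1]] by simp
    have a: "F (ws[i := lie_bracket M ?Z (ws ! i)]) = (\<lambda>p.
       F (ws[i := lie_bracket M X (ws ! i)]) p + F (ws[i := lie_bracket M Y (ws ! i)]) p)" if i: "i < Suc k" for i
    proof -
      have w: "ws ! i \<in> vfields M" using ws i by (auto simp: subset_eq)
      show ?thesis
        unfolding lie_bracket_add_left[OF X Y w]
        using tens_add[OF F lie_bracket_vfields[OF X w] lie_bracket_vfields[OF Y w], of "take i ws" "drop (Suc i) ws"] ws i
        by (auto simp: upd_conv_take_nth_drop dest: in_set_takeD in_set_dropD)
    qed
    have "lie_op ?Z (Suc k) F ws p = lie_op X (Suc k) F ws p + lie_op Y (Suc k) F ws p"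
      unfolding lie_op_def by (simp add: a sum.distrib del: sum.lessThan_Suc)
    moreover have "koszul k (?i ?Z) ws p = koszul k (?i X) ws p + koszul k (?i Y) ws p"
    proof (rule koszul_add[OF _ ws(2,1)], intro conjI)
      fix Ys assume *: "length Ys = k" "set Ys \<subseteq> vfields M"
      show "F (X # Ys) \<in> smooth_funs M" "F (Y # Ys) \<in> smooth_funs M"
        using * X Y by (auto intro!: tens_smooth[OF F])
      show "F (?Z # Ys) = (\<lambda>p. F (X # Ys) p + F (Y # Ys) p)"
        using tens_add[OF F X Y, of "[]" Ys] * by simp
    qed
    ultimately show "?G (?Z # ws) p = ?G (X # ws) p + ?G (Y # ws) p"
      using X Y Z ws by (simp add: G)
  qed
  have anti: "?G (X # Y # ws) p = - ?G (Y # X # ws) p"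
    if X: "X \<in> vfields M" and Y: "Y \<in> vfields M" and ws: "set ws \<subseteq> vfields M" "length ws = k" for X Y ws p
  proof -
    let ?Z = "\<lambda>p f. X p f + Y p f"
    have Z: "?Z \<in> vfields M" using vfields_comb[OF X Y smooth_const[of 1] smooth_const[of 1]] by simp
    have l: "?G (V # ?Z # ws) p = ?G (V # X # ws) p + ?G (V # Y # ws) p" if "V \<in> vfields M" for V
      using lin[OF that X Y smooth_const[of 1] smooth_const[of 1], of "[]" ws] ws by simp
    have "0 = ?G (?Z # ?Z # ws) p" using adj0[OF Z ws] by simp
    also have "\<dots> = ?G (X # ?Z # ws) p + ?G (Y # ?Z # ws) p" using add0[OF X Y, of "?Z # ws"] Z ws by simp
    also have "\<dots> = ?G (X # Y # ws) p + ?G (Y # X # ws) p" using l X Y adj0[OF X ws] adj0[OF Y ws] by simp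
    finally show ?thesis by simp
  qed
  \<comment> \<open>\<open>anti\<close> moves the combination into the second slot, where
    \<open>lin\<close> already applies, and back.\<close>
  have lin0: "?G ((\<lambda>p f. a p * Y p f + b p * Z p f) # ws) = (\<lambda>p. a p * ?G (Y # ws) p + b p * ?G (Z # ws) p)"
    if Y: "Y \<in> vfields M" and Z: "Z \<in> vfields M" and a: "a \<in> smooth_funs M" and b: "b \<in> smooth_funs M"
      and ws: "set ws \<subseteq> vfields M" "length ws = Suc k" for Y Z ws a b
  proof
    fix p
    obtain V ws' where V: "ws = V # ws'" using ws by (cases ws) auto
    then have V': "V \<in> vfields M" "set ws' \<subseteq> vfields M" "length ws' = k" using ws by auto
    show "?G ((\<lambda>p f. a p * Y p f + b p * Z p f) # ws) p = a p * ?G (Y # ws) p + b p * ?G (Z # ws) p"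
      using anti[OF vfields_comb[OF Y Z a b] V', of p] anti[OF Y V', of p] anti[OF Z V', of p]
        lin[OF V'(1) Y Z a b, of "[]" ws'] V'
      by (simp add: V)
  qed
  show ?case
    unfolding tens_def
  proof (intro conjI allI ballI impI)
    fix us ws Y Z a b
    assume *: "Y \<in> vfields M" "Z \<in> vfields M" "a \<in> smooth_funs M" "b \<in> smooth_funs M"
      "length us + length ws + 1 = Suc (Suc k)" "set us \<subseteq> vfields M" "set ws \<subseteq> vfields M"
    then show "?G (us @ (\<lambda>p f. a p * Y p f + b p * Z p f) # ws) =
        (\<lambda>p. a p * ?G (us @ Y # ws) p + b p * ?G (us @ Z # ws) p)"
      by (cases us) (auto simp: lin lin0)
  next
    fix us ws Y
    assume *: "Y \<in> vfields M" "length us + length ws + 2 = Suc (Suc k)" "set us \<subseteq> vfields M" "set ws \<subseteq> vfields M"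
    then show "?G (us @ Y # Y # ws) = (\<lambda>p. 0)"
      by (cases us) (auto simp: adj adj0)
  qed (rule smooth)
qed

section \<open>The descriptions of d and of the Lie derivative denote\<close>

text \<open>Existence is \<open>form_of_tens\<close> applied to the Koszul formula, uniqueness is
  \<open>forms_eqI\<close>.\<close>

lemma ext_d_props:
  assumes "\<omega> \<in> forms M k"
  shows "ext_d M k \<omega> \<in> forms M (Suc k)"
    and "length Xs = Suc k \<Longrightarrow> set Xs \<subseteq> vfields M \<Longrightarrow>
      form_eval (ext_d M k \<omega>) Xs p = koszul k (form_eval \<omega>) Xs p"
proof -
  let ?P = "\<lambda>\<eta>. \<eta> \<in> forms M (Suc k) \<and> (\<forall>Xs p. length Xs = Suc k \<longrightarrow> set Xs \<subseteq> vfields M \<longrightarrow>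
        form_eval \<eta> Xs p = koszul k (form_eval \<omega>) Xs p)"
  obtain \<eta> where \<eta>: "?P \<eta>" using form_of_tens[OF tens_koszul[OF tens_form[OF assms]]] by metis
  have e: "ext_d M k \<omega> = (THE \<eta>. ?P \<eta>)" by (simp add: ext_d_def koszul_def)
  have t: "?P (THE \<eta>. ?P \<eta>)"
    by (rule theI[of ?P, OF \<eta>]) (use \<eta> in \<open>auto intro: forms_eqI\<close>)
  have P: "?P (ext_d M k \<omega>)" unfolding e by (rule t)
  then show "ext_d M k \<omega> \<in> forms M (Suc k)" by blast
  show "length Xs = Suc k \<Longrightarrow> set Xs \<subseteq> vfields M \<Longrightarrow>
      form_eval (ext_d M k \<omega>) Xs p = koszul k (form_eval \<omega>) Xs p" using P by blast
qed

lemma lie_derivative_props: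
  assumes "\<omega> \<in> forms M k" "X \<in> vfields M"
  shows "lie_derivative M k X \<omega> \<in> forms M k"
    and "length Ys = k \<Longrightarrow> set Ys \<subseteq> vfields M \<Longrightarrow>
      form_eval (lie_derivative M k X \<omega>) Ys p = lie_op X k (form_eval \<omega>) Ys p"
proof -
  let ?P = "\<lambda>\<eta>. \<eta> \<in> forms M k \<and> (\<forall>Ys p. length Ys = k \<longrightarrow> set Ys \<subseteq> vfields M \<longrightarrow>
        form_eval \<eta> Ys p = lie_op X k (form_eval \<omega>) Ys p)"
  obtain \<eta> where \<eta>: "?P \<eta>" using form_of_tens[OF tens_lie_op[OF tens_form[OF assms(1)] assms(2)]] by metis
  have e: "lie_derivative M k X \<omega> = (THE \<eta>. ?P \<eta>)" by (simp add: lie_derivative_def lie_op_def)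
  have t: "?P (THE \<eta>. ?P \<eta>)"
    by (rule theI[of ?P, OF \<eta>]) (use \<eta> in \<open>auto intro: forms_eqI\<close>)
  have P: "?P (lie_derivative M k X \<omega>)" unfolding e by (rule t)
  then show "lie_derivative M k X \<omega> \<in> forms M k" by blast
  show "length Ys = k \<Longrightarrow> set Ys \<subseteq> vfields M \<Longrightarrow>
      form_eval (lie_derivative M k X \<omega>) Ys p = lie_op X k (form_eval \<omega>) Ys p" using P by blast
qed

section \<open>Divergence in a local frame\<close>

lemma frameD:
  assumes "frame N E x"
  shows "open N" "E b \<in> vfields M" "x b \<in> smooth_funs M" "E b q \<in> tangent M q"
    "q \<in> N \<Longrightarrow> b \<in> Basis \<Longrightarrow> c \<in> Basis \<Longrightarrow> E b q (x c) = (if b = c then 1 else 0)"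
    "q \<in> N \<Longrightarrow> v \<in> tangent M q \<Longrightarrow> v f = (\<Sum>b\<in>Basis. v (x b) * E b q f)"
proof -
  show "E b \<in> vfields M" for b using assms by (simp add: frame_def)
  then show "E b q \<in> tangent M q" by (rule vfieldsD)
  show "open N" "x b \<in> smooth_funs M" using assms by (simp_all add: frame_def)
  show "q \<in> N \<Longrightarrow> b \<in> Basis \<Longrightarrow> c \<in> Basis \<Longrightarrow> E b q (x c) = (if b = c then 1 else 0)"
    using assms by (simp add: frame_def)
  show "v f = (\<Sum>b\<in>Basis. v (x b) * E b q f)" if "q \<in> N" "v \<in> tangent M q"
    using assms that unfolding frame_def by blast
qed

lemma form_eval_frame: "form_eval \<omega> (map E J) q = \<omega> q (map (\<lambda>b. E b q) J)"
  by (simp add: form_eval_def o_def)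

lemma frame_vfields: "frame N E x \<Longrightarrow> set (map E J) \<subseteq> vfields M"
  using frameD(2) by auto

text \<open>A top covector that vanishes on a basis is zero, which a volume form is nowhere.\<close>

lemma volume_form_frame:
  assumes "volume_form M W" "frame N E x" "p \<in> N" "distinct J" "set J = Basis"
  shows "form_eval W (map E J) p \<noteq> 0"
proof
  assume "form_eval W (map E J) p = 0"
  then have "W p (map (\<lambda>b. E b p) J) = 0" by (simp add: form_eval_frame)
  moreover have "W p \<in> covectors M p DIM('e)"
    using assms(1) formsD by (auto simp: volume_form_def mdim_def)
  ultimately have "W p = (\<lambda>vs. 0)"
    using top_covector_zeroI[OF _ assms(2-5)] by blast
  moreover obtain vs where "W p vs \<noteq> 0" using assms(1) by (auto simp: volume_form_def)
  ultimately show False by simp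
qed

text \<open>E b applied to x c is constant near p, so only the derivative along E b of the component
  X (x c) survives.\<close>

lemma lie_bracket_frame:
  assumes X: "X \<in> vfields M" and fr: "frame N E x" and p: "p \<in> N" and b: "b \<in> Basis"
  shows "lie_bracket M X (E b) p = (\<lambda>f. \<Sum>c\<in>Basis. - E b p (\<lambda>r. X r (x c)) * E c p f)"
proof
  fix f
  have "lie_bracket M X (E b) p (x c) = - E b p (\<lambda>r. X r (x c))" if c: "c \<in> Basis" for c
  proof -
    \<comment> \<open>Constancy holds on N only, hence the appeal to locality of X at p.\<close>
    have "X p (\<lambda>q. E b q (x c)) = X p (\<lambda>q. if b = c then 1 else 0)"
      by (rule tangent_local[OF vfieldsD[OF X] frameD(1)[OF fr] p])
        (use frameD[OF fr] b c vfields_smooth smooth_const in auto)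
    also have "\<dots> = 0" by (rule tangent_const[OF vfieldsD[OF X]])
    finally show ?thesis using frameD(3)[OF fr] by (simp add: lie_bracket_def)
  qed
  note coeff = this
  have "lie_bracket M X (E b) p f = (\<Sum>c\<in>Basis. lie_bracket M X (E b) p (x c) * E c p f)"
    by (rule frameD(6)[OF fr p vfieldsD[OF lie_bracket_vfields[OF X frameD(2)[OF fr]]]])
  also have "\<dots> = (\<Sum>c\<in>Basis. - E b p (\<lambda>r. X r (x c)) * E c p f)"
    by (intro sum.cong refl arg_cong2[where f = "(*)"] coeff)
  finally show "lie_bracket M X (E b) p f = (\<Sum>c\<in>Basis. - E b p (\<lambda>r. X r (x c)) * E c p f)" .
qed

text \<open>Bracketing in slot i replaces a frame vector by a combination of all of them.
  Alternation leaves only its own component, and the surviving coefficients add up to the coordinate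
  divergence of X.\<close>

lemma lie_op_frame:
  assumes W: "W \<in> forms M DIM('e)" and X: "X \<in> vfields M" and fr: "frame N E x" and p: "p \<in> N"
    and J: "distinct J" "set J = Basis"
  shows "lie_op X DIM('e) (form_eval W) (map E J) p =
    X p (form_eval W (map E J)) +
    (\<Sum>b\<in>Basis. E b p (\<lambda>r. X r (x b))) * form_eval W (map E J) p"
proof -
  have lJ: "length J = DIM('e)" using J distinct_card by fastforce
  let ?E = "\<lambda>J. map (\<lambda>b. E b p) J"
  have upd: "form_eval W ((map E J)[i := lie_bracket M X (map E J ! i)]) p =
      - E (J ! i) p (\<lambda>r. X r (x (J ! i))) * form_eval W (map E J) p" if i: "i < DIM('e)" for i
  proof -
    have Ji: "J ! i \<in> Basis" using nth_mem[of i J] J lJ i by simp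
    have z: "W p (?E (take i J) @ E c p # ?E (drop (Suc i) J)) = 0" if c: "c \<in> Basis" "c \<noteq> J ! i" for c
    proof -
      obtain j where j: "j < length J" "J ! j = c" using c J by (metis in_set_conv_nth)
      with c have "j \<noteq> i" by blast
      have "\<not> distinct (J[i := c])"
        using nth_eq_iff_index_eq[of "J[i := c]" i j] i j lJ \<open>j \<noteq> i\<close> by auto
      then have "\<not> distinct (?E (J[i := c]))" by (simp add: distinct_map)
      then have "W p (?E (J[i := c])) = 0"
        using frameD(4)[OF fr] lJ by (intro altern_repeat[OF covectors_altern[OF formsD[OF W]]]) auto
      then show ?thesis using i lJ by (simp add: upd_conv_take_nth_drop)
    qed
    have "form_eval W ((map E J)[i := lie_bracket M X (map E J ! i)]) p =
        W p (?E (take i J) @ lie_bracket M X (E (J ! i)) p # ?E (drop (Suc i) J))"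
      using i lJ by (simp add: form_eval_def upd_conv_take_nth_drop take_map drop_map o_def)
    also have "\<dots> = (\<Sum>c\<in>Basis. - E (J ! i) p (\<lambda>r. X r (x c)) * W p (?E (take i J) @ E c p # ?E (drop (Suc i) J)))"
      unfolding lie_bracket_frame[OF X fr p Ji]
      by (rule covectors_sum[OF formsD[OF W] finite_Basis]) (use frameD(4)[OF fr] i lJ in auto)
    also have "\<dots> = (\<Sum>c\<in>{J ! i}. - E (J ! i) p (\<lambda>r. X r (x c)) * W p (?E (take i J) @ E c p # ?E (drop (Suc i) J)))"
      by (rule sum.mono_neutral_right) (use Ji z in auto)
    finally have "form_eval W ((map E J)[i := lie_bracket M X (map E J ! i)]) p =
        - E (J ! i) p (\<lambda>r. X r (x (J ! i))) * W p (?E (take i J) @ E (J ! i) p # ?E (drop (Suc i) J))"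
      by simp
    moreover have "?E (take i J) @ E (J ! i) p # ?E (drop (Suc i) J) = ?E J"
      using i lJ by (metis id_take_nth_drop list.simps(9) map_append)
    ultimately show ?thesis by (simp add: form_eval_frame)
  qed
  have "(\<Sum>i<DIM('e). E (J ! i) p (\<lambda>r. X r (x (J ! i)))) = (\<Sum>b\<in>Basis. E b p (\<lambda>r. X r (x b)))"
    by (rule sum.reindex_bij_betw[OF bij_betw_nth]) (use J lJ in auto)
  then show ?thesis
    unfolding lie_op_def by (simp add: upd sum_negf sum_distrib_right[symmetric])
qed

text \<open>Top covectors at a point form a line, so the Lie derivative is a multiple of W at each
  point. On each frame domain the factor is a quotient of smooth functions.\<close>

lemma divergence_props:
  assumes W: "volume_form M W" and X: "X \<in> vfields M"
  shows "divergence M W X \<in> smooth_funs M"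
    and "lie_derivative M (mdim M) X W = (\<lambda>p vs. divergence M W X p * W p vs)"
proof -
  let ?L = "lie_derivative M (mdim M) X W"
  have Wf: "W \<in> forms M DIM('e)" using W by (simp add: volume_form_def mdim_def)
  have L: "?L \<in> forms M DIM('e)" using lie_derivative_props(1)[OF Wf X] by (simp add: mdim_def)
  obtain J :: "'e list" where J: "distinct J" "set J = Basis" using finite_distinct_list[OF finite_Basis] by blast
  have lJ: "length J = DIM('e)" using J distinct_card by fastforce
  have loc: "?L q = (\<lambda>vs. form_eval ?L (map E J) q * inverse (form_eval W (map E J) q) * W q vs)"
    if fr: "frame N E x" and q: "q \<in> N" for N E x q
  proof -
    let ?c = "form_eval ?L (map E J) q * inverse (form_eval W (map E J) q)"
    have "(\<lambda>vs. 1 * ?L q vs + (- ?c) * W q vs) = (\<lambda>vs. 0)"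
      by (rule top_covector_zeroI[OF covectors_comb[OF formsD[OF L] formsD[OF Wf]] fr q J])
        (use volume_form_frame[OF W fr q J] in \<open>simp add: form_eval_frame\<close>)
    then show ?thesis by (simp add: fun_eq_iff)
  qed
  \<comment> \<open>Chosen pointwise, without reference to a frame; nonvanishing of W makes the
    choice unique, and frames enter only to show smoothness.\<close>
  define g where "g = (\<lambda>p. SOME c. ?L p = (\<lambda>vs. c * W p vs))"
  have g: "?L p = (\<lambda>vs. g p * W p vs)" for p
  proof -
    obtain N E x where "frame N E x" "p \<in> N" by (rule frame_ex)
    from loc[OF this] show ?thesis unfolding g_def by (rule someI)
  qed
  have uniq: "h = g" if "?L = (\<lambda>p vs. h p * W p vs)" for h
  proof
    fix p
    obtain vs where "W p vs \<noteq> 0" using W by (auto simp: volume_form_def)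
    moreover have "h p * W p vs = g p * W p vs" using g[of p] that by metis
    ultimately show "h p = g p" by simp
  qed
  have "g \<in> smooth_funs M"
  proof (rule smooth_funs_local)
    fix p
    obtain N E x where fr: "frame N E x" "p \<in> N" by (rule frame_ex)
    note o = frameD(1)[OF fr(1)]
    have nz: "form_eval W (map E J) q \<noteq> 0" if "q \<in> N" for q
      using volume_form_frame[OF W fr(1) that J] .
    have s: "smooth_near N (\<lambda>q. form_eval ?L (map E J) q * inverse (form_eval W (map E J) q))"
      by (intro smooth_near_mult smooth_near_inverse o smooth_funs_near nz
          forms_smooth[OF L] forms_smooth[OF Wf]) (use lJ frameD(2)[OF fr(1)] in auto)
    have "g q = form_eval ?L (map E J) q * inverse (form_eval W (map E J) q)" if "q \<in> N" for q
    proof -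
      have "g q * form_eval W (map E J) q = form_eval ?L (map E J) q"
        using g[of q] by (simp add: form_eval_frame)
      with nz[OF that] show ?thesis by (simp add: field_simps)
    qed
    then have "smooth_near N g \<longleftrightarrow>
        smooth_near N (\<lambda>q. form_eval ?L (map E J) q * inverse (form_eval W (map E J) q))"
      by (rule smooth_near_cong[OF o])
    with s fr(2) o show "\<exists>N. open N \<and> p \<in> N \<and> smooth_near N g" by blast
  qed
  note g_smooth = this
  have Lg: "?L = (\<lambda>p vs. g p * W p vs)" by (rule ext, rule g)
  have eq: "divergence M W X = g"
    unfolding divergence_def
  proof (rule the_equality)
    show "g \<in> smooth_funs M \<and> ?L = (\<lambda>p vs. g p * W p vs)" using g_smooth Lg ..
    show "h = g" if "h \<in> smooth_funs M \<and> ?L = (\<lambda>p vs. h p * W p vs)" for h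
      using that by (intro uniq) (rule conjunct2)
  qed
  show "divergence M W X \<in> smooth_funs M" unfolding eq by (rule g_smooth)
  show "?L = (\<lambda>p vs. divergence M W X p * W p vs)" unfolding eq by (rule Lg)
qed

lemma divergence_frame:
  assumes W: "volume_form M W" and X: "X \<in> vfields M" and fr: "frame N E x" and p: "p \<in> N"
    and J: "distinct J" "set J = Basis"
  shows "divergence M W X p * form_eval W (map E J) p =
    X p (form_eval W (map E J)) +
    (\<Sum>b\<in>Basis. E b p (\<lambda>r. X r (x b))) * form_eval W (map E J) p"
proof -
  have Wf: "W \<in> forms M DIM('e)" using W by (simp add: volume_form_def mdim_def)
  have "length (map E J) = DIM('e)" using J distinct_card by fastforce
  from lie_derivative_props(2)[OF Wf X this frame_vfields[OF fr], of p]
  have "form_eval (lie_derivative M DIM('e) X W) (map E J) p = lie_op X DIM('e) (form_eval W) (map E J) p" .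
  then show ?thesis
    using divergence_props(2)[OF W X] lie_op_frame[OF Wf X fr p J]
    by (simp add: form_eval_frame mdim_def)
qed

section \<open>The Poisson bracket\<close>

lemma wedge11_differential:
  "wedge11 M (differential M f) (differential M g) p vs =
    (if vs \<in> tuples M p 2 then (vs ! 0) f * (vs ! 1) g - (vs ! 1) f * (vs ! 0) g else 0)"
proof -
  have "[vs ! i] \<in> tuples M p 1" if "vs \<in> tuples M p 2" "i < 2" for i
    using that by (auto simp: tuples_def subset_eq)
  from this[of 0] this[of 1] show ?thesis by (simp add: wedge11_def differential_def)
qed

lemma wedge11_covectors: "wedge11 M (differential M f) (differential M g) p \<in> covectors M p 2"
  unfolding covectors_def
proof (intro CollectI conjI allI ballI impI)
  show "wedge11 M (differential M f) (differential M g) p vs = 0" if "vs \<notin> tuples M p 2" for vs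
    using that by (simp add: wedge11_def)
next
  fix us ws v w a b
  assume v: "v \<in> tangent M p" "w \<in> tangent M p" and t: "us @ v # ws \<in> tuples M p 2"
  have t': "us @ w # ws \<in> tuples M p 2" "us @ (\<lambda>f. a * v f + b * w f) # ws \<in> tuples M p 2"
    using t v tangent_comb[OF v] by (auto simp: tuples_def)
  have "length us + length ws = 1" using t by (simp add: tuples_def)
  then consider u where "us = []" "ws = [u]" | u where "us = [u]" "ws = []"
    by (cases us; cases ws) auto
  then show "wedge11 M (differential M f) (differential M g) p (us @ (\<lambda>f. a * v f + b * w f) # ws) =
     a * wedge11 M (differential M f) (differential M g) p (us @ v # ws) +
     b * wedge11 M (differential M f) (differential M g) p (us @ w # ws)"
    unfolding wedge11_differential using t t' by cases (simp_all add: algebra_simps)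
next
  fix vs :: "'a tvec list" and i j :: nat assume "i < j" "j < 2" "vs ! i = vs ! j"
  moreover then have "i = 0" "j = 1" by auto
  ultimately show "wedge11 M (differential M f) (differential M g) p vs = 0"
    by (simp add: wedge11_differential)
qed

lemma wedge11_forms:
  assumes "f \<in> smooth_funs M" "g \<in> smooth_funs M"
  shows "wedge11 M (differential M f) (differential M g) \<in> forms M 2"
  unfolding forms_def
proof (intro CollectI conjI allI impI)
  fix Xs assume *: "length Xs = 2" "set Xs \<subseteq> vfields M"
  then obtain X Y where Xs: "Xs = [X, Y]" by (auto simp: numeral_2_eq_2 length_Suc_conv)
  have XY: "X \<in> vfields M" "Y \<in> vfields M" using * Xs by auto
  have "form_eval (wedge11 M (differential M f) (differential M g)) Xs =
      (\<lambda>p. X p f * Y p g - Y p f * X p g)"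
    using XY vfieldsD by (simp add: form_eval_def wedge11_differential Xs tuples_def fun_eq_iff)
  then show "form_eval (wedge11 M (differential M f) (differential M g)) Xs \<in> smooth_funs M"
    using XY assms by (simp add: smooth_intros vfields_smooth)
qed (rule wedge11_covectors)

lemma differential_covectors: "differential M f p \<in> covectors M p 1"
  unfolding covectors_def
proof (intro CollectI conjI allI ballI impI)
  fix us ws v w a b
  assume v: "v \<in> tangent M p" "w \<in> tangent M p" and t: "us @ v # ws \<in> tuples M p 1"
  then have "us = []" "ws = []" by (auto simp: tuples_def)
  then show "differential M f p (us @ (\<lambda>f. a * v f + b * w f) # ws) =
     a * differential M f p (us @ v # ws) + b * differential M f p (us @ w # ws)"
    using v tangent_comb[OF v] by (simp add: differential_def tuples_def)
qed (auto simp: differential_def)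

lemma kvfieldsD: "\<pi> \<in> kvfields M k \<Longrightarrow> \<pi> p \<in> kvectors M p k"
  by (simp add: kvfields_def)

lemma kvfields_smooth: "\<pi> \<in> kvfields M k \<Longrightarrow> \<omega> \<in> forms M k \<Longrightarrow> (\<lambda>p. \<pi> p (\<omega> p)) \<in> smooth_funs M"
  by (simp add: kvfields_def)

lemma bracket_smooth:
  assumes "\<pi> \<in> kvfields M 2" "f \<in> smooth_funs M" "g \<in> smooth_funs M"
  shows "bracket M \<pi> f g \<in> smooth_funs M"
  unfolding bracket_def by (rule kvfields_smooth[OF assms(1) wedge11_forms[OF assms(2,3)]])

text \<open>The condition on h concerns derivations at p alone, so it covers sums with constants a,
  b as well as products, where a and b are the values of the factors at p.\<close>

lemma bracket_comb:
  assumes \<pi>: "\<pi> \<in> kvfields M 2" and "\<And>v. v \<in> tangent M p \<Longrightarrow> v h = a * v f + b * v g"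
  shows "bracket M \<pi> k h p = a * bracket M \<pi> k f p + b * bracket M \<pi> k g p"
proof -
  have "wedge11 M (differential M k) (differential M h) p = (\<lambda>vs.
      a * wedge11 M (differential M k) (differential M f) p vs +
      b * wedge11 M (differential M k) (differential M g) p vs)"
  proof
    fix vs
    have "vs ! 0 \<in> tangent M p" "vs ! 1 \<in> tangent M p" if "vs \<in> tuples M p 2"
      using that by (auto simp: tuples_def subset_eq)
    then show "wedge11 M (differential M k) (differential M h) p vs =
      a * wedge11 M (differential M k) (differential M f) p vs +
      b * wedge11 M (differential M k) (differential M g) p vs"
      using assms(2)[of "vs ! 0"] assms(2)[of "vs ! 1"]
      by (simp add: wedge11_differential algebra_simps)
  qed
  then show ?thesis
    unfolding bracket_def
    using kvectors_linear[OF kvfieldsD[OF \<pi>] wedge11_covectors wedge11_covectors covectors_comb[OF wedge11_covectors wedge11_covectors]]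
    by simp
qed

lemma bracket_antisym:
  assumes \<pi>: "\<pi> \<in> kvfields M 2"
  shows "bracket M \<pi> f g p = - bracket M \<pi> g f p"
proof -
  \<comment> \<open>The zero summand supplies the two-term shape of
    \<open>kvectors_linear\<close>.\<close>
  have "wedge11 M (differential M f) (differential M g) p = (\<lambda>vs.
      (-1) * wedge11 M (differential M g) (differential M f) p vs +
      0 * wedge11 M (differential M g) (differential M f) p vs)"
    by (auto simp: wedge11_differential fun_eq_iff)
  then show ?thesis
    unfolding bracket_def
    using kvectors_linear[OF kvfieldsD[OF \<pi>] wedge11_covectors wedge11_covectors covectors_comb[OF wedge11_covectors wedge11_covectors],
        where a = "-1" and b = 0]
    by simp
qed

lemma bracket_self: "\<pi> \<in> kvfields M 2 \<Longrightarrow> bracket M \<pi> f f p = 0"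
  using bracket_antisym[of \<pi> f f p] by simp

lemma bracket_lin:
  assumes "\<pi> \<in> kvfields M 2" "f \<in> smooth_funs M" "g \<in> smooth_funs M"
  shows "bracket M \<pi> k (\<lambda>x. a * f x + b * g x) p = a * bracket M \<pi> k f p + b * bracket M \<pi> k g p"
  by (rule bracket_comb[OF assms(1)]) (rule tangent_lin[OF _ assms(2,3)])

lemma bracket_mult:
  assumes "\<pi> \<in> kvfields M 2" "f \<in> smooth_funs M" "g \<in> smooth_funs M"
  shows "bracket M \<pi> k (\<lambda>x. f x * g x) p = f p * bracket M \<pi> k g p + g p * bracket M \<pi> k f p"
  by (rule bracket_comb[OF assms(1)]) (rule tangent_mult[OF _ assms(2,3)])

lemma bracket_lin_left:
  assumes "\<pi> \<in> kvfields M 2" "f \<in> smooth_funs M" "g \<in> smooth_funs M"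
  shows "bracket M \<pi> (\<lambda>x. a * f x + b * g x) k p = a * bracket M \<pi> f k p + b * bracket M \<pi> g k p"
  using bracket_lin[OF assms, of k a b p] bracket_antisym[OF assms(1), of _ k p] by simp

lemma bracket_mult_left:
  assumes "\<pi> \<in> kvfields M 2" "f \<in> smooth_funs M" "g \<in> smooth_funs M"
  shows "bracket M \<pi> (\<lambda>x. f x * g x) k p = f p * bracket M \<pi> g k p + g p * bracket M \<pi> f k p"
  using bracket_mult[OF assms, of k p] bracket_antisym[OF assms(1), of _ k p] by simp

lemma hamiltonian_vfields:
  assumes \<pi>: "\<pi> \<in> kvfields M 2" and f: "f \<in> smooth_funs M"
  shows "hamiltonian M \<pi> f \<in> vfields M"
  unfolding vfields_def tangent_def
  using bracket_smooth[OF \<pi> f] bracket_lin[OF \<pi>] bracket_mult[OF \<pi>]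
  by (auto simp: hamiltonian_def smooth_intros)

lemma bracket_frame:
  assumes \<pi>: "\<pi> \<in> kvfields M 2" and f: "f \<in> smooth_funs M" and g: "g \<in> smooth_funs M"
    and fr: "frame N E x" and p: "p \<in> N"
  shows "bracket M \<pi> f g p = (\<Sum>b\<in>Basis. bracket M \<pi> f (x b) p * E b p g)"
  using frameD(6)[OF fr p vfieldsD[OF hamiltonian_vfields[OF \<pi> f]], of g] g frameD(3)[OF fr]
  by (simp add: hamiltonian_def)

section \<open>The modular vector field and the curl\<close>

text \<open>Explicit candidate for the description \<open>modular_vfield\<close>, following the
  convention of \<open>tangent\<close> off the smooth functions.\<close>

definition modular :: "'a kvfield \<Rightarrow> 'a form \<Rightarrow> 'a vfield" where
  "modular \<pi> W = (\<lambda>p f. if f \<in> smooth_funs M then divergence M W (hamiltonian M \<pi> f) p else 0)"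

lemma modular_frame:
  assumes \<pi>: "\<pi> \<in> kvfields M 2" and W: "volume_form M W" and f: "f \<in> smooth_funs M"
    and fr: "frame N E x" and p: "p \<in> N" and J: "distinct J" "set J = Basis"
  shows "modular \<pi> W p f * form_eval W (map E J) p =
    bracket M \<pi> f (form_eval W (map E J)) p +
    (\<Sum>b\<in>Basis. E b p (bracket M \<pi> f (x b))) * form_eval W (map E J) p"
proof -
  have "length (map E J) = mdim M" using J distinct_card by (fastforce simp: mdim_def)
  then have "form_eval W (map E J) \<in> smooth_funs M"
    using W frame_vfields[OF fr] by (intro forms_smooth) (auto simp: volume_form_def)
  then show ?thesis
    using divergence_frame[OF W hamiltonian_vfields[OF \<pi> f] fr p J] f frameD(3)[OF fr]
    by (simp add: modular_def hamiltonian_def)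
qed

text \<open>Both derivation laws are checked after multiplication by the density of W in a frame,
  which is nonzero at p, where \<open>modular_frame\<close> gives a formula.\<close>

lemma modular_vfields:
  assumes \<pi>: "\<pi> \<in> kvfields M 2" and W: "volume_form M W"
  shows "modular \<pi> W \<in> vfields M"
  unfolding vfields_def
proof (intro CollectI conjI allI ballI)
  fix f assume "f \<in> smooth_funs M"
  then show "(\<lambda>p. modular \<pi> W p f) \<in> smooth_funs M"
    using divergence_props(1)[OF W hamiltonian_vfields[OF \<pi>]] by (simp add: modular_def)
next
  fix p
  obtain N E x where fr: "frame N E x" and p: "p \<in> N" by (rule frame_ex)
  obtain J :: "'e list" where J: "distinct J" "set J = Basis" using finite_distinct_list[OF finite_Basis] by blast
  let ?w = "form_eval W (map E J)"
  have w: "?w p \<noteq> 0" by (rule volume_form_frame[OF W fr p J])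
  note mf = modular_frame[OF \<pi> W _ fr p J]
  note tE = frameD(4)[OF fr, of _ p]
  have bs: "bracket M \<pi> f (x b) \<in> smooth_funs M" if "f \<in> smooth_funs M" for f b
    by (rule bracket_smooth[OF \<pi> that frameD(3)[OF fr]])
  show "modular \<pi> W p \<in> tangent M p"
    unfolding tangent_def
  proof (intro CollectI conjI allI ballI impI)
    show "modular \<pi> W p f = 0" if "f \<notin> smooth_funs M" for f using that by (simp add: modular_def)
  next
    fix f g a b assume f: "f \<in> smooth_funs M" and g: "g \<in> smooth_funs M"
    have s: "(\<lambda>x. a * f x + b * g x) \<in> smooth_funs M" using f g by (intro smooth_intros)
    have "bracket M \<pi> (\<lambda>x. a * f x + b * g x) (x c) =
        (\<lambda>q. a * bracket M \<pi> f (x c) q + b * bracket M \<pi> g (x c) q)" for c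
      using bracket_lin_left[OF \<pi> f g] by blast
    then have "modular \<pi> W p (\<lambda>x. a * f x + b * g x) * ?w p = (a * modular \<pi> W p f + b * modular \<pi> W p g) * ?w p"
      using mf[OF f] mf[OF g]
      by (simp add: mf[OF s] bracket_lin_left[OF \<pi> f g] tangent_lin[OF tE bs[OF f] bs[OF g]]
          sum.distrib sum_distrib_left[symmetric] distrib_right mult.assoc distrib_left)
    then show "modular \<pi> W p (\<lambda>x. a * f x + b * g x) = a * modular \<pi> W p f + b * modular \<pi> W p g"
      using w by simp
  next
    fix f g assume f: "f \<in> smooth_funs M" and g: "g \<in> smooth_funs M"
    have s: "(\<lambda>x. f x * g x) \<in> smooth_funs M" using f g by (intro smooth_intros)
    have "E c p (bracket M \<pi> (\<lambda>x. f x * g x) (x c)) =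
        f p * E c p (bracket M \<pi> g (x c)) + g p * E c p (bracket M \<pi> f (x c)) +
        (bracket M \<pi> g (x c) p * E c p f + bracket M \<pi> f (x c) p * E c p g)" for c
    proof -
      have "bracket M \<pi> (\<lambda>x. f x * g x) (x c) =
          (\<lambda>q. f q * bracket M \<pi> g (x c) q + g q * bracket M \<pi> f (x c) q)"
        using bracket_mult_left[OF \<pi> f g] by blast
      then show ?thesis
        using f g bs by (simp add: tangent_add[OF tE] tangent_mult[OF tE] smooth_intros)
    qed
    \<comment> \<open>By \<open>bracket_frame\<close> the terms in which E c differentiates f or g
      add up to {g, f} + {f, g}, the only obstruction to the Leibniz rule.\<close>
    then have "(\<Sum>c\<in>Basis. E c p (bracket M \<pi> (\<lambda>x. f x * g x) (x c))) =
        f p * (\<Sum>c\<in>Basis. E c p (bracket M \<pi> g (x c))) + g p * (\<Sum>c\<in>Basis. E c p (bracket M \<pi> f (x c))) +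
        (bracket M \<pi> g f p + bracket M \<pi> f g p)"
      using bracket_frame[OF \<pi> f g fr p] bracket_frame[OF \<pi> g f fr p]
      by (simp add: sum.distrib sum_distrib_left)
    also have "bracket M \<pi> g f p + bracket M \<pi> f g p = 0" using bracket_antisym[OF \<pi>, of g f p] by simp
    finally have S: "(\<Sum>c\<in>Basis. E c p (bracket M \<pi> (\<lambda>x. f x * g x) (x c))) =
        f p * (\<Sum>c\<in>Basis. E c p (bracket M \<pi> g (x c))) + g p * (\<Sum>c\<in>Basis. E c p (bracket M \<pi> f (x c)))"
      by simp
    have "modular \<pi> W p (\<lambda>x. f x * g x) * ?w p =
        f p * (modular \<pi> W p g * ?w p) + g p * (modular \<pi> W p f * ?w p)"
      unfolding mf[OF s] mf[OF f] mf[OF g] S bracket_mult_left[OF \<pi> f g, of ?w p]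
      by (simp add: algebra_simps)
    then have "modular \<pi> W p (\<lambda>x. f x * g x) * ?w p = (f p * modular \<pi> W p g + g p * modular \<pi> W p f) * ?w p"
      by (simp add: algebra_simps)
    then show "modular \<pi> W p (\<lambda>x. f x * g x) = f p * modular \<pi> W p g + g p * modular \<pi> W p f"
      using w by simp
  qed
qed

lemma modular_vfield_eq:
  assumes \<pi>: "\<pi> \<in> kvfields M 2" and W: "volume_form M W"
  shows "modular_vfield M \<pi> W = modular \<pi> W"
  unfolding modular_vfield_def
proof (rule the_equality)
  show "modular \<pi> W \<in> vfields M \<and>
      (\<forall>f\<in>smooth_funs M. divergence M W (hamiltonian M \<pi> f) = (\<lambda>p. modular \<pi> W p f))"
    using modular_vfields[OF assms] by (simp add: modular_def)
  fix X assume X: "X \<in> vfields M \<and>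
      (\<forall>f\<in>smooth_funs M. divergence M W (hamiltonian M \<pi> f) = (\<lambda>p. X p f))"
  show "X = modular \<pi> W"
  proof (intro ext)
    fix p f
    have "X p \<in> tangent M p" using X vfieldsD by blast
    then show "X p f = modular \<pi> W p f"
      using X tangent_nonsmooth by (cases "f \<in> smooth_funs M") (auto simp: modular_def)
  qed
qed

text \<open>The left-hand side is the value of $d (i_\pi W)$ on the coordinate
  fields \<open>E b\<close> with \<open>b \<noteq> c\<close>, whose brackets vanish.\<close>

lemma sum_bracket_frame:
  assumes \<pi>: "\<pi> \<in> kvfields M 2" and W: "volume_form M W"
    and fr: "frame N E x" and p: "p \<in> N" and J: "distinct J" "set J = Basis"
    and c: "c \<in> Basis"
  shows "(\<Sum>b\<in>Basis. E b p (\<lambda>q. form_eval W (map E J) q * bracket M \<pi> (x c) (x b) q)) =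
    modular \<pi> W p (x c) * form_eval W (map E J) p"
proof -
  let ?w = "form_eval W (map E J)"
  note xs = frameD(3)[OF fr]
  have "length (map E J) = mdim M" using J distinct_card by (fastforce simp: mdim_def)
  then have ws: "?w \<in> smooth_funs M"
    using W frame_vfields[OF fr] by (intro forms_smooth) (auto simp: volume_form_def)
  have "E b p (\<lambda>q. ?w q * bracket M \<pi> (x c) (x b) q) =
      ?w p * E b p (bracket M \<pi> (x c) (x b)) + bracket M \<pi> (x c) (x b) p * E b p ?w" for b
    by (rule tangent_mult[OF frameD(4)[OF fr] ws bracket_smooth[OF \<pi> xs xs]])
  \<comment> \<open>The terms that differentiate the density add up to the bracket of x c with it,
    by \<open>bracket_frame\<close>.\<close>
  then have "(\<Sum>b\<in>Basis. E b p (\<lambda>q. ?w q * bracket M \<pi> (x c) (x b) q)) =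
      ?w p * (\<Sum>b\<in>Basis. E b p (bracket M \<pi> (x c) (x b))) + bracket M \<pi> (x c) ?w p"
    by (simp add: sum.distrib sum_distrib_left bracket_frame[OF \<pi> xs ws fr p])
  then show ?thesis using modular_frame[OF \<pi> W xs fr p J] by (simp add: algebra_simps)
qed

text \<open>Filling all slots of \<omega> but two with the frame vectors of R leaves a 2-covector
  that vanishes as soon as an index from R is inserted. It is therefore a multiple of dx_c \<and>
  dx_d, and A is linear.\<close>

lemma kvector_two_frame:
  assumes A: "A \<in> kvectors M p 2" and \<omega>: "\<omega> \<in> covectors M p DIM('e)"
    and fr: "frame N E x" and p: "p \<in> N"
    and R: "distinct (c # d # R)" "set (c # d # R) = Basis"
  shows "A (\<lambda>us. \<omega> (us @ map (\<lambda>b. E b p) R)) =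
    \<omega> (map (\<lambda>b. E b p) (c # d # R)) * A (wedge11 M (differential M (x c)) (differential M (x d)) p)"
proof -
  let ?E = "map (\<lambda>b. E b p)"
  let ?\<omega>2 = "\<lambda>us. \<omega> (us @ ?E R)"
  let ?w = "wedge11 M (differential M (x c)) (differential M (x d)) p"
  let ?k = "\<omega> (?E (c # d # R))"
  have n: "DIM('e) = 2 + length R" using R distinct_card[OF R(1)] by simp
  have t: "?E R \<in> tuples M p (length R)" using frameD(4)[OF fr] by (auto simp: tuples_def)
  have \<omega>2: "?\<omega>2 \<in> covectors M p 2"
    by (rule covectors_append_right[OF _ t]) (use \<omega> n in simp)
  have "(\<lambda>us. 1 * ?\<omega>2 us + (- ?k) * ?w us) = (\<lambda>us. 0)"
  proof (rule covector_zeroI[OF covectors_comb[OF \<omega>2 wedge11_covectors] fr p])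
    fix I :: "'e list" assume I: "length I = 2" "set I \<subseteq> Basis" "distinct I"
    then obtain i j where ij: "I = [i, j]" by (auto simp: numeral_2_eq_2 length_Suc_conv)
    have b: "i \<in> Basis" "j \<in> Basis" "i \<noteq> j" "c \<in> Basis" "d \<in> Basis" "c \<noteq> d" using I R ij by auto
    have w: "?w (?E [i, j]) = (if i = c then 1 else 0) * (if j = d then 1 else 0) -
        (if j = c then 1 else 0) * (if i = d then 1 else 0)"
      using frameD(4)[OF fr] by (simp add: wedge11_differential tuples_def frameD(5)[OF fr p] b)
    have "?\<omega>2 (?E [i, j]) = ?k * ?w (?E [i, j])"
    proof (cases "i \<in> set R \<or> j \<in> set R")
      case True
      then have "\<not> distinct (?E ([i, j] @ R))" by (auto simp: distinct_map)
      then have "\<omega> (?E ([i, j] @ R)) = 0"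
        by (intro altern_repeat[OF covectors_altern[OF \<omega>]]) (use frameD(4)[OF fr] n in auto)
      moreover have "?w (?E [i, j]) = 0" unfolding w using True R by auto
      ultimately show ?thesis by simp
    next
      case False
      then have "i \<in> {c, d}" "j \<in> {c, d}" using b R by auto
      with b consider "i = c" "j = d" | "i = d" "j = c" by blast
      then show ?thesis
      proof cases
        case 1
        then show ?thesis unfolding w using b by simp
      next
        case 2
        have "\<omega> ([] @ E d p # E c p # ?E R) = - \<omega> ([] @ E c p # E d p # ?E R)"
          by (rule altern_swap[OF covectors_altern[OF \<omega>]]) (use frameD(4)[OF fr] n in auto)
        then show ?thesis unfolding w using 2 b by simp
      qed
    qed
    then show "1 * ?\<omega>2 (?E I) + (- ?k) * ?w (?E I) = 0" by (simp add: ij)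
  qed
  then have "?\<omega>2 = (\<lambda>us. ?k * ?w us + 0 * ?w us)" by (simp add: fun_eq_iff)
  then show ?thesis
    using kvectors_linear[OF A wedge11_covectors wedge11_covectors covectors_comb[OF wedge11_covectors wedge11_covectors],
        where a = ?k and b = 0]
    by simp
qed

section \<open>Scaling by functions, and contraction with a volume form\<close>

lemma kvectors_scale: "A \<in> kvectors M p k \<Longrightarrow> (\<lambda>\<omega>. s * A \<omega>) \<in> kvectors M p k"
proof (induction rule: kvectors.induct)
  case zero
  then show ?case using kvectors.zero by simp
next
  case (add vs A c)
  from kvectors.add[OF add(1) add(3), of "s * c"] show ?case by (simp add: algebra_simps)
qed

lemma kvfields_fscale:
  assumes "\<pi> \<in> kvfields M k" "m \<in> smooth_funs M"
  shows "fscale m \<pi> \<in> kvfields M k"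
  using assms unfolding kvfields_def fscale_def by (auto intro: kvectors_scale smooth_mult)

lemma forms_fscale:
  assumes "\<omega> \<in> forms M k" "m \<in> smooth_funs M"
  shows "fscale m \<omega> \<in> forms M k"
  unfolding forms_def
proof (intro CollectI conjI allI impI)
  show "fscale m \<omega> p \<in> covectors M p k" for p
    using covectors_comb[OF formsD[OF assms(1)] formsD[OF assms(1)], where a = "m p" and b = 0] by (simp add: fscale_def)
  fix Xs assume "length Xs = k" "set Xs \<subseteq> vfields M"
  then show "form_eval (fscale m \<omega>) Xs \<in> smooth_funs M"
    using smooth_mult[OF assms(2) forms_smooth[OF assms(1)]] by (simp add: form_eval_def fscale_def)
qed

lemma volume_form_fscale:
  assumes "volume_form M V" "m \<in> smooth_funs M" "\<forall>p. m p > 0"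
  shows "volume_form M (fscale m V)"
  unfolding volume_form_def
proof (intro conjI allI)
  show "fscale m V \<in> forms M (mdim M)" using assms forms_fscale by (simp add: volume_form_def)
  fix p
  obtain vs where "V p vs \<noteq> 0" using assms(1) by (auto simp: volume_form_def)
  moreover have "m p \<noteq> 0" using assms(3) by (metis less_irrefl)
  ultimately show "\<exists>vs. fscale m V p vs \<noteq> 0" by (auto simp: fscale_def)
qed

text \<open>For smoothness the fields Xs are frozen: what remains of V is a k-form, and pairing it
  with A is smooth by the definition of \<open>kvfields\<close>.\<close>

lemma flat_forms:
  assumes A: "A \<in> kvfields M k" and V: "V \<in> forms M DIM('e)"
  shows "flat M V k A \<in> forms M (DIM('e) - k)"
  unfolding forms_def
proof (intro CollectI conjI allI impI)
  show c: "flat M V k A p \<in> covectors M p (DIM('e) - k)" for p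
    using contraction_covectors[OF kvfieldsD[OF A] formsD[OF V]] by (simp add: flat_def mdim_def)
  fix Xs assume Xs: "length Xs = DIM('e) - k" "set Xs \<subseteq> vfields M"
  show "form_eval (flat M V k A) Xs \<in> smooth_funs M"
  proof (cases "k \<le> DIM('e)")
    case False
    then show ?thesis
      by (simp add: form_eval_def[abs_def] flat_def contraction_def mdim_def smooth_const)
  next
    case True
    have t: "map (\<lambda>X. X p) Xs \<in> tuples M p (DIM('e) - k)" for p
      using Xs vfieldsD by (auto simp: tuples_def)
    define \<omega> where "\<omega> = (\<lambda>p us. V p (us @ map (\<lambda>X. X p) Xs))"
    have "\<omega> \<in> forms M k"
      unfolding forms_def
    proof (intro CollectI conjI allI impI)
      show "\<omega> p \<in> covectors M p k" for p
        unfolding \<omega>_def by (rule covectors_append_right[OF _ t]) (use formsD[OF V] True in simp)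
      fix Ys assume "length Ys = k" "set Ys \<subseteq> vfields M"
      with Xs True have "form_eval V (Ys @ Xs) \<in> smooth_funs M" by (intro forms_smooth[OF V]) auto
      then show "form_eval \<omega> Ys \<in> smooth_funs M" by (simp add: form_eval_def \<omega>_def)
    qed
    moreover have "form_eval (flat M V k A) Xs = (\<lambda>p. A p (\<omega> p))"
      using contraction_apply[OF kvfieldsD[OF A] formsD[OF V] True t]
      by (simp add: form_eval_def[abs_def] flat_def mdim_def \<omega>_def)
    ultimately show ?thesis using kvfields_smooth[OF A] by simp
  qed
qed

text \<open>In degree 1 a linear combination of decomposables is decomposable, so a 1-vector is
  evaluation at one tangent vector.\<close>

lemma kvectors_one:
  assumes "A \<in> kvectors M p 1"
  obtains v where "v \<in> tangent M p" "\<And>\<omega>. \<omega> \<in> covectors M p 1 \<Longrightarrow> A \<omega> = \<omega> [v]"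
    "\<And>\<omega>. \<omega> \<notin> covectors M p 1 \<Longrightarrow> A \<omega> = 0"
proof -
  have "\<exists>v\<in>tangent M p. \<forall>\<omega>. A \<omega> = (if \<omega> \<in> covectors M p 1 then \<omega> [v] else 0)"
    using assms
  proof (induction rule: kvectors.induct)
    case zero
    have "\<omega> [\<lambda>f. 0] = 0" if "\<omega> \<in> covectors M p 1" for \<omega>
      using covectors_lin[OF that tangent_zero tangent_zero, of "[]" "[]" 0 0] by simp
    then show ?case using tangent_zero by (intro bexI[of _ "\<lambda>f. 0"]) auto
  next
    case (add vs A c)
    from add.IH obtain v where v: "v \<in> tangent M p" "\<And>\<omega>. A \<omega> = (if \<omega> \<in> covectors M p 1 then \<omega> [v] else 0)"
      by blast
    obtain u where u: "vs = [u]" "u \<in> tangent M p"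
      using add(1) by (auto simp: tuples_def length_Suc_conv)
    have "\<omega> [\<lambda>f. c * u f + 1 * v f] = c * \<omega> [u] + 1 * \<omega> [v]" if "\<omega> \<in> covectors M p 1" for \<omega>
      using covectors_lin[OF that u(2) v(1), of "[]" "[]" c 1] by simp
    then show ?case using tangent_comb[OF u(2) v(1), of c 1]
      by (intro bexI[of _ "\<lambda>f. c * u f + 1 * v f"]) (auto simp: decomp_def u v(2))
  qed
  then show ?thesis using that by auto
qed

text \<open>Every component of v other than the c-th repeats a frame vector already in the
  list.\<close>

lemma covector_contract_frame:
  assumes \<omega>: "\<omega> \<in> covectors M p DIM('e)" and fr: "frame N E x" and p: "p \<in> N"
    and v: "v \<in> tangent M p" and I: "distinct (c # I)" "set (c # I) = Basis"
  shows "\<omega> (v # map (\<lambda>b. E b p) I) = v (x c) * \<omega> (map (\<lambda>b. E b p) (c # I))"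
proof -
  let ?E = "map (\<lambda>b. E b p)"
  have n: "length (c # I) = DIM('e)" using I distinct_card[OF I(1)] by simp
  have z: "\<omega> (E b p # ?E I) = 0" if "b \<in> Basis" "b \<noteq> c" for b
  proof -
    have "\<not> distinct (?E (b # I))" using that I by auto
    then have "\<omega> (?E (b # I)) = 0"
      using altern_repeat[OF covectors_altern[OF \<omega>], of "?E (b # I)"] frameD(4)[OF fr] n by auto
    then show ?thesis by simp
  qed
  have v_eq: "v = (\<lambda>f. \<Sum>b\<in>Basis. v (x b) * E b p f)" using frameD(6)[OF fr p v] by blast
  have "\<omega> ([] @ v # ?E I) = (\<Sum>b\<in>Basis. v (x b) * \<omega> ([] @ E b p # ?E I))"
    by (subst v_eq, rule covectors_sum[OF \<omega> finite_Basis]) (use frameD(4)[OF fr] n in auto)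
  also have "\<dots> = (\<Sum>b\<in>{c}. v (x b) * \<omega> ([] @ E b p # ?E I))"
    by (rule sum.mono_neutral_right) (use I z in auto)
  finally show ?thesis by simp
qed

text \<open>The factor s is 1 in \<open>flat_inj\<close> and m p in \<open>curl_eq\<close>, where
  the field to be recovered is m times the modular field.\<close>

lemma flat_one_apply:
  assumes V: "V \<in> forms M DIM('e)" and A: "A \<in> kvectors M p 1"
    and v: "v \<in> tangent M p" "\<And>\<omega>. \<omega> \<in> covectors M p 1 \<Longrightarrow> A \<omega> = s * \<omega> [v]"
    and vs: "vs \<in> tuples M p (DIM('e) - 1)"
  shows "contraction M p 1 DIM('e) A (V p) vs = s * V p (v # vs)"
proof -
  have n: "1 \<le> DIM('e)" using DIM_positive[where 'a = 'e] by simp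
  have "(\<lambda>us. V p (us @ vs)) \<in> covectors M p 1"
    by (rule covectors_append_right[OF _ vs]) (use formsD[OF V] n in simp)
  then show ?thesis using contraction_apply[OF A formsD[OF V] n vs] v(2) by simp
qed

text \<open>Evaluating on all frame vectors except the c-th isolates the c-th component, up to the
  nonzero density of V.\<close>

lemma flat_inj:
  assumes V: "volume_form M V"
  shows "inj_on (flat M V 1) (kvfields M 1)"
proof (rule inj_onI)
  fix A B assume A: "A \<in> kvfields M 1" and B: "B \<in> kvfields M 1" and eq: "flat M V 1 A = flat M V 1 B"
  have Vf: "V \<in> forms M DIM('e)" using V by (simp add: volume_form_def mdim_def)
  show "A = B"
  proof
    fix p
    obtain v where v: "v \<in> tangent M p" "\<And>\<omega>. \<omega> \<in> covectors M p 1 \<Longrightarrow> A p \<omega> = \<omega> [v]"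
      "\<And>\<omega>. \<omega> \<notin> covectors M p 1 \<Longrightarrow> A p \<omega> = 0" using kvectors_one[OF kvfieldsD[OF A]] by metis
    obtain w where w: "w \<in> tangent M p" "\<And>\<omega>. \<omega> \<in> covectors M p 1 \<Longrightarrow> B p \<omega> = \<omega> [w]"
      "\<And>\<omega>. \<omega> \<notin> covectors M p 1 \<Longrightarrow> B p \<omega> = 0" using kvectors_one[OF kvfieldsD[OF B]] by metis
    obtain N E x where fr: "frame N E x" and p: "p \<in> N" by (rule frame_ex)
    have "v (x c) = w (x c)" if c: "c \<in> Basis" for c
    proof -
      obtain I where I': "distinct I" "set I = Basis - {c}"
        using finite_distinct_list[of "Basis - {c}"] by auto
      then have I: "distinct (c # I)" "set (c # I) = Basis" using c by auto
      have t: "map (\<lambda>b. E b p) I \<in> tuples M p (DIM('e) - 1)"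
        using distinct_card[OF I(1)] I(2) frameD(4)[OF fr] by (auto simp: tuples_def)
      have "1 * V p (v # map (\<lambda>b. E b p) I) = 1 * V p (w # map (\<lambda>b. E b p) I)"
        using flat_one_apply[OF Vf kvfieldsD[OF A] v(1) _ t, of 1] v(2)
          flat_one_apply[OF Vf kvfieldsD[OF B] w(1) _ t, of 1] w(2) eq
        by (simp add: flat_def mdim_def fun_eq_iff)
      then have "v (x c) * V p (map (\<lambda>b. E b p) (c # I)) = w (x c) * V p (map (\<lambda>b. E b p) (c # I))"
        using covector_contract_frame[OF formsD[OF Vf] fr p v(1) I]
          covector_contract_frame[OF formsD[OF Vf] fr p w(1) I] by simp
      then show ?thesis using volume_form_frame[OF V fr p I] by (simp add: form_eval_def o_def)
    qed
    note vw = this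
    have "v = w"
    proof
      fix f
      have "v f = (\<Sum>b\<in>Basis. v (x b) * E b p f)" by (rule frameD(6)[OF fr p v(1)])
      also have "\<dots> = (\<Sum>b\<in>Basis. w (x b) * E b p f)" by (intro sum.cong refl) (simp add: vw)
      also have "\<dots> = w f" by (rule frameD(6)[OF fr p w(1), symmetric])
      finally show "v f = w f" .
    qed
    show "A p = B p"
    proof
      fix \<omega> show "A p \<omega> = B p \<omega>"
      proof (cases "\<omega> \<in> covectors M p 1")
        case True
        show ?thesis unfolding v(2)[OF True] w(2)[OF True] \<open>v = w\<close> by (rule refl)
      next
        case False
        show ?thesis unfolding v(3)[OF False] w(3)[OF False] by (rule refl)
      qed
    qed
  qed
qed

text \<open>The value of d(i_W-contraction of \<pi>) on all coordinate fields except the c-th, with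
  W = m V. Deleting the a-th field leaves the indices c and \<open>I ! a\<close> for \<pi>, so each
  Koszul term differentiates the density times one bracket, and \<open>sum_bracket_frame\<close>
  sums them up.\<close>

lemma koszul_frame:
  assumes \<pi>: "\<pi> \<in> kvfields M 2" and V: "volume_form M V" and m: "m \<in> smooth_funs M" "\<forall>p. m p > 0"
    and fr: "frame N E x" and p: "p \<in> N" and I: "distinct (c # I)" "set (c # I) = Basis"
    and l: "length I = Suc k"
  shows "koszul k (form_eval (flat M V 2 (fscale m \<pi>))) (map E I) p =
    modular \<pi> (fscale m V) p (x c) * form_eval (fscale m V) (map E (c # I)) p"
proof -
  let ?W = "fscale m V"
  let ?\<sigma> = "flat M V 2 (fscale m \<pi>)"
  let ?w = "form_eval ?W (map E (c # I))"
  have Vf: "V \<in> forms M DIM('e)" using V by (simp add: volume_form_def mdim_def)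
  have W: "volume_form M ?W" by (rule volume_form_fscale[OF V m])
  have Wf: "?W \<in> forms M DIM('e)" using W by (simp add: volume_form_def mdim_def)
  have mp: "fscale m \<pi> \<in> kvfields M 2" by (rule kvfields_fscale[OF \<pi> m(1)])
  have n: "DIM('e) = Suc (Suc k)" using distinct_card[OF I(1)] I(2) l by simp
  have \<sigma>: "?\<sigma> \<in> forms M k" using flat_forms[OF mp Vf] n by simp
  note xs = frameD(3)[OF fr]
  have ws: "?w \<in> smooth_funs M"
    by (rule forms_smooth[OF Wf]) (use n l frameD(2)[OF fr] in auto)
  \<comment> \<open>The sign comes from moving \<open>I ! a\<close> past the a entries before it in
    the arguments of V.\<close>
  have eval: "form_eval ?\<sigma> (map E (nths I (- {a}))) q =
      (-1) ^ a * (?w q * bracket M \<pi> (x c) (x (I ! a)) q)" if a: "a \<le> k" and q: "q \<in> N" for a q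
  proof -
    let ?R = "nths I (- {a})"
    let ?E = "map (\<lambda>b. E b q)"
    have I_eq: "I = take a I @ I ! a # drop (Suc a) I" using a l by (intro id_take_nth_drop) simp
    have R: "?R = take a I @ drop (Suc a) I" by (rule nths_remove)
    have d: "distinct (c # I ! a # ?R)" "set (c # I ! a # ?R) = Basis"
      using I unfolding R by (subst (asm) (1 2) I_eq, force)+
    have lR: "length ?R = k" using a l by (simp add: length_nths_remove)
    have t: "?E ?R \<in> tuples M q (DIM('e) - 2)"
      using n lR frameD(4)[OF fr] by (auto simp: tuples_def)
    have "form_eval ?\<sigma> (map E ?R) q = m q * \<pi> q (\<lambda>us. V q (us @ ?E ?R))"
      using contraction_apply[OF kvfieldsD[OF mp] formsD[OF Vf] _ t] n
      by (simp add: form_eval_frame flat_def mdim_def fscale_def)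
    also have "\<dots> = m q * (V q (?E (c # I ! a # ?R)) * bracket M \<pi> (x c) (x (I ! a)) q)"
      using kvector_two_frame[OF kvfieldsD[OF \<pi>] formsD[OF Vf] fr q d] by (simp add: bracket_def)
    also have "V q (?E (c # I ! a # ?R)) = (-1) ^ a * V q (?E (c # I))"
    proof -
      \<comment> \<open>E c stays in front as a frozen prefix while \<open>I ! a\<close> is
        moved.\<close>
      have "altern (tangent M q) (\<lambda>v w f. v f + w f) (length [E c q] + Suc k) (V q)"
        using covectors_altern[OF formsD[OF Vf]] n by simp
      from altern_move[OF altern_prefix[OF this], of "E (I ! a) q" "?E (take a I)" "?E (drop (Suc a) I)"]
      have "V q ([E c q] @ ?E (take a I) @ E (I ! a) q # ?E (drop (Suc a) I)) =
          (-1) ^ a * V q ([E c q] @ E (I ! a) q # ?E (take a I) @ ?E (drop (Suc a) I))"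
        using frameD(4)[OF fr] a l by (auto simp: min_def)
      moreover have "?E (take a I) @ E (I ! a) q # ?E (drop (Suc a) I) = ?E I"
        by (subst (4) I_eq) simp
      ultimately show ?thesis by (simp add: R)
    qed
    finally show ?thesis by (simp add: form_eval_def fscale_def o_def mult_ac)
  qed
  \<comment> \<open>\<open>eval\<close> holds on N only; differentiating it at p uses locality of
    tangent vectors.\<close>
  have deriv_eval: "E (I ! a) p (form_eval ?\<sigma> (map E (nths I (- {a})))) =
      (-1) ^ a * E (I ! a) p (\<lambda>q. ?w q * bracket M \<pi> (x c) (x (I ! a)) q)" if a: "a \<le> k" for a
  proof -
    have s: "(\<lambda>q. ?w q * bracket M \<pi> (x c) (x (I ! a)) q) \<in> smooth_funs M"
      by (intro smooth_mult ws bracket_smooth[OF \<pi> xs xs])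
    have "E (I ! a) p (form_eval ?\<sigma> (map E (nths I (- {a})))) =
        E (I ! a) p (\<lambda>q. (-1) ^ a * (?w q * bracket M \<pi> (x c) (x (I ! a)) q))"
    proof (rule tangent_local[OF frameD(4)[OF fr] frameD(1)[OF fr] p eval[OF a]])
      show "form_eval ?\<sigma> (map E (nths I (- {a}))) \<in> smooth_funs M"
        by (rule forms_smooth[OF \<sigma>]) (use a l frameD(2)[OF fr] in \<open>auto simp: length_nths_remove\<close>)
    qed (use s in \<open>simp_all add: smooth_cmult\<close>)
    also have "\<dots> = (-1) ^ a * E (I ! a) p (\<lambda>q. ?w q * bracket M \<pi> (x c) (x (I ! a)) q)"
      by (rule tangent_cmult[OF frameD(4)[OF fr] s])
    finally show ?thesis .
  qed
  have br: "form_eval ?\<sigma> (lie_bracket M (E (I ! i)) (E (I ! j)) # map E (nths I (- {i, j}))) p = 0"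
    if ij: "i < j" "j \<le> k" for i j
  proof -
    have "I ! i \<in> set I" "I ! j \<in> set I" using ij l by simp_all
    then have Ib: "I ! i \<in> Basis" "I ! j \<in> Basis" unfolding I(2)[symmetric] by simp_all
    have "E (I ! j) p (\<lambda>r. E (I ! i) r (x d)) = 0" if d: "d \<in> Basis" for d
    proof -
      have "E (I ! j) p (\<lambda>r. E (I ! i) r (x d)) = E (I ! j) p (\<lambda>r. if I ! i = d then 1 else 0)"
        by (rule tangent_local[OF frameD(4)[OF fr] frameD(1)[OF fr] p])
          (use frameD(5)[OF fr _ Ib(1) d] frameD(2,3)[OF fr] vfields_smooth smooth_const in auto)
      then show ?thesis using tangent_const[OF frameD(4)[OF fr]] by simp
    qed
    then have "lie_bracket M (E (I ! i)) (E (I ! j)) p = (\<lambda>f. 0)"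
      using lie_bracket_frame[OF frameD(2)[OF fr] fr p Ib(2), of "I ! i"] by simp
    \<comment> \<open>The zero vector in the shape that \<open>covectors_lin\<close> gives it for
      two zero coefficients.\<close>
    moreover have "?\<sigma> p ([] @ (\<lambda>f. 0 * 0 + 0 * 0) # map (\<lambda>b. E b p) (nths I (- {i, j}))) = 0"
    proof -
      have "length (nths I (- {i, j})) = Suc k - 2" using ij l by (subst length_nths_remove(2)) auto
      then show ?thesis
        using covectors_lin[OF formsD[OF \<sigma>] tangent_zero tangent_zero, where us = "[]" and p = p and
            ws = "map (\<lambda>b. E b p) (nths I (- {i, j}))" and a = 0 and b = 0]
          ij frameD(4)[OF fr] by (simp add: image_subset_iff)
    qed
    ultimately show ?thesis by (simp add: form_eval_def o_def)
  qed
  have "koszul k (form_eval ?\<sigma>) (map E I) p =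
      (\<Sum>a\<le>k. (-1) ^ a * E (I ! a) p (form_eval ?\<sigma> (map E (nths I (- {a})))))"
    using l by (simp add: koszul_def nths_map br)
  \<comment> \<open>The sign from \<open>eval\<close> and the sign in the Koszul sum are both (-1)^a
    and multiply to 1.\<close>
  also have "\<dots> = (\<Sum>a<Suc k. E (I ! a) p (\<lambda>q. ?w q * bracket M \<pi> (x c) (x (I ! a)) q))"
    unfolding lessThan_Suc_atMost
    by (intro sum.cong refl) (simp add: deriv_eval power_mult_distrib[symmetric] mult.assoc[symmetric])
  also have "\<dots> = (\<Sum>b\<in>set I. E b p (\<lambda>q. ?w q * bracket M \<pi> (x c) (x b) q))"
    by (rule sum.reindex_bij_betw[OF bij_betw_nth]) (use I l in auto)
  \<comment> \<open>The missing index c may be added, since the bracket of x c with itself is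
    0.\<close>
  also have "\<dots> = (\<Sum>b\<in>Basis. E b p (\<lambda>q. ?w q * bracket M \<pi> (x c) (x b) q))"
  proof (rule sum.mono_neutral_left)
    have "E c p (\<lambda>q. ?w q * bracket M \<pi> (x c) (x c) q) = 0"
      by (simp add: bracket_self[OF \<pi>] tangent_const[OF frameD(4)[OF fr]])
    then show "\<forall>b\<in>Basis - set I. E b p (\<lambda>q. ?w q * bracket M \<pi> (x c) (x b) q) = 0" using I by auto
  qed (use I in auto)
  also have "\<dots> = modular \<pi> ?W p (x c) * ?w p"
    using sum_bracket_frame[OF \<pi> W fr p I] I by auto
  finally show ?thesis .
qed

text \<open>The right-hand side is m X, with X the modular field of m V, read as a 1-vector field.
  It suffices that contracting V with it gives d\<sigma>, because \<open>flat\<close> is injective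
  in degree 1.\<close>

lemma curl_eq:
  assumes \<pi>: "\<pi> \<in> kvfields M 2" and V: "volume_form M V" and m: "m \<in> smooth_funs M" "\<forall>p. m p > 0"
  shows "curl M V 2 (fscale m \<pi>) =
    (\<lambda>p \<omega>. if \<omega> \<in> covectors M p 1 then m p * \<omega> [modular \<pi> (fscale m V) p] else 0)"
proof -
  let ?X = "modular \<pi> (fscale m V)"
  let ?\<sigma> = "flat M V 2 (fscale m \<pi>)"
  define A where "A = (\<lambda>p \<omega>. if \<omega> \<in> covectors M p 1 then m p * \<omega> [?X p] else 0)"
  have Vf: "V \<in> forms M DIM('e)" using V by (simp add: volume_form_def mdim_def)
  have W: "volume_form M (fscale m V)" by (rule volume_form_fscale[OF V m])
  have mp: "fscale m \<pi> \<in> kvfields M 2" by (rule kvfields_fscale[OF \<pi> m(1)])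
  have X: "?X \<in> vfields M" by (rule modular_vfields[OF \<pi> W])
  have A_kv: "A \<in> kvfields M 1"
    unfolding kvfields_def
  proof (intro CollectI conjI allI ballI)
    fix p
    have t: "[?X p] \<in> tuples M p 1" using vfieldsD[OF X] by (simp add: tuples_def)
    have "A p = (\<lambda>\<omega>. m p * decomp M p [?X p] \<omega> + 0)" by (simp add: A_def decomp_def fun_eq_iff)
    then show "A p \<in> kvectors M p 1" using kvectors.add[OF t kvectors.zero] by simp
  next
    fix \<omega> assume \<omega>: "\<omega> \<in> forms M 1"
    then have "(\<lambda>p. A p (\<omega> p)) = (\<lambda>p. m p * form_eval \<omega> [?X] p)"
      using formsD[OF \<omega>] by (simp add: A_def form_eval_def)
    then show "(\<lambda>p. A p (\<omega> p)) \<in> smooth_funs M"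
      using smooth_mult[OF m(1) forms_smooth[OF \<omega>, of "[?X]"]] X by simp
  qed
  have \<sigma>: "?\<sigma> \<in> forms M (DIM('e) - 2)" by (rule flat_forms[OF mp Vf])
  have fA: "flat M V 1 A \<in> forms M (DIM('e) - 1)" by (rule flat_forms[OF A_kv Vf])
  have "ext_d M (DIM('e) - 2) ?\<sigma> = flat M V 1 A"
  proof (cases "DIM('e) = 1")
    \<comment> \<open>In dimension 1 the degree mdim M - 2 truncates to 0, so \<open>curl\<close>
      differentiates \<sigma> as a 0-form. Here \<sigma> = 0 because 2 exceeds the dimension, and
      the modular field vanishes too.\<close>
    case True
    obtain c :: 'e where c: "Basis = {c}" using True card_1_singletonE by blast
    \<comment> \<open>With one coordinate, every bracket is a multiple of the bracket of that
      coordinate with itself.\<close>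
    have b0: "bracket M \<pi> f g p = 0" if f: "f \<in> smooth_funs M" and g: "g \<in> smooth_funs M" for f g p
    proof -
      obtain N E x where fr: "frame N E x" and p: "p \<in> N" by (rule frame_ex)
      have "bracket M \<pi> f (x c) p = - bracket M \<pi> (x c) f p" by (rule bracket_antisym[OF \<pi>])
      also have "\<dots> = 0"
        using bracket_frame[OF \<pi> frameD(3)[OF fr] f fr p, of c] bracket_self[OF \<pi>] by (simp add: c)
      finally show ?thesis using bracket_frame[OF \<pi> f g fr p] by (simp add: c)
    qed
    have X0: "?X p f = 0" for p f
    proof (cases "f \<in> smooth_funs M")
      case True
      obtain N E x where fr: "frame N E x" and p: "p \<in> N" by (rule frame_ex)
      have J: "distinct [c]" "set [c] = Basis" by (simp_all add: c)
      have ws: "form_eval (fscale m V) (map E [c]) \<in> smooth_funs M"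
        using W frame_vfields[OF fr, of "[c]"] \<open>DIM('e) = 1\<close> by (intro forms_smooth) (auto simp: volume_form_def mdim_def)
      have "bracket M \<pi> f (x c) = (\<lambda>q. 0)" using b0[OF True frameD(3)[OF fr]] by blast
      with modular_frame[OF \<pi> W True fr p J] b0[OF True ws]
      have "?X p f * form_eval (fscale m V) (map E [c]) p = 0"
        by (simp add: c tangent_const[OF frameD(4)[OF fr]])
      then show ?thesis using volume_form_frame[OF W fr p J] by simp
    qed (simp add: modular_def)
    have "\<omega> [?X p] = 0" if "\<omega> \<in> covectors M p 1" for \<omega> p
      using covectors_lin[OF that tangent_zero tangent_zero, of "[]" "[]" 0 0] X0 by (simp add: fun_eq_iff)
        (metis X0 ext)
    then have A0: "A = (\<lambda>p \<omega>. 0)" by (auto simp: A_def fun_eq_iff)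
    have \<sigma>0: "?\<sigma> = (\<lambda>p vs. 0)" using True by (simp add: flat_def contraction_def mdim_def fun_eq_iff)
    have k0: "koszul 0 (form_eval (\<lambda>p vs. 0)) [Y] p = 0" if "Y \<in> vfields M" for Y p
      using tangent_const[OF vfieldsD[OF that]] by (simp add: koszul_def form_eval_def[abs_def])
    have "ext_d M 0 ?\<sigma> = (\<lambda>p vs. 0)"
    proof (rule forms_eqI)
      show "ext_d M 0 ?\<sigma> \<in> forms M 1" using ext_d_props(1)[of ?\<sigma> 0] \<sigma> True by simp
      show "(\<lambda>p vs. 0) \<in> forms M 1"
        by (simp add: forms_def covectors_zero form_eval_def[abs_def] smooth_const)
      show "form_eval (ext_d M 0 ?\<sigma>) Xs p = form_eval (\<lambda>p vs. 0) Xs p"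
        if Xs: "length Xs = 1" "set Xs \<subseteq> vfields M" for Xs p
      proof -
        obtain Y where Y: "Xs = [Y]" "Y \<in> vfields M" using Xs by (auto simp: length_Suc_conv)
        then show ?thesis
          using ext_d_props(2)[of ?\<sigma> 0 Xs p] \<sigma> True k0[of Y p] \<sigma>0 by (simp add: form_eval_def)
      qed
    qed
    moreover have "flat M V 1 A = (\<lambda>p vs. 0)"
      by (simp add: A0 flat_def contraction_def wedge_def fun_eq_iff)
    ultimately show ?thesis using True by simp
  next
    case False
    define k where "k = DIM('e) - 2"
    have n: "DIM('e) = Suc (Suc k)" unfolding k_def using False DIM_positive[where 'a = 'e] by linarith
    have \<sigma>k: "?\<sigma> \<in> forms M k" using \<sigma> by (simp add: k_def)
    have d: "ext_d M k ?\<sigma> \<in> forms M (Suc k)" by (rule ext_d_props(1)[OF \<sigma>k])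
    have fAk: "flat M V 1 A \<in> forms M (Suc k)" using fA n by simp
    have "ext_d M k ?\<sigma> p = flat M V 1 A p" for p
    proof -
      obtain N E x where fr: "frame N E x" and p: "p \<in> N" by (rule frame_ex)
      have "(\<lambda>vs. 1 * ext_d M k ?\<sigma> p vs + (-1) * flat M V 1 A p vs) = (\<lambda>vs. 0)"
      proof (rule covector_zeroI[OF covectors_comb[OF formsD[OF d] formsD[OF fAk]] fr p])
        fix I :: "'e list" assume I: "length I = Suc k" "set I \<subseteq> Basis" "distinct I"
        \<comment> \<open>n - 1 distinct basis elements omit exactly one; it is the index c of
          \<open>koszul_frame\<close>.\<close>
        have "card (Basis - set I) = 1"
          using I n by (simp add: card_Diff_subset distinct_card)
        then obtain c where c: "Basis - set I = {c}" by (rule card_1_singletonE)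
        then have cI: "distinct (c # I)" "set (c # I) = Basis" using I by auto
        have t: "map (\<lambda>b. E b p) I \<in> tuples M p (DIM('e) - 1)"
          using I n frameD(4)[OF fr] by (auto simp: tuples_def)
        have "ext_d M k ?\<sigma> p (map (\<lambda>b. E b p) I) = koszul k (form_eval ?\<sigma>) (map E I) p"
          using ext_d_props(2)[OF \<sigma>k _ frame_vfields[OF fr, of I], of p] I by (simp add: form_eval_frame)
        also have "\<dots> = ?X p (x c) * form_eval (fscale m V) (map E (c # I)) p"
          by (rule koszul_frame[OF \<pi> V m fr p cI I(1)])
        also have "\<dots> = m p * V p (?X p # map (\<lambda>b. E b p) I)"
          using covector_contract_frame[OF formsD[OF Vf] fr p vfieldsD[OF X] cI]
          by (simp add: form_eval_def fscale_def o_def)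
        also have "\<dots> = flat M V 1 A p (map (\<lambda>b. E b p) I)"
          using flat_one_apply[OF Vf kvfieldsD[OF A_kv] vfieldsD[OF X] _ t, of "m p"]
          by (simp add: flat_def mdim_def A_def)
        finally show "1 * ext_d M k ?\<sigma> p (map (\<lambda>b. E b p) I) +
            (-1) * flat M V 1 A p (map (\<lambda>b. E b p) I) = 0" by simp
      qed
      then show ?thesis by (simp add: fun_eq_iff)
    qed
    then show ?thesis by (auto simp: k_def)
  qed
  \<comment> \<open>\<open>natural\<close> is taken in degree 2 - 1 = 1, and the exhibited preimage
    A is recovered by injectivity.\<close>
  then have "curl M V 2 (fscale m \<pi>) = inv_into (kvfields M 1) (flat M V 1) (flat M V 1 A)"
    by (simp add: curl_def natural_def mdim_def)
  also have "\<dots> = A" by (rule inv_into_f_f[OF flat_inj[OF V] A_kv])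
  finally show ?thesis by (simp add: A_def)
qed

end

text \<open>After \<open>curl_eq\<close> and \<open>modular_vfield_eq\<close> it remains to see that
  m X, as a functional on 1-covectors, vanishes exactly when X does.\<close>

theorem proposition3p3:
  fixes M :: "('a::{t2_space,second_countable_topology}, 'e::euclidean_space) atlas"
    and V :: "'a form" and \<pi> :: "'a kvfield" and m :: "'a \<Rightarrow> real"
  assumes "smooth_manifold M"
    and "volume_form M V"
    and "poisson_bivector M \<pi>"
    and "m \<in> smooth_funs M"
    and "\<forall>p. m p > 0"
  shows "last_multiplier M \<pi> V m \<longleftrightarrow> modular_vfield M \<pi> (fscale m V) = (\<lambda>p f. 0)"
proof -
  interpret smooth_mfd M by (rule smooth_mfd.intro) (rule assms(1))
  have \<pi>: "\<pi> \<in> kvfields M 2" using assms(3) by (simp add: poisson_bivector_def)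
  have W: "volume_form M (fscale m V)" by (rule volume_form_fscale[OF assms(2,4,5)])
  let ?X = "modular \<pi> (fscale m V)"
  have X: "?X p \<in> tangent M p" for p by (rule vfieldsD[OF modular_vfields[OF \<pi> W]])
  have "(\<forall>p. \<forall>\<omega>\<in>covectors M p 1. m p * \<omega> [?X p] = 0) \<longleftrightarrow> ?X = (\<lambda>p f. 0)"
  proof
    assume *: "\<forall>p. \<forall>\<omega>\<in>covectors M p 1. m p * \<omega> [?X p] = 0"
    show "?X = (\<lambda>p f. 0)"
    proof (intro ext)
      fix p f
      \<comment> \<open>Pairing with df recovers X f, so the differentials detect every tangent
        vector.\<close>
      have "m p * differential M f p [?X p] = 0" using * differential_covectors by blast
      moreover have "m p \<noteq> 0" using assms(5) by (metis less_irrefl)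
      ultimately show "?X p f = 0" using X by (simp add: differential_def tuples_def)
    qed
  next
    assume *: "?X = (\<lambda>p f. 0)"
    show "\<forall>p. \<forall>\<omega>\<in>covectors M p 1. m p * \<omega> [?X p] = 0"
    proof (intro allI ballI)
      fix p \<omega> assume "\<omega> \<in> covectors M p 1"
      then have "\<omega> [\<lambda>f. 0] = 0"
        using covectors_lin[OF _ tangent_zero tangent_zero, of \<omega> p 1 "[]" "[]" 0 0] by simp
      then show "m p * \<omega> [?X p] = 0" by (simp add: *)
    qed
  qed
  then show ?thesis
    unfolding last_multiplier_def curl_eq[OF \<pi> assms(2,4,5)] modular_vfield_eq[OF \<pi> W]
    by (auto simp: fun_eq_iff split: if_splits)
qed

end
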